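(* Let $\sigma\colon\Gamma\to2^V$ be a quasi-geometric homology triangulation of a simplex and $E$ a face of $\Gamma$ with $\ell(\Gamma,E)=0$. Suppose $F\in\mathrm{lk}_\Gamma(E)$ has an interior partition $F=F_1\sqcup F_2\sqcup\mathcal{A}_F$ with $|F_1|\le2$. Then $F$ is a $U$-pyramid.
   Context: Fix an infinite field $k$; homology is with coefficients in $k$. A $d$-dimensional simplicial complex $\Gamma$ with trivial reduced homology is a homology ball of dimension $d$ if there is a subcomplex $\partial\Gamma$ such that $\partial\Gamma$ is a homology sphere of dimension $d-1$, $\mathrm{lk}_\Gamma(F)$ is a homology sphere of dimension $d-|F|$ for $F\notin\partial\Gamma$, and $\mathrm{lk}_\Gamma(F)$ is a homology ball of dimension $d-|F|$ for nonempty $F\in\partial\Gamma$; its interior faces are those not in $\partial\Gamma$. A homology triangulation of $2^V$ is a finite simplicial complex $\Gamma$ with $\sigma\colon\Gamma\to2^V$ such that for every nonempty $U\subset V$, $\Gamma_U:=\sigma^{-1}(2^U)$ is a homology ball of dimension $|U|-1$ whose interior faces are exactly $\sigma^{-1}(U)$. $\sigma(F)$ is the carrier; $\sigma(w)=\sigma(\{w\})$. It is quasi-geometric if there is no face $F$ and $U\subset V$ with $\dim\Gamma_U<\dim F$ and $\sigma(w)\subset U$ for all vertices $w\in F$. $U^c=V\smallsetminus U$. A face $G$ is interior if $\sigma(G)=V$. $k[\Delta]$ is the face ring (variables $x_w$, $x^F=\prod_{w\in F}x_w$), graded by degree. An l.s.o.p. for a finitely generated graded $k$-algebra of Krull dimension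 $d$ is a sequence of $d$ degree-one elements with finite-dimensional quotient. For a face $E$, an l.s.o.p. $\theta_1,\ldots,\theta_d$ of $k[\mathrm{lk}_\Gamma(E)]$ ($d=|V|-|E|$) is special if for each $v\in V\smallsetminus\sigma(E)$ there is an element $\theta_v$ of it supported on vertices $w$ with $v\in\sigma(w)$, with $\theta_v\ne\theta_{v'}$ for $v\ne v'$. The local face module $L(\Gamma,E)$ is the image of $(x^F:F\in\mathrm{lk}_\Gamma(E),\ F\sqcup E\text{ interior})$ in $k[\mathrm{lk}_\Gamma(E)]/(\theta_1,\ldots,\theta_d)$ for a special l.s.o.p.; the local $h$-vector $\ell(\Gamma,E)=(\ell_0,\ldots,\ell_d)$, $\ell_i=\dim_kL(\Gamma,E)_i$, is independent of the choice of special l.s.o.p. For $F\in\mathrm{lk}_\Gamma(E)$ with $F\sqcup E$ interior: $F$ is a pyramid with apex $w\in F$ if $(F\sqcup E)\smallsetminus\{w\}$ is not interior; $\mathcal{A}_F$ is the set of such apexes $w$; $V_w:=\sigma((F\sqcup E)\smallsetminus\{w\})^c$; $F$ is a $U$-pyramid if there is $w\in\mathcal{A}_F$ with $|V_w|=1$. An interior partition of a face $F\in\mathrm{lk}_\Gamma(E)$ is a decomposition $F=F_1\sqcup F_2\sqcup\mathcal{A}_F$ such that $F_1\sqcup\mathcal{A}_F\sqcup E$ and $F_2\sqcup\mathcal{A}_F\sqcup E$ are both interior. *)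

theory Defs
  imports "HOL-Library.Poly_Mapping"
begin

definition simplicial_complex :: "'a set set \<Rightarrow> bool" where
  "simplicial_complex \<Delta> \<longleftrightarrow> finite \<Delta> \<and> (\<forall>F\<in>\<Delta>. finite F) \<and> (\<forall>F\<in>\<Delta>. \<forall>G. G \<subseteq> F \<longrightarrow> G \<in> \<Delta>)"

definition has_dim :: "'a set set \<Rightarrow> int \<Rightarrow> bool" where
  "has_dim \<Delta> d \<longleftrightarrow> (\<exists>F\<in>\<Delta>. int (card F) = d + 1) \<and> (\<forall>F\<in>\<Delta>. int (card F) \<le> d + 1)"

definition lk :: "'a set set \<Rightarrow> 'a set \<Rightarrow> 'a set set" where
  "lk \<Delta> E = {G \<in> \<Delta>. G \<inter> E = {} \<and> G \<union> E \<in> \<Delta>}"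

text \<open>i-chains (oriented by the linear order of the vertex type) with coefficients in the field 'k;
  faces of dimension i have i+1 vertices; the empty face gives the augmentation (reduced homology)\<close>
definition chain :: "'a set set \<Rightarrow> int \<Rightarrow> ('a set \<Rightarrow> 'k::field) \<Rightarrow> bool" where
  "chain \<Delta> i c \<longleftrightarrow> (\<forall>G. c G \<noteq> 0 \<longrightarrow> G \<in> \<Delta> \<and> int (card G) = i + 1)"

definition bd :: "'a::linorder set set \<Rightarrow> ('a set \<Rightarrow> 'k::field) \<Rightarrow> 'a set \<Rightarrow> 'k" where
  "bd \<Delta> c G = (\<Sum>w\<in>{w. w \<notin> G \<and> insert w G \<in> \<Delta>}.
       (-1) ^ card {u\<in>G. u < w} * c (insert w G))"

definition is_cycle :: "'a::linorder set set \<Rightarrow> int \<Rightarrow> ('a set \<Rightarrow> 'k::field) \<Rightarrow> bool" where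
  "is_cycle \<Delta> i c \<longleftrightarrow> chain \<Delta> i c \<and> bd \<Delta> c = (\<lambda>_. 0)"

definition is_boundary :: "'a::linorder set set \<Rightarrow> int \<Rightarrow> ('a set \<Rightarrow> 'k::field) \<Rightarrow> bool" where
  "is_boundary \<Delta> i c \<longleftrightarrow> (\<exists>b. chain \<Delta> (i + 1) b \<and> c = bd \<Delta> b)"

definition hom_zero :: "'k::field itself \<Rightarrow> 'a::linorder set set \<Rightarrow> int \<Rightarrow> bool" where
  "hom_zero K \<Delta> i \<longleftrightarrow> (\<forall>c::'a set \<Rightarrow> 'k. is_cycle \<Delta> i c \<longrightarrow> is_boundary \<Delta> i c)"

definition hom_k :: "'k::field itself \<Rightarrow> 'a::linorder set set \<Rightarrow> int \<Rightarrow> bool" where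
  "hom_k K \<Delta> i \<longleftrightarrow> (\<exists>z::'a set \<Rightarrow> 'k. is_cycle \<Delta> i z \<and> \<not> is_boundary \<Delta> i z \<and>
      (\<forall>c. is_cycle \<Delta> i c \<longrightarrow> (\<exists>a b. chain \<Delta> (i + 1) b \<and> c = (\<lambda>G. a * z G + bd \<Delta> b G))))"

definition acyclic_cx :: "'k::field itself \<Rightarrow> 'a::linorder set set \<Rightarrow> bool" where
  "acyclic_cx K \<Delta> \<longleftrightarrow> (\<forall>i. hom_zero K \<Delta> i)"

definition hsphere :: "'k::field itself \<Rightarrow> int \<Rightarrow> 'a::linorder set set \<Rightarrow> bool" where
  "hsphere K d \<Delta> \<longleftrightarrow> simplicial_complex \<Delta> \<and> has_dim \<Delta> d \<and>
     (\<forall>F\<in>\<Delta>. \<forall>i. (if i = d - int (card F) then hom_k K (lk \<Delta> F) i else hom_zero K (lk \<Delta> F) i))"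

text \<open>homology ball of dimension d with boundary complex B (well-founded recursion on dimension,
  realised as an inductive predicate)\<close>
inductive hball_bd :: "'k::field itself \<Rightarrow> int \<Rightarrow> 'a::linorder set set \<Rightarrow> 'a set set \<Rightarrow> bool"
  for K :: "'k itself" where
  "\<lbrakk> simplicial_complex \<Delta>; has_dim \<Delta> d; acyclic_cx K \<Delta>;
     B \<subseteq> \<Delta>; simplicial_complex B; hsphere K (d - 1) B;
     \<forall>F\<in>\<Delta>. F \<notin> B \<longrightarrow> hsphere K (d - int (card F)) (lk \<Delta> F);
     \<forall>F\<in>B. F \<noteq> {} \<longrightarrow> (\<exists>B'. hball_bd K (d - int (card F)) (lk \<Delta> F) B') \<rbrakk>
   \<Longrightarrow> hball_bd K d \<Delta> B"

definition hball :: "'k::field itself \<Rightarrow> int \<Rightarrow> 'a::linorder set set \<Rightarrow> bool" where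
  "hball K d \<Delta> \<longleftrightarrow> (\<exists>B. hball_bd K d \<Delta> B)"

definition restr :: "'a set set \<Rightarrow> ('a set \<Rightarrow> 'b set) \<Rightarrow> 'b set \<Rightarrow> 'a set set" where
  "restr \<Gamma> \<sigma> U = {F \<in> \<Gamma>. \<sigma> F \<subseteq> U}"

definition homology_triangulation ::
  "'k::field itself \<Rightarrow> 'a::linorder set set \<Rightarrow> ('a set \<Rightarrow> 'b set) \<Rightarrow> 'b set \<Rightarrow> bool" where
  "homology_triangulation K \<Gamma> \<sigma> V \<longleftrightarrow> simplicial_complex \<Gamma> \<and> finite V \<and> V \<noteq> {} \<and>
     (\<forall>F\<in>\<Gamma>. \<sigma> F \<subseteq> V) \<and>
     (\<forall>U. U \<subseteq> V \<and> U \<noteq> {} \<longrightarrow>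
        (\<exists>B. hball_bd K (int (card U) - 1) (restr \<Gamma> \<sigma> U) B \<and>
             restr \<Gamma> \<sigma> U - B = {F \<in> \<Gamma>. \<sigma> F = U}))"

text \<open>dim Gamma_U < dim F, written out: every face of Gamma_U has fewer vertices than F\<close>
definition quasi_geometric :: "'a set set \<Rightarrow> ('a set \<Rightarrow> 'b set) \<Rightarrow> 'b set \<Rightarrow> bool" where
  "quasi_geometric \<Gamma> \<sigma> V \<longleftrightarrow> \<not> (\<exists>F\<in>\<Gamma>. \<exists>U. U \<subseteq> V \<and>
       (\<forall>G\<in>restr \<Gamma> \<sigma> U. card G < card F) \<and> (\<forall>w\<in>F. \<sigma> {w} \<subseteq> U))"

definition interior :: "'a set set \<Rightarrow> ('a set \<Rightarrow> 'b set) \<Rightarrow> 'b set \<Rightarrow> 'a set \<Rightarrow> bool" where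
  "interior \<Gamma> \<sigma> V G \<longleftrightarrow> G \<in> \<Gamma> \<and> \<sigma> G = V"

text \<open>polynomial ring k[x_a : a] as finitely supported functions from monomials to k;
  the face ring k[\<Delta>] is its quotient by the Stanley--Reisner ideal (which contains the
  variables of non-vertices)\<close>
type_synonym ('a, 'k) poly = "('a \<Rightarrow>\<^sub>0 nat) \<Rightarrow>\<^sub>0 'k"

definition var :: "'a \<Rightarrow> ('a, 'k::field) poly" where
  "var w = Poly_Mapping.single (Poly_Mapping.single w 1) 1"

definition const :: "'k::field \<Rightarrow> ('a, 'k) poly" where
  "const a = Poly_Mapping.single 0 a"

definition monom :: "'a set \<Rightarrow> ('a, 'k::field) poly" where
  "monom F = (\<Prod>w\<in>F. var w)"

definition ideal_gen :: "('a, 'k::field) poly set \<Rightarrow> ('a, 'k) poly set" where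
  "ideal_gen S = {p. \<exists>A c. finite A \<and> A \<subseteq> S \<and> p = (\<Sum>s\<in>A. c s * s)}"

definition SR_gens :: "'a set set \<Rightarrow> ('a, 'k::field) poly set" where
  "SR_gens \<Delta> = {monom G | G. finite G \<and> G \<notin> \<Delta>}"

definition homogeneous :: "nat \<Rightarrow> ('a, 'k::field) poly \<Rightarrow> bool" where
  "homogeneous i p \<longleftrightarrow> (\<forall>m\<in>Poly_Mapping.keys p. (\<Sum>a\<in>Poly_Mapping.keys m. Poly_Mapping.lookup m a) = i)"

definition lin_form_on :: "'a set \<Rightarrow> ('a, 'k::field) poly \<Rightarrow> bool" where
  "lin_form_on S \<theta> \<longleftrightarrow> (\<exists>W c. finite W \<and> W \<subseteq> S \<and> \<theta> = (\<Sum>w\<in>W. const (c w) * var w))"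

definition vertices :: "'a set set \<Rightarrow> 'a set" where
  "vertices \<Delta> = {w. {w} \<in> \<Delta>}"

definition lsop :: "'a set set \<Rightarrow> nat \<Rightarrow> (nat \<Rightarrow> ('a, 'k::field) poly) \<Rightarrow> bool" where
  "lsop \<Delta> d \<theta> \<longleftrightarrow> (\<forall>i<d. lin_form_on UNIV (\<theta> i)) \<and>
     (\<exists>S. finite S \<and> (\<forall>p. \<exists>c. p - (\<Sum>s\<in>S. const (c s) * s)
                                 \<in> ideal_gen (SR_gens \<Delta> \<union> \<theta> ` {..<d})))"

definition special_lsop ::
  "'a set set \<Rightarrow> ('a set \<Rightarrow> 'b set) \<Rightarrow> 'b set \<Rightarrow> 'a set \<Rightarrow> (nat \<Rightarrow> ('a, 'k::field) poly) \<Rightarrow> bool" where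
  "special_lsop \<Gamma> \<sigma> V E \<theta> \<longleftrightarrow>
     (let \<Delta> = lk \<Gamma> E; d = card V - card E in
      lsop \<Delta> d \<theta> \<and>
      (\<exists>\<iota>. inj_on \<iota> (V - \<sigma> E) \<and> \<iota> ` (V - \<sigma> E) \<subseteq> {..<d} \<and>
         (\<forall>v\<in>V - \<sigma> E. \<exists>l. lin_form_on {w \<in> vertices \<Delta>. v \<in> \<sigma> {w}} l \<and>
                               \<theta> (\<iota> v) - l \<in> ideal_gen (SR_gens \<Delta>))))"

text \<open>ell(Gamma,E) = 0 for the special l.s.o.p. theta: every graded piece L(Gamma,E)_i of the image
  of the ideal (x^F : F in lk E, F \<union> E interior) in k[lk E]/(theta) is zero\<close>
definition local_h_zero ::
  "'a set set \<Rightarrow> ('a set \<Rightarrow> 'b set) \<Rightarrow> 'b set \<Rightarrow> 'a set \<Rightarrow> (nat \<Rightarrow> ('a, 'k::field) poly) \<Rightarrow> bool" where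
  "local_h_zero \<Gamma> \<sigma> V E \<theta> \<longleftrightarrow>
     (\<forall>i. \<forall>p \<in> ideal_gen {monom F | F. F \<in> lk \<Gamma> E \<and> interior \<Gamma> \<sigma> V (F \<union> E)}.
        homogeneous i p \<longrightarrow>
        p \<in> ideal_gen (SR_gens (lk \<Gamma> E) \<union> \<theta> ` {..<card V - card E}))"

definition apexes :: "'a set set \<Rightarrow> ('a set \<Rightarrow> 'b set) \<Rightarrow> 'b set \<Rightarrow> 'a set \<Rightarrow> 'a set \<Rightarrow> 'a set" where
  "apexes \<Gamma> \<sigma> V E F = {w \<in> F. \<not> interior \<Gamma> \<sigma> V ((F \<union> E) - {w})}"

definition U_pyramid :: "'a set set \<Rightarrow> ('a set \<Rightarrow> 'b set) \<Rightarrow> 'b set \<Rightarrow> 'a set \<Rightarrow> 'a set \<Rightarrow> bool" where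
  "U_pyramid \<Gamma> \<sigma> V E F \<longleftrightarrow> (\<exists>w\<in>apexes \<Gamma> \<sigma> V E F. card (V - \<sigma> ((F \<union> E) - {w})) = 1)"

definition interior_partition ::
  "'a set set \<Rightarrow> ('a set \<Rightarrow> 'b set) \<Rightarrow> 'b set \<Rightarrow> 'a set \<Rightarrow> 'a set \<Rightarrow> 'a set \<Rightarrow> 'a set \<Rightarrow> bool" where
  "interior_partition \<Gamma> \<sigma> V E F F1 F2 \<longleftrightarrow>
     (let A = apexes \<Gamma> \<sigma> V E F in
      F = F1 \<union> F2 \<union> A \<and> F1 \<inter> F2 = {} \<and> F1 \<inter> A = {} \<and> F2 \<inter> A = {} \<and>
      interior \<Gamma> \<sigma> V (F1 \<union> A \<union> E) \<and> interior \<Gamma> \<sigma> V (F2 \<union> A \<union> E))"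

end

theory Submission
  imports Defs "HOL.Vector_Spaces" "HOL-Library.Function_Algebras"
begin

text \<open>Write \<open>k[\<Delta>]\<close> for the face ring of \<open>\<Delta> = lk E\<close> and let \<open>I\<close> and \<open>J\<^sub>u\<close> be the ideals spanned by the monomials
  whose carrier (together with \<open>E\<close>) is \<open>V\<close>, respectively contains \<open>V - {u}\<close>. All complexes
  \<open>lk E \<inter> \<Gamma>\<^sub>W\<close> are Cohen--Macaulay: a Cech double complex shows that the Koszul complexes of their
  face rings are exact. Induction on the set of carrier conditions then gives
  \<open>I \<inter> (\<theta>) = \<Sum> \<theta>\<^sub>u J\<^sub>u + \<Sum> \<theta>\<^sub>j I\<close>, so if the local face module vanishes, every interior monomial
  is in the right-hand side.

  Now restrict to the face \<open>F\<close> with apex set \<open>A\<close>. If \<open>F\<close> is not a U-pyramid, then all of \<open>I\<close> and \<open>J\<^sub>u\<close>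
  becomes divisible by \<open>x\<^sup>A\<close>. Comparing coefficients of the minimal interior faces \<open>G \<union> A\<close> yields a
  matrix of full rank, hence an injective choice of a vertex \<open>y \<in> G\<close> such that \<open>G - {y}\<close> has carrier
  \<open>V - {u}\<close> and \<open>\<theta>\<^sub>u\<close> has a nonzero coefficient at \<open>y\<close>. Such a choice is incompatible with two disjoint
  interior sets one of which has at most two elements.\<close>

section \<open>Koszul complexes\<close>

text \<open>The induction on carrier conditions rests on one fact: a special parameter theta_u
  vanishes on the faces whose carrier misses u. Dropping it leaves exactly as many parameters as the
  smaller subcomplex needs, so the Koszul complex there is exact too; hence exactness is proved for
  all these subcomplexes at once. In the double complex the rows contract as soon as one variable is
  inverted, and the columns split by exponent into cones and cochain complexes of links.

  Divisibility by \<open>x\<^sup>A\<close> holds because a monomial in a coefficient of the refined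
  relation misses at most one element of V, whereas deleting an apex of a face that is not a
  U-pyramid loses at least two. The injective choice is a nonzero term in the expansion of a maximal
  minor; rows are pairs (u, H), but a non-interior H determines its u, so G - {y} alone is already
  injective in G.

  The bound 2 enters as follows: deleting a vertex from a minimal interior set inside F1 leaves at
  most one vertex w, so every set containing w misses at most the same element v.\<close>

definition sg :: "'i::linorder \<Rightarrow> 'i set \<Rightarrow> 'k::field" where
  "sg w F = (-1) ^ card {u \<in> F. u < w}"

lemma sg_square [simp]: "sg w F * sg w F = (1::'k::field)"
  by (simp add: sg_def flip: power_add)

lemma sg_sg_mult [simp]: "sg w F * (sg w F * x) = (x::'k::field)"
  by (simp flip: mult.assoc)

lemma sg_insert:
  assumes "finite B" "j \<notin> B"
  shows "sg i (insert j B) = (if j < i then - sg i B else (sg i B :: 'k::field))"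
proof (cases "j < i")
  case True
  then have "{u \<in> insert j B. u < i} = insert j {u \<in> B. u < i}" by auto
  then show ?thesis using True assms by (simp add: sg_def)
next
  case False
  then have "{u \<in> insert j B. u < i} = {u \<in> B. u < i}" by auto
  then show ?thesis using False by (simp add: sg_def)
qed

lemma sg_swap:
  assumes "finite B" "i \<noteq> j" "i \<notin> B" "j \<notin> B"
  shows "sg i B * sg j (insert i B) = - (sg j B * (sg i (insert j B) :: 'k::field))"
  using assms by (cases "i < j") (auto simp: sg_insert)

lemma sg_swap':
  assumes "finite B" "i \<noteq> j" "i \<notin> B" "j \<notin> B"
  shows "sg i (insert j B) * sg j (insert i B) = - (sg j B * (sg i B :: 'k::field))"
  using assms by (cases "i < j") (auto simp: sg_insert)

text \<open>The pairs are cancelled after splitting at \<open>i < j\<close>; arguing from S = -S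
  would fail in characteristic 2.\<close>

lemma sum_antisym_pairs_eq_0:
  fixes f :: "'i::linorder \<Rightarrow> 'i \<Rightarrow> 'k::ab_group_add"
  assumes "finite A" and "\<And>i j. i \<in> A \<Longrightarrow> j \<in> A \<Longrightarrow> i \<noteq> j \<Longrightarrow> f i j = - f j i"
  shows "(\<Sum>i\<in>A. \<Sum>j\<in>A - {i}. f i j) = 0"
proof -
  have split: "(\<Sum>j\<in>A - {i}. f i j) = (\<Sum>j\<in>{j\<in>A. j < i}. f i j) + (\<Sum>j\<in>{j\<in>A. i < j}. f i j)" for i
    using assms(1) by (subst sum.union_disjoint [symmetric]) (auto intro!: sum.cong)
  have "(\<Sum>i\<in>A. \<Sum>j\<in>{j\<in>A. i < j}. f i j) = (\<Sum>j\<in>A. \<Sum>i\<in>{i\<in>A. i < j}. f i j)"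
    using assms(1) by (rule sum.swap_restrict [OF _ assms(1)])
  also have "\<dots> = (\<Sum>j\<in>A. \<Sum>i\<in>{i\<in>A. i < j}. - f j i)"
    by (intro sum.cong refl assms(2)) auto
  finally show ?thesis
    by (simp add: split sum.distrib sum_negf)
qed

text \<open>Elements of face rings and their localizations are represented by arbitrary functions on exponent
  vectors, without finiteness of the support: multiplication by a linear form is still defined.\<close>

definition kz :: "'i::linorder set \<Rightarrow> ('i \<Rightarrow> ('x \<Rightarrow> 'k::field) \<Rightarrow> 'x \<Rightarrow> 'k) \<Rightarrow>
    ('i set \<Rightarrow> 'x \<Rightarrow> 'k) \<Rightarrow> 'i set \<Rightarrow> 'x \<Rightarrow> 'k" where
  "kz N X c B x = (\<Sum>i\<in>N - B. sg i B * X i (c (insert i B)) x)"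

definition dec :: "('a \<Rightarrow> int) \<Rightarrow> 'a \<Rightarrow> 'a \<Rightarrow> int" where
  "dec a y = a(y := a y - 1)"

text \<open>Cutting off outside \<open>D\<close> plays the role of the Stanley-Reisner relations:
  monomials outside \<open>D\<close> count as zero.\<close>

definition mulop :: "'a set \<Rightarrow> ('a \<Rightarrow> int) set \<Rightarrow> ('a \<Rightarrow> 'k::field) \<Rightarrow>
    (('a \<Rightarrow> int) \<Rightarrow> 'k) \<Rightarrow> ('a \<Rightarrow> int) \<Rightarrow> 'k" where
  "mulop Y D t f a = (if a \<in> D then \<Sum>y\<in>Y. t y * f (dec a y) else 0)"

text \<open>This is what makes truncated multiplications commute: if both ends of a two-step
  division lie in \<open>D\<close> but the middle does not, one order of the two factors loses a
  term that the other order may keep.\<close>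

definition dec_convex :: "('a \<Rightarrow> int) set \<Rightarrow> bool" where
  "dec_convex D \<longleftrightarrow> (\<forall>a y z. a \<in> D \<longrightarrow> dec (dec a y) z \<in> D \<longrightarrow> dec a y \<in> D)"

text \<open>\<open>c B\<close> is the coefficient of the exterior basis element e_B. The degree is a
  support condition, so chains of all degrees share one type.\<close>

definition kchain :: "'i set \<Rightarrow> nat \<Rightarrow> 'x set \<Rightarrow> ('i set \<Rightarrow> 'x \<Rightarrow> 'k::field) \<Rightarrow> bool" where
  "kchain N p D c \<longleftrightarrow> (\<forall>B a. c B a \<noteq> 0 \<longrightarrow> B \<subseteq> N \<and> card B = p \<and> a \<in> D)"

lemma dec_commute: "dec (dec a y) z = dec (dec a z) y"
  by (auto simp: dec_def fun_eq_iff)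

lemma mulop_mult_sum:
  "mulop Y D t (\<lambda>x. \<Sum>j\<in>J. s j * f j x) a = (\<Sum>j\<in>J. s j * mulop Y D t (f j) a)"
proof (cases "a \<in> D")
  case True
  have "(\<Sum>y\<in>Y. t y * (\<Sum>j\<in>J. s j * f j (dec a y))) = (\<Sum>y\<in>Y. \<Sum>j\<in>J. s j * (t y * f j (dec a y)))"
    by (simp add: sum_distrib_left mult.left_commute)
  also have "\<dots> = (\<Sum>j\<in>J. \<Sum>y\<in>Y. s j * (t y * f j (dec a y)))"
    by (rule sum.swap)
  finally show ?thesis using True by (simp add: mulop_def sum_distrib_left)
qed (simp add: mulop_def)

lemma mulop_diff: "mulop Y D t (\<lambda>x. f x - g x) a = mulop Y D t f a - mulop Y D t g a"
  by (simp add: mulop_def right_diff_distrib sum_subtractf)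

lemma mulop_zero [simp]: "mulop Y D t (\<lambda>x. 0) = (\<lambda>x. 0)"
  by (simp add: mulop_def fun_eq_iff)

lemma mulop_mulop:
  assumes "dec_convex D" and "\<And>a. a \<notin> D \<Longrightarrow> f a = 0"
  shows "mulop Y D t (mulop Y D s f) a =
    (if a \<in> D then \<Sum>y\<in>Y. \<Sum>z\<in>Y. t y * s z * f (dec (dec a y) z) else 0)"
proof -
  have "t y * (if dec a y \<in> D then \<Sum>z\<in>Y. s z * f (dec (dec a y) z) else 0) =
      (\<Sum>z\<in>Y. t y * s z * f (dec (dec a y) z))" if "a \<in> D" for y
  proof (cases "dec a y \<in> D")
    case False
    then have "f (dec (dec a y) z) = 0" for z
      using assms that unfolding dec_convex_def by blast
    then show ?thesis using False by simp
  qed (simp add: sum_distrib_left mult.assoc)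
  then show ?thesis
    by (auto simp: mulop_def intro: sum.cong)
qed

lemma mulop_commute:
  assumes "dec_convex D" and "\<And>a. a \<notin> D \<Longrightarrow> f a = 0"
  shows "mulop Y D t (mulop Y D s f) a = mulop Y D s (mulop Y D t f) a"
proof -
  have "(\<Sum>y\<in>Y. \<Sum>z\<in>Y. t y * s z * f (dec (dec a y) z)) =
      (\<Sum>z\<in>Y. \<Sum>y\<in>Y. t y * s z * f (dec (dec a y) z))"
    by (rule sum.swap)
  also have "\<dots> = (\<Sum>y\<in>Y. \<Sum>z\<in>Y. s y * t z * f (dec (dec a y) z))"
    by (simp add: dec_commute mult.commute)
  finally show ?thesis
    using assms by (simp add: mulop_mulop)
qed

lemma kz_diff:
  "kz N (\<lambda>i. mulop Y D (t i)) (\<lambda>B x. c B x - e B x) B a =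
   kz N (\<lambda>i. mulop Y D (t i)) c B a - kz N (\<lambda>i. mulop Y D (t i)) e B a"
  by (simp add: kz_def mulop_diff right_diff_distrib sum_subtractf)

lemma kz_zero [simp]: "kz N (\<lambda>i. mulop Y D (t i)) (\<lambda>B x. 0) = (\<lambda>B x. 0)"
  by (simp add: kz_def fun_eq_iff)

lemma kchain_diff: "kchain N p D c \<Longrightarrow> kchain N p D e \<Longrightarrow> kchain N p D (\<lambda>B x. c B x - e B x)"
  unfolding kchain_def by (metis diff_zero)

lemma kchain_zero [simp]: "kchain N p D (\<lambda>B x. 0)"
  by (simp add: kchain_def)

lemma kchain_gt_card:
  assumes "kchain N p D c" "finite N" "card N < p"
  shows "c = (\<lambda>B x. 0)"
  using assms card_mono[of N] unfolding kchain_def fun_eq_iff by (metis leD)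

lemma kchain_kz:
  assumes "kchain N (Suc p) D c" "finite N"
  shows "kchain N p D (kz N (\<lambda>i. mulop Y D (t i)) c)"
  unfolding kchain_def
proof (intro allI impI)
  fix B a assume "kz N (\<lambda>i. mulop Y D (t i)) c B a \<noteq> 0"
  then obtain i where i: "i \<in> N - B" "mulop Y D (t i) (c (insert i B)) a \<noteq> 0"
    unfolding kz_def by (metis (no_types, lifting) mult_zero_right sum.neutral)
  then have "a \<in> D" by (auto simp: mulop_def split: if_splits)
  moreover obtain y where "c (insert i B) (dec a y) \<noteq> 0"
    using i(2) unfolding mulop_def by (metis (no_types, lifting) mult_zero_right sum.neutral)
  then have "insert i B \<subseteq> N" "card (insert i B) = Suc p"
    using assms(1) unfolding kchain_def by blast+
  ultimately show "B \<subseteq> N \<and> card B = p \<and> a \<in> D"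
    using i(1) finite_subset[OF _ assms(2)] by auto
qed

lemma kz_kz:
  fixes c :: "'i::linorder set \<Rightarrow> ('a \<Rightarrow> int) \<Rightarrow> 'b::field"
  assumes "finite N" "dec_convex D" "kchain N p D c"
  shows "kz N (\<lambda>i. mulop Y D (t i)) (kz N (\<lambda>i. mulop Y D (t i)) c) B a = 0"
proof -
  let ?X = "\<lambda>i. mulop Y D (t i)"
  have supp: "c B a = 0" if "a \<notin> D" for B a
    using assms(3) that unfolding kchain_def by blast
  have "kz N ?X (kz N ?X c) B a =
      (\<Sum>i\<in>N - B. \<Sum>j\<in>N - insert i B. sg i B * sg j (insert i B) *
         ?X i (?X j (c (insert j (insert i B)))) a)"
    by (simp add: kz_def[abs_def] mulop_mult_sum sum_distrib_left mult.assoc)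
  also have "\<dots> = (\<Sum>i\<in>N - B. \<Sum>j\<in>N - B - {i}. sg i B * sg j (insert i B) *
         ?X i (?X j (c (insert j (insert i B)))) a)"
    by (intro sum.cong) auto
  also have "\<dots> = 0"
  proof (cases "B \<subseteq> N")
    case True
    then have "finite B" using assms(1) finite_subset by blast
    show ?thesis
    proof (rule sum_antisym_pairs_eq_0)
      fix i j assume ij: "i \<in> N - B" "j \<in> N - B" "i \<noteq> j"
      have "?X i (?X j (c (insert j (insert i B)))) a = ?X j (?X i (c (insert i (insert j B)))) a"
        unfolding insert_commute[of j i] by (rule mulop_commute) (use assms(2) supp in auto)
      then show "sg i B * sg j (insert i B) * ?X i (?X j (c (insert j (insert i B)))) a =
          - (sg j B * sg i (insert j B) * ?X j (?X i (c (insert i (insert j B)))) a)"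
        using ij sg_swap[OF \<open>finite B\<close>, of i j, where 'k = 'b] by simp
    qed (use assms(1) in auto)
  next
    case False
    then have "c (insert j (insert i B)) = (\<lambda>_. 0)" for i j
      using assms(3) unfolding kchain_def fun_eq_iff by blast
    then show ?thesis by simp
  qed
  finally show ?thesis .
qed

section \<open>Homotopies obtained by dividing by an invertible variable\<close>

definition inc :: "('a \<Rightarrow> int) \<Rightarrow> 'a \<Rightarrow> 'a \<Rightarrow> int" where
  "inc a y = a(y := a y + 1)"

text \<open>Exterior multiplication by the sum of the \<alpha>_k e_k, followed by division by
  x_w.\<close>

definition khom :: "'a \<Rightarrow> ('i::linorder \<Rightarrow> 'k::field) \<Rightarrow> ('i set \<Rightarrow> ('a \<Rightarrow> int) \<Rightarrow> 'k) \<Rightarrow>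
    'i set \<Rightarrow> ('a \<Rightarrow> int) \<Rightarrow> 'k" where
  "khom w \<alpha> c B a = (\<Sum>k\<in>B. sg k (B - {k}) * \<alpha> k * c (B - {k}) (inc a w))"

lemma dec_inc: "dec (inc a w) y = inc (dec a y) w"
  by (auto simp: dec_def inc_def fun_eq_iff)

lemma mulop_inc:
  assumes "\<And>a. inc a w \<in> D \<longleftrightarrow> a \<in> D"
  shows "mulop Y D t (\<lambda>x. f (inc x w)) a = mulop Y D t f (inc a w)"
  by (simp add: mulop_def assms dec_inc)

text \<open>Cartan-type formula: dh + hd is multiplication by x_w^{-1} times the combination of the
  parameters with coefficients \<alpha>. Terms that add an index i and remove an index k (collected
  in \<open>Z\<close>) occur in both composites with opposite signs. The diagonal terms with i
  outside \<open>B\<close> come from dh, those with i in \<open>B\<close> from hd.\<close>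

lemma kz_khom:
  fixes c :: "'i::linorder set \<Rightarrow> ('a \<Rightarrow> int) \<Rightarrow> 'k::field" and t :: "'i \<Rightarrow> 'a \<Rightarrow> 'k" and Y :: "'a set"
  assumes "finite N" "B \<subseteq> N" and D: "\<And>a. inc a w \<in> D \<longleftrightarrow> a \<in> D"
  defines "X \<equiv> \<lambda>i. mulop Y D (t i)"
  shows "kz N X (khom w \<alpha> c) B a + khom w \<alpha> (kz N X c) B a = (\<Sum>i\<in>N. \<alpha> i * X i (c B) (inc a w))"
proof -
  have fin: "finite B" "finite (N - B)" using assms finite_subset by auto
  define Z where "Z i k = \<alpha> k * X i (c (insert i (B - {k}))) (inc a w)" for i k
  have "kz N X (khom w \<alpha> c) B a =
      (\<Sum>i\<in>N - B. sg i B * (\<Sum>k\<in>insert i B. (sg k (insert i B - {k}) * \<alpha> k) *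
         X i (c (insert i B - {k})) (inc a w)))"
    by (simp add: kz_def khom_def[abs_def] X_def mulop_mult_sum mulop_inc[OF D])
  also have "\<dots> = (\<Sum>i\<in>N - B. \<alpha> i * X i (c B) (inc a w) +
      (\<Sum>k\<in>B. sg i B * sg k (insert i (B - {k})) * Z i k))"
  proof (intro sum.cong refl)
    fix i assume i: "i \<in> N - B"
    have *: "(\<Sum>k\<in>insert i B. (sg k (insert i B - {k}) * \<alpha> k) * X i (c (insert i B - {k})) (inc a w))
       = sg i B * \<alpha> i * X i (c B) (inc a w) + (\<Sum>k\<in>B. sg k (insert i (B - {k})) * Z i k)"
    proof -
      have "insert i B - {k} = insert i (B - {k})" if "k \<in> B" for k using that i by auto
      moreover have "insert i B - {i} = B" using i by auto
      ultimately show ?thesis using i fin by (simp add: Z_def mult.assoc)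
    qed
    have "sg i B * (sg i B * \<alpha> i * X i (c B) (inc a w)) =
      sg i B * sg i B * (\<alpha> i * X i (c B) (inc a w))" by (simp only: mult.assoc)
    then show "sg i B * (\<Sum>k\<in>insert i B. (sg k (insert i B - {k}) * \<alpha> k) * X i (c (insert i B - {k})) (inc a w))
       = \<alpha> i * X i (c B) (inc a w) + (\<Sum>k\<in>B. sg i B * sg k (insert i (B - {k})) * Z i k)"
      unfolding * by (simp add: distrib_left sum_distrib_left mult.assoc)
  qed
  also have "\<dots> = (\<Sum>i\<in>N - B. \<alpha> i * X i (c B) (inc a w)) +
      (\<Sum>i\<in>N - B. \<Sum>k\<in>B. sg i B * sg k (insert i (B - {k})) * Z i k)"
    by (rule sum.distrib)
  finally have 1: "kz N X (khom w \<alpha> c) B a = (\<Sum>i\<in>N - B. \<alpha> i * X i (c B) (inc a w)) +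
      (\<Sum>i\<in>N - B. \<Sum>k\<in>B. sg i B * sg k (insert i (B - {k})) * Z i k)" .
  have "khom w \<alpha> (kz N X c) B a =
      (\<Sum>k\<in>B. sg k (B - {k}) * \<alpha> k * (\<Sum>i\<in>N - (B - {k}). sg i (B - {k}) *
        X i (c (insert i (B - {k}))) (inc a w)))"
    by (simp add: kz_def khom_def)
  also have "\<dots> = (\<Sum>k\<in>B. \<alpha> k * X k (c B) (inc a w) +
      (\<Sum>i\<in>N - B. sg k (B - {k}) * sg i (B - {k}) * Z i k))"
  proof (intro sum.cong refl)
    fix k assume k: "k \<in> B"
    then have *: "N - (B - {k}) = insert k (N - B)" "insert k (B - {k}) = B"
      using assms(2) by auto
    have "sg k (B - {k}) * \<alpha> k * (sg k (B - {k}) * X k (c B) (inc a w)) =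
      sg k (B - {k}) * sg k (B - {k}) * (\<alpha> k * X k (c B) (inc a w))"
      by (simp only: ac_simps)
    then show "sg k (B - {k}) * \<alpha> k * (\<Sum>i\<in>N - (B - {k}). sg i (B - {k}) *
        X i (c (insert i (B - {k}))) (inc a w)) = \<alpha> k * X k (c B) (inc a w) +
      (\<Sum>i\<in>N - B. sg k (B - {k}) * sg i (B - {k}) * Z i k)"
      unfolding *(1) using k fin
      by (simp add: insert_absorb Z_def distrib_left sum_distrib_left mult.assoc mult.left_commute)
  qed
  also have "\<dots> = (\<Sum>i\<in>B. \<alpha> i * X i (c B) (inc a w)) +
      (\<Sum>k\<in>B. \<Sum>i\<in>N - B. sg k (B - {k}) * sg i (B - {k}) * Z i k)"
    by (rule sum.distrib)
  also have "(\<Sum>k\<in>B. \<Sum>i\<in>N - B. sg k (B - {k}) * sg i (B - {k}) * Z i k) =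
      (\<Sum>i\<in>N - B. \<Sum>k\<in>B. sg k (B - {k}) * sg i (B - {k}) * Z i k)"
    by (rule sum.swap)
  also have "\<dots> = - (\<Sum>i\<in>N - B. \<Sum>k\<in>B. sg i B * sg k (insert i (B - {k})) * Z i k)"
    unfolding sum_negf[symmetric]
  proof (intro sum.cong refl)
    fix i k assume "i \<in> N - B" "k \<in> B"
    then have "sg i (insert k (B - {k})) * sg k (insert i (B - {k})) = - (sg k (B - {k}) * (sg i (B - {k}) :: 'k))"
      by (intro sg_swap') (use fin in auto)
    then show "sg k (B - {k}) * sg i (B - {k}) * Z i k = - (sg i B * sg k (insert i (B - {k})) * Z i k)"
      using \<open>k \<in> B\<close> by (simp add: insert_absorb)
  qed
  finally have 2: "khom w \<alpha> (kz N X c) B a = (\<Sum>i\<in>B. \<alpha> i * X i (c B) (inc a w)) -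
      (\<Sum>i\<in>N - B. \<Sum>k\<in>B. sg i B * sg k (insert i (B - {k})) * Z i k)"
    by simp
  have "(\<Sum>i\<in>N. \<alpha> i * X i (c B) (inc a w)) =
      (\<Sum>i\<in>N - B. \<alpha> i * X i (c B) (inc a w)) + (\<Sum>i\<in>B. \<alpha> i * X i (c B) (inc a w))"
    using assms(1,2) by (metis (no_types, lifting) sum.subset_diff)
  then show ?thesis using 1 2 by simp
qed

lemma kchain_khom:
  assumes "kchain N p D c" "finite N" and D: "\<And>a. inc a w \<in> D \<longleftrightarrow> a \<in> D"
    and \<alpha>: "\<And>i. i \<notin> N \<Longrightarrow> \<alpha> i = 0"
  shows "kchain N (Suc p) D (khom w \<alpha> c)"
  unfolding kchain_def
proof (intro allI impI)
  fix B a assume "khom w \<alpha> c B a \<noteq> 0"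
  then obtain k where k: "k \<in> B" "\<alpha> k \<noteq> 0" "c (B - {k}) (inc a w) \<noteq> 0"
    unfolding khom_def by (metis (no_types, lifting) mult_eq_0_iff sum.neutral)
  then have "B - {k} \<subseteq> N" "card (B - {k}) = p" "inc a w \<in> D"
    using assms(1) unfolding kchain_def by blast+
  moreover from k(2) have "k \<in> N" using \<alpha> by blast
  ultimately have "B \<subseteq> N" by blast
  then show "B \<subseteq> N \<and> card B = Suc p \<and> a \<in> D"
    using k(1) D finite_subset[OF _ assms(2)] card_Suc_Diff1[of B k]
      \<open>card (B - {k}) = p\<close> \<open>inc a w \<in> D\<close> by auto
qed

lemma mulop_add: "mulop Y D t (\<lambda>x. f x + g x) a = mulop Y D t f a + mulop Y D t g a"
  by (simp add: mulop_def distrib_left sum.distrib)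

lemma kz_add:
  "kz N (\<lambda>i. mulop Y D (t i)) (\<lambda>B x. c B x + e B x) B a =
   kz N (\<lambda>i. mulop Y D (t i)) c B a + kz N (\<lambda>i. mulop Y D (t i)) e B a"
  by (simp add: kz_def mulop_add distrib_left sum.distrib)

lemma kchain_add: "kchain N p D c \<Longrightarrow> kchain N p D e \<Longrightarrow> kchain N p D (\<lambda>B x. c B x + e B x)"
  unfolding kchain_def by (metis add.right_neutral add.left_neutral)

text \<open>Exponents of the monomials of the localization of the face ring at \<open>x\<^sup>F\<close>.\<close>

definition cdom :: "'a set set \<Rightarrow> 'a set \<Rightarrow> ('a \<Rightarrow> int) set" where
  "cdom \<Delta> F = {a. (\<forall>w. w \<notin> F \<longrightarrow> 0 \<le> a w) \<and> {w. a w \<noteq> 0} \<union> F \<in> \<Delta>}"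

lemma simplicial_complexD: "simplicial_complex \<Delta> \<Longrightarrow> F \<in> \<Delta> \<Longrightarrow> G \<subseteq> F \<Longrightarrow> G \<in> \<Delta>"
  unfolding simplicial_complex_def by blast

lemma simplicial_complex_finite: "simplicial_complex \<Delta> \<Longrightarrow> F \<in> \<Delta> \<Longrightarrow> finite F"
  unfolding simplicial_complex_def by blast

lemma simplicial_complex_finite_Union: "simplicial_complex \<Delta> \<Longrightarrow> finite (\<Union>\<Delta>)"
  unfolding simplicial_complex_def by blast

text \<open>Dividing by x_y enlarges the support only if \<open>a y = 0\<close>; the new exponent is
  then -1, which is allowed only inside \<open>F\<close>.\<close>

lemma support_dec:
  assumes "\<And>w. w \<notin> F \<Longrightarrow> 0 \<le> dec a y w"
  shows "{w. dec a y w \<noteq> 0} \<union> F \<subseteq> {w. a w \<noteq> 0} \<union> F"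
proof
  fix w assume w: "w \<in> {w. dec a y w \<noteq> 0} \<union> F"
  show "w \<in> {w. a w \<noteq> 0} \<union> F"
    using w assms[of w] by (cases "w \<in> F"; cases "w = y") (auto simp: dec_def)
qed

lemma cdom_dec:
  assumes "simplicial_complex \<Delta>" "a \<in> cdom \<Delta> F" "\<And>w. w \<notin> F \<Longrightarrow> 0 \<le> dec a y w"
  shows "dec a y \<in> cdom \<Delta> F"
proof -
  have "{w. dec a y w \<noteq> 0} \<union> F \<in> \<Delta>"
    by (rule simplicial_complexD[OF assms(1) _ support_dec[of F, OF assms(3)]])
      (use assms(2) in \<open>auto simp: cdom_def\<close>)
  then show ?thesis using assms(3) by (simp add: cdom_def)
qed

lemma dec_le: "dec a y w \<le> a w"
  by (simp add: dec_def)

lemma dec_convex_cdom: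
  assumes "simplicial_complex \<Delta>"
  shows "dec_convex (cdom \<Delta> F)"
  unfolding dec_convex_def
proof (intro allI impI)
  fix a :: "'a \<Rightarrow> int" and y z
  assume a: "a \<in> cdom \<Delta> F" and d: "dec (dec a y) z \<in> cdom \<Delta> F"
  show "dec a y \<in> cdom \<Delta> F"
  proof (rule cdom_dec[OF assms a])
    fix w assume "w \<notin> F"
    then have "0 \<le> dec (dec a y) z w" using d by (simp add: cdom_def)
    then show "0 \<le> dec a y w" by (rule order_trans[OF _ dec_le])
  qed
qed

lemma inc_cdom_iff:
  assumes "w \<in> F"
  shows "inc a w \<in> cdom \<Delta> F \<longleftrightarrow> a \<in> cdom \<Delta> F"
proof -
  have "{v. inc a w v \<noteq> 0} \<union> F = {v. a v \<noteq> 0} \<union> F" using assms by (auto simp: inc_def)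
  then show ?thesis using assms by (auto simp: cdom_def inc_def)
qed

text \<open>Modulo boundaries, \<open>c\<close> may be replaced by \<open>c - x\<^sub>w\<inverse> \<ell> c\<close> for any linear combination \<open>\<ell>\<close> of the
  parameters; if \<open>\<ell>\<close> restricts to \<open>x\<^sub>w\<close> on a face \<open>G\<close>, then this kills the part of \<open>c\<close> living on \<open>G\<close>.\<close>

lemma koszul_exact_localization:
  fixes t :: "'i::linorder \<Rightarrow> 'a \<Rightarrow> 'k::field"
  assumes \<Delta>: "simplicial_complex \<Delta>" and N: "finite N" and w: "w \<in> F"
    and span: "\<And>G. G \<in> \<Delta> \<Longrightarrow> w \<in> G \<Longrightarrow>
      \<exists>\<alpha>. \<forall>y\<in>G. (\<Sum>i\<in>N. \<alpha> i * t i y) = (if y = w then 1 else 0)"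
    and c: "kchain N p (cdom \<Delta> F) c"
  defines "X \<equiv> \<lambda>i. mulop (\<Union>\<Delta>) (cdom \<Delta> F) (t i)"
  assumes cyc: "kz N X c = (\<lambda>B a. 0)"
  shows "\<exists>b. kchain N (Suc p) (cdom \<Delta> F) b \<and> c = kz N X b"
proof -
  let ?D = "cdom \<Delta> F"
  have conv: "dec_convex ?D" by (rule dec_convex_cdom[OF \<Delta>])
  have D: "inc a w \<in> ?D \<longleftrightarrow> a \<in> ?D" for a by (rule inc_cdom_iff[OF w])
  \<comment> \<open>Invariant of the induction over faces: \<open>c'\<close> is homologous to
    \<open>c\<close> and vanishes at all monomials living on a face that has been treated.\<close>
  have "\<exists>c' b. kchain N p ?D c' \<and> kz N X c' = (\<lambda>B a. 0) \<and> kchain N (Suc p) ?D b \<and>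
      c = (\<lambda>B a. c' B a + kz N X b B a) \<and>
      (\<forall>G\<in>\<G>. \<forall>B a. {v. a v \<noteq> 0} \<union> F \<subseteq> G \<longrightarrow> c' B a = 0)"
    if "finite \<G>" "\<G> \<subseteq> \<Delta>" for \<G>
    using that
  proof (induction \<G>)
    case empty
    have "kz N X (\<lambda>B x. 0) = (\<lambda>B x. 0)" unfolding X_def by simp
    then show ?case using c cyc by (intro exI[of _ c] exI[of _ "\<lambda>B x. 0"]) simp
  next
    case (insert G \<G>)
    then have "\<G> \<subseteq> \<Delta>" by simp
    from insert.IH[OF this] obtain c' b where c': "kchain N p ?D c'" "kz N X c' = (\<lambda>B a. 0)"
      and b: "kchain N (Suc p) ?D b" "c = (\<lambda>B a. c' B a + kz N X b B a)"
      and van0: "\<forall>G\<in>\<G>. \<forall>B a. {v. a v \<noteq> 0} \<union> F \<subseteq> G \<longrightarrow> c' B a = 0"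
      by (elim exE conjE)
    have van: "c' B a = 0" if "G \<in> \<G>" "{v. a v \<noteq> 0} \<union> F \<subseteq> G" for G B a
      using van0 that by blast
    show ?case
    proof (cases "w \<in> G")
      case False
      then have "\<not> {v. a v \<noteq> 0} \<union> F \<subseteq> G" for a :: "'a \<Rightarrow> int" using w by blast
      then have "\<forall>G'\<in>insert G \<G>. \<forall>B a. {v. a v \<noteq> 0} \<union> F \<subseteq> G' \<longrightarrow> c' B a = 0"
        using van by blast
      then show ?thesis by (intro exI[of _ c'] exI[of _ b] conjI c' b)
    next
      case True
      from insert.prems have "G \<in> \<Delta>" by simp
      from span[OF this True] obtain \<alpha>0
        where \<alpha>0: "\<forall>y\<in>G. (\<Sum>i\<in>N. \<alpha>0 i * t i y) = (if y = w then 1 else 0)" ..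
      define \<alpha> where "\<alpha> i = (if i \<in> N then \<alpha>0 i else 0)" for i
      have \<alpha>: "(\<Sum>i\<in>N. \<alpha> i * t i y) = (if y = w then 1 else 0)" if "y \<in> G" for y
        using \<alpha>0 that by (simp add: \<alpha>_def)
      define h where "h = khom w \<alpha> c'"
      have h: "kchain N (Suc p) ?D h"
        unfolding h_def by (rule kchain_khom[OF c'(1) N D]) (simp add: \<alpha>_def)
      have hp: "kchain N p ?D (kz N X h)" unfolding X_def by (rule kchain_kz[OF h N])
      define c'' where "c'' = (\<lambda>B a. c' B a - kz N X h B a)"
      \<comment> \<open>Since \<open>c'\<close> is a cycle, only one of the two composites in
        \<open>kz_khom\<close> survives.\<close>
      have kzh: "kz N X h B a = (\<Sum>y\<in>\<Union>\<Delta>. (\<Sum>i\<in>N. \<alpha> i * t i y) * c' B (inc (dec a y) w))"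
        if "B \<subseteq> N" "a \<in> ?D" for B a
      proof -
        have "kz N X h B a + khom w \<alpha> (kz N X c') B a = (\<Sum>i\<in>N. \<alpha> i * X i (c' B) (inc a w))"
          unfolding X_def h_def by (rule kz_khom[OF N that(1) D])
        then have "kz N X h B a = (\<Sum>i\<in>N. \<Sum>y\<in>\<Union>\<Delta>. \<alpha> i * t i y * c' B (inc (dec a y) w))"
          unfolding c'(2) using that
          by (simp add: khom_def X_def mulop_def D dec_inc sum_distrib_left mult.assoc)
        also have "\<dots> = (\<Sum>y\<in>\<Union>\<Delta>. \<Sum>i\<in>N. \<alpha> i * t i y * c' B (inc (dec a y) w))"
          by (rule sum.swap)
        finally show ?thesis by (simp add: sum_distrib_right)
      qed
      have step: "c' B (inc (dec a y) w) = 0"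
        if "\<not> {v. dec a y v \<noteq> 0} \<union> F \<subseteq> {v. a v \<noteq> 0} \<union> F" for B a y
      proof -
        have "\<not> (\<forall>w. w \<notin> F \<longrightarrow> 0 \<le> dec a y w)" using support_dec[of F a y] that by blast
        then have "inc (dec a y) w \<notin> ?D" unfolding D by (auto simp: cdom_def)
        then show ?thesis using c'(1) unfolding kchain_def by blast
      qed
      have van'': "c'' B a = 0" if G': "G' \<in> insert G \<G>" and sub: "{v. a v \<noteq> 0} \<union> F \<subseteq> G'" for G' B a
      proof (cases "B \<subseteq> N \<and> a \<in> ?D")
        case False
        then have "c' B a = 0" "kz N X h B a = 0" using c'(1) hp unfolding kchain_def by blast+
        then show ?thesis by (simp add: c''_def)
      next
        case Ba: True
        show ?thesis
        proof (cases "G' \<in> \<G>")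
          case True
          \<comment> \<open>Treated faces stay treated: multiplying by x_w and dividing by x_y does
            not enlarge the support modulo \<open>F\<close>, unless it leaves the domain.\<close>
          have "c' B (inc (dec a y) w) = 0" for y
          proof (cases "{v. dec a y v \<noteq> 0} \<union> F \<subseteq> {v. a v \<noteq> 0} \<union> F")
            case t: True
            have "{v. inc (dec a y) w v \<noteq> 0} \<union> F \<subseteq> {v. dec a y v \<noteq> 0} \<union> F"
              using w by (auto simp: inc_def)
            then show ?thesis using van[OF True] t sub by blast
          qed (rule step)
          then have "kz N X h B a = 0" using kzh Ba by simp
          then show ?thesis using van[OF True sub] by (simp add: c''_def)
        next
          case False
          then have G: "G' = G" using G' by simp
          have wU: "w \<in> \<Union>\<Delta>" using True insert.prems by blast
          \<comment> \<open>On the new face the correction is \<open>c'\<close> itself: among the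
            vertices of \<open>G\<close> only \<open>y = w\<close> has a nonzero coefficient, and a
            vertex outside \<open>G\<close> would get exponent -1 outside \<open>F\<close>.\<close>
          have "(\<Sum>y\<in>\<Union>\<Delta>. (\<Sum>i\<in>N. \<alpha> i * t i y) * c' B (inc (dec a y) w)) =
              (\<Sum>y\<in>\<Union>\<Delta>. if y = w then c' B a else 0)"
          proof (intro sum.cong refl)
            fix y
            show "(\<Sum>i\<in>N. \<alpha> i * t i y) * c' B (inc (dec a y) w) = (if y = w then c' B a else 0)"
            proof (cases "y \<in> G")
              case True
              moreover have "inc (dec a w) w = a" by (auto simp: inc_def dec_def)
              ultimately show ?thesis using \<alpha> by simp
            next
              case False
              then have "y \<notin> F" "a y = 0" using sub G by auto
              then have "\<not> (\<forall>w. w \<notin> F \<longrightarrow> 0 \<le> dec a y w)" by (auto simp: dec_def intro: exI[of _ y])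
              then have "inc (dec a y) w \<notin> ?D" unfolding D by (auto simp: cdom_def)
              then have "c' B (inc (dec a y) w) = 0" using c'(1) unfolding kchain_def by blast
              then show ?thesis using False \<open>w \<in> G\<close> by auto
            qed
          qed
          also have "\<dots> = c' B a"
            using wU simplicial_complex_finite_Union[OF \<Delta>] by simp
          finally show ?thesis using kzh Ba by (simp add: c''_def)
        qed
      qed
      have "kchain N p ?D c''" unfolding c''_def by (rule kchain_diff[OF c'(1) hp])
      moreover have "kz N X c'' = (\<lambda>B a. 0)"
        using c'(2) kz_kz[OF N conv h, where Y = "\<Union>\<Delta>" and t = t]
        by (simp add: fun_eq_iff c''_def X_def kz_diff)
      moreover have "kchain N (Suc p) ?D (\<lambda>B a. b B a + h B a)" by (rule kchain_add[OF b(1) h])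
      moreover have "c = (\<lambda>B a. c'' B a + kz N X (\<lambda>B a. b B a + h B a) B a)"
        using b(2) by (simp add: c''_def X_def kz_add)
      ultimately show ?thesis
        using van'' by (intro exI[of _ c''] exI[of _ "\<lambda>B a. b B a + h B a"] conjI ballI allI impI)
    qed
  qed
  moreover have "finite \<Delta>" using \<Delta> unfolding simplicial_complex_def by blast
  ultimately have "\<exists>c' b. kchain N p ?D c' \<and> kz N X c' = (\<lambda>B a. 0) \<and> kchain N (Suc p) ?D b \<and>
      c = (\<lambda>B a. c' B a + kz N X b B a) \<and>
      (\<forall>G\<in>\<Delta>. \<forall>B a. {v. a v \<noteq> 0} \<union> F \<subseteq> G \<longrightarrow> c' B a = 0)" by simp
  then obtain c' b where *: "kchain N p ?D c'" "kchain N (Suc p) ?D b"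
      "c = (\<lambda>B a. c' B a + kz N X b B a)"
      and van: "\<forall>G\<in>\<Delta>. \<forall>B a. {v. a v \<noteq> 0} \<union> F \<subseteq> G \<longrightarrow> c' B a = 0"
    by (elim exE conjE)
  \<comment> \<open>All faces have been treated, and each monomial of the domain lives on one of
    them.\<close>
  have "c' B a = 0" for B a
  proof (cases "a \<in> ?D")
    case True
    then show ?thesis using van by (auto simp: cdom_def)
  qed (use *(1) in \<open>auto simp: kchain_def\<close>)
  then have "c = kz N X b" using *(3) by simp
  then show ?thesis using *(2) by blast
qed

section \<open>The Cech double complex\<close>

lemma bd_sg: "bd \<Delta> c G = (\<Sum>w\<in>{w. w \<notin> G \<and> insert w G \<in> \<Delta>}. sg w G * c (insert w G))"
  by (simp add: bd_def sg_def)

lemma finite_cofaces: "simplicial_complex \<Delta> \<Longrightarrow> finite {w. w \<notin> G \<and> insert w G \<in> \<Delta>}"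
  by (rule finite_subset[OF _ simplicial_complex_finite_Union]) auto

text \<open>The coboundary is the transpose of the boundary: both sides sum over pairs of a face
  \<open>K\<close> and a vertex \<open>w\<close> of it.\<close>

lemma bd_pairing:
  fixes g b :: "'a::linorder set \<Rightarrow> 'k::field"
  assumes L: "simplicial_complex L"
  shows "(\<Sum>H\<in>L. g H * bd L b H) = (\<Sum>K\<in>L. b K * (\<Sum>w\<in>K. sg w (K - {w}) * g (K - {w})))"
proof -
  have fin: "finite L" "\<And>K. K \<in> L \<Longrightarrow> finite K"
    using L unfolding simplicial_complex_def by blast+
  have "(\<Sum>H\<in>L. g H * bd L b H) =
      (\<Sum>(H, w)\<in>Sigma L (\<lambda>H. {w. w \<notin> H \<and> insert w H \<in> L}). g H * (sg w H * b (insert w H)))"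
    using fin finite_cofaces[OF L] by (simp add: bd_sg sum_distrib_left sum.Sigma)
  also have "\<dots> = (\<Sum>(K, w)\<in>Sigma L (\<lambda>K. K). b K * (sg w (K - {w}) * g (K - {w})))"
    by (rule sum.reindex_bij_witness[where i = "\<lambda>(K, w). (K - {w}, w)" and j = "\<lambda>(H, w). (insert w H, w)"])
      (auto simp: insert_absorb mult_ac intro: simplicial_complexD[OF L])
  also have "\<dots> = (\<Sum>K\<in>L. b K * (\<Sum>w\<in>K. sg w (K - {w}) * g (K - {w})))"
    using fin by (simp add: sum_distrib_left sum.Sigma)
  finally show ?thesis .
qed

lemma vector_space_fun: "vector_space (\<lambda>(r::'k::field) (f::'x \<Rightarrow> 'k) x. r * f x)"
  by unfold_locales (auto simp: algebra_simps fun_eq_iff)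

text \<open>Exactness of the chain complex dualizes: a cochain \<open>g\<close> killing the boundaries factors through a
  linear right inverse \<open>s\<close> of the boundary map.\<close>

lemma hom_zero_dual:
  fixes g :: "'a::linorder set \<Rightarrow> 'k::field"
  assumes L: "simplicial_complex L" and hz: "hom_zero TYPE('k) L i"
    and cocyc: "\<And>K. K \<in> L \<Longrightarrow> int (card K) = i + 2 \<Longrightarrow> (\<Sum>w\<in>K. sg w (K - {w}) * g (K - {w})) = 0"
  shows "\<exists>h. \<forall>K\<in>L. int (card K) = i + 1 \<longrightarrow> g K = (\<Sum>w\<in>K. sg w (K - {w}) * h (K - {w}))"
proof -
  let ?s = "\<lambda>(r::'k) (f::'a set \<Rightarrow> 'k) x. r * f x"
  interpret vector_space ?s by (rule vector_space_fun)
  interpret vp: vector_space_pair ?s ?s by unfold_locales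
  define C where "C = {c :: 'a set \<Rightarrow> 'k. chain L i c}"
  have fin: "finite L" "\<And>K. K \<in> L \<Longrightarrow> finite K"
    using L unfolding simplicial_complex_def by blast+
  have lin: "Vector_Spaces.linear ?s ?s (bd L)"
    unfolding Vector_Spaces.linear_iff
    by (auto simp: vector_space_fun fun_eq_iff bd_sg distrib_left sum.distrib sum_distrib_left mult_ac)
  have "subspace C"
    unfolding subspace_def C_def chain_def by (auto, (metis add.right_neutral)+)
  from vp.linear_exists_right_inverse_on[OF lin this] obtain s
    where s: "range s \<subseteq> C" "Vector_Spaces.linear ?s ?s s" "\<And>c. c \<in> C \<Longrightarrow> bd L (s (bd L c)) = bd L c"
    by auto
  \<comment> \<open>\<open>\<mu>\<close> is \<open>g\<close> composed with the right inverse
    \<open>s\<close>; its values on indicator functions are the wanted cochain.\<close>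
  define \<mu> where "\<mu> v = (\<Sum>H\<in>L. g H * s v H)" for v
  have \<mu>_add: "\<mu> (u + v) = \<mu> u + \<mu> v" for u v
    using s(2) unfolding Vector_Spaces.linear_iff by (simp add: \<mu>_def distrib_left sum.distrib)
  have \<mu>_scale: "\<mu> (\<lambda>x. r * v x) = r * \<mu> v" for r v
    using s(2) unfolding Vector_Spaces.linear_iff by (simp add: \<mu>_def sum_distrib_left mult_ac)
  have \<mu>_sum: "\<mu> (\<Sum>j\<in>J. v j) = (\<Sum>j\<in>J. \<mu> (v j))" if "finite J" for J :: "'a set" and v
    using that
  proof (induction J)
    case empty
    show ?case using \<mu>_scale[of 0 "\<lambda>x. 0"] by (simp add: zero_fun_def)
  next
    case (insert x F)
    have "sum v (insert x F) = v x + sum v F" using insert.hyps by (rule sum.insert)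
    then have "\<mu> (sum v (insert x F)) = \<mu> (v x) + \<mu> (sum v F)" by (simp only: \<mu>_add)
    then show ?case using insert by (simp add: plus_fun_def)
  qed
  define \<delta> where "\<delta> J = (\<lambda>H. if H = J then 1 else 0 :: 'k)" for J :: "'a set"
  have "g K = (\<Sum>w\<in>K. sg w (K - {w}) * \<mu> (\<delta> (K - {w})))" if K: "K \<in> L" "int (card K) = i + 1" for K
  proof -
    have \<delta>K: "\<delta> K \<in> C" using K by (auto simp: C_def chain_def \<delta>_def)
    have bdK: "bd L (\<delta> K) = (\<Sum>w\<in>K. (\<lambda>H. sg w (K - {w}) * \<delta> (K - {w}) H))"
    proof
      fix H
      have "(\<Sum>w\<in>{w. w \<notin> H \<and> insert w H \<in> L}. sg w H * \<delta> K (insert w H)) =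
          (\<Sum>w\<in>{w \<in> K. H = K - {w}}. sg w H)"
        using K finite_cofaces[OF L, of H]
        by (intro sum.mono_neutral_cong_right) (auto simp: \<delta>_def insert_absorb)
      also have "\<dots> = (\<Sum>w\<in>K. sg w (K - {w}) * \<delta> (K - {w}) H)"
        using fin(2)[OF K(1)]
        by (intro sum.mono_neutral_cong_left) (auto simp: \<delta>_def)
      finally have "bd L (\<delta> K) H = (\<Sum>w\<in>K. sg w (K - {w}) * \<delta> (K - {w}) H)"
        by (simp add: bd_sg)
      moreover have "(\<Sum>w\<in>J. (\<lambda>H. sg w (K - {w}) * \<delta> (K - {w}) H)) H =
          (\<Sum>w\<in>J. sg w (K - {w}) * \<delta> (K - {w}) H)" for J
        by (induction J rule: infinite_finite_induct) auto
      ultimately show "bd L (\<delta> K) H = (\<Sum>w\<in>K. (\<lambda>H. sg w (K - {w}) * \<delta> (K - {w}) H)) H" by simp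
    qed
    \<comment> \<open>The two terms have the same boundary, so \<open>c\<close> is a cycle, hence a
      boundary, and \<open>g\<close> pairs to zero with it.\<close>
    define c where "c = s (bd L (\<delta> K)) - \<delta> K"
    have "c \<in> C" unfolding c_def using s(1) \<delta>K \<open>subspace C\<close> by (intro subspace_diff) auto
    moreover have "bd L c = (\<lambda>_. 0)"
      using s(3)[OF \<delta>K] by (auto simp: c_def fun_eq_iff bd_sg right_diff_distrib sum_subtractf)
    ultimately have "is_boundary L i c"
      using hz unfolding hom_zero_def is_cycle_def C_def by blast
    then obtain b where b: "chain L (i + 1) b" "c = bd L b" unfolding is_boundary_def by blast
    have "(\<Sum>H\<in>L. g H * bd L b H) = 0"
      unfolding bd_pairing[OF L]
    proof (intro sum.neutral ballI)
      fix M assume "M \<in> L"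
      then show "b M * (\<Sum>w\<in>M. sg w (M - {w}) * g (M - {w})) = 0"
        using cocyc[of M] b(1) unfolding chain_def by (cases "b M = 0") auto
    qed
    then have "\<mu> (bd L (\<delta> K)) = (\<Sum>H\<in>L. g H * \<delta> K H)"
      unfolding b(2)[symmetric] by (simp add: c_def \<mu>_def right_diff_distrib sum_subtractf)
    also have "\<dots> = g K" using K fin by (simp add: \<delta>_def sum.delta' if_distrib cong: if_cong)
    finally show ?thesis
      unfolding bdK using fin(2)[OF K(1)] by (simp add: \<mu>_sum \<mu>_scale)
  qed
  then show ?thesis by (intro exI[of _ "\<lambda>J. \<mu> (\<delta> J)"]) blast
qed

section \<open>Cech complexes in a fixed exponent\<close>

definition cob :: "('a::linorder set \<Rightarrow> 'k::field) \<Rightarrow> 'a set \<Rightarrow> 'k" where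
  "cob \<phi> F = (\<Sum>w\<in>F. sg w (F - {w}) * \<phi> (F - {w}))"

text \<open>Corrects the orientation when faces containing \<open>G\<close> are identified with faces of the link of \<open>G\<close>.\<close>

definition twist :: "'a::linorder set \<Rightarrow> 'a set \<Rightarrow> 'k::field" where
  "twist G H = (\<Prod>w\<in>H. sg w G)"

lemma sg_Un:
  assumes "finite A" "finite B" "A \<inter> B = {}"
  shows "sg w (A \<union> B) = sg w A * (sg w B :: 'k::field)"
proof -
  have "{u \<in> A \<union> B. u < w} = {u \<in> A. u < w} \<union> {u \<in> B. u < w}" by auto
  moreover have "card ({u \<in> A. u < w} \<union> {u \<in> B. u < w}) = card {u \<in> A. u < w} + card {u \<in> B. u < w}"
    using assms by (intro card_Un_disjoint) auto
  ultimately show ?thesis by (simp add: sg_def power_add)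
qed

lemma twist_square: "twist G H * twist G H = (1::'k::field)"
  by (simp add: twist_def flip: prod.distrib)

text \<open>As \<open>\<phi>\<close> vanishes on sets not containing \<open>G\<close>, only vertices
  of \<open>K\<close> can be removed. The sign of such a vertex relative to K and G together is a
  product, and the factor from \<open>G\<close> is what the twist absorbs.\<close>

lemma cob_twist:
  fixes \<phi> :: "'a::linorder set \<Rightarrow> 'k::field"
  assumes "finite G" "finite K" "K \<inter> G = {}" and \<phi>: "\<And>F. \<not> G \<subseteq> F \<Longrightarrow> \<phi> F = 0"
  shows "cob (\<lambda>H. twist G H * \<phi> (H \<union> G)) K = twist G K * cob \<phi> (K \<union> G)"
proof -
  have "\<phi> (K \<union> G - {w}) = 0" if "w \<in> G" for w by (rule \<phi>) (use that in blast)
  then have "cob \<phi> (K \<union> G) = (\<Sum>w\<in>K. sg w (K \<union> G - {w}) * \<phi> (K \<union> G - {w}))"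
    unfolding cob_def using assms by (intro sum.mono_neutral_right) auto
  also have "twist G K * \<dots> = (\<Sum>w\<in>K. sg w (K - {w}) * (twist G (K - {w}) * \<phi> ((K - {w}) \<union> G)))"
    unfolding sum_distrib_left
  proof (intro sum.cong refl)
    fix w assume w: "w \<in> K"
    then have "K \<union> G - {w} = (K - {w}) \<union> G" using assms(3) by auto
    moreover have "sg w ((K - {w}) \<union> G) = sg w (K - {w}) * (sg w G :: 'k)"
      using assms by (intro sg_Un) auto
    moreover have "twist G K = sg w G * (twist G (K - {w}) :: 'k)"
      unfolding twist_def using w assms(2) by (simp add: prod.remove)
    ultimately show "twist G K * (sg w (K \<union> G - {w}) * \<phi> (K \<union> G - {w})) =
        sg w (K - {w}) * (twist G (K - {w}) * \<phi> ((K - {w}) \<union> G))"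
      by (simp add: mult_ac)
  qed
  finally show ?thesis by (simp add: cob_def)
qed

lemma simplicial_complex_lk: "simplicial_complex \<Delta> \<Longrightarrow> simplicial_complex (lk \<Delta> G)"
  unfolding simplicial_complex_def
proof (intro conjI ballI allI impI)
  assume \<Delta>: "finite \<Delta> \<and> (\<forall>F\<in>\<Delta>. finite F) \<and> (\<forall>F\<in>\<Delta>. \<forall>G\<subseteq>F. G \<in> \<Delta>)"
  then show "finite (lk \<Delta> G)" by (simp add: lk_def)
  fix F assume F: "F \<in> lk \<Delta> G"
  then show "finite F" using \<Delta> by (simp add: lk_def)
  fix H assume "H \<subseteq> F"
  moreover have "H \<union> G \<subseteq> F \<union> G" using \<open>H \<subseteq> F\<close> by blast
  ultimately show "H \<in> lk \<Delta> G" using F \<Delta> unfolding lk_def by blast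
qed

text \<open>With \<open>a p\<close> positive, inserting \<open>p\<close> into \<open>F\<close> does
  not change whether \<open>a\<close> lies in the localization at \<open>F\<close>. The sets that
  occur thus form a cone with apex \<open>p\<close>, and the usual cone homotopy
  \<open>\<psi>\<close> works.\<close>

lemma cech_exact_cone:
  fixes \<phi> :: "'a::linorder set \<Rightarrow> 'k::field" and a :: "'a \<Rightarrow> int"
  assumes \<Delta>: "simplicial_complex \<Delta>" and p: "0 < a p"
    and \<phi>: "\<And>F. \<phi> F \<noteq> 0 \<Longrightarrow> card F = j \<and> a \<in> cdom \<Delta> F"
    and cocyc: "\<And>F. a \<in> cdom \<Delta> F \<Longrightarrow> cob \<phi> F = 0"
  shows "\<exists>\<psi>. (\<forall>F. \<psi> F \<noteq> 0 \<longrightarrow> Suc (card F) = j \<and> a \<in> cdom \<Delta> F) \<and>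
    (\<forall>F. a \<in> cdom \<Delta> F \<longrightarrow> \<phi> F = cob \<psi> F)"
proof -
  have fin: "finite F" if "a \<in> cdom \<Delta> F" for F
    using that simplicial_complex_finite[OF \<Delta>, of "{w. a w \<noteq> 0} \<union> F"] by (simp add: cdom_def)
  have ins: "a \<in> cdom \<Delta> (insert p F) \<longleftrightarrow> a \<in> cdom \<Delta> F" for F
  proof -
    have "{w. a w \<noteq> 0} \<union> insert p F = {w. a w \<noteq> 0} \<union> F" using p by auto
    moreover have "(\<forall>w. w \<notin> insert p F \<longrightarrow> 0 \<le> a w) \<longleftrightarrow> (\<forall>w. w \<notin> F \<longrightarrow> 0 \<le> a w)"
      (is "?l \<longleftrightarrow> ?r")
    proof
      assume l: ?l
      show ?r
      proof (intro allI impI)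
        fix w assume "w \<notin> F"
        then show "0 \<le> a w" using l p by (cases "w = p") auto
      qed
    qed simp
    ultimately show ?thesis unfolding cdom_def by simp
  qed
  define \<psi> where "\<psi> F = (if p \<notin> F \<and> a \<in> cdom \<Delta> F then sg p F * \<phi> (insert p F) else 0)" for F
  have "Suc (card F) = j \<and> a \<in> cdom \<Delta> F" if "\<psi> F \<noteq> 0" for F
  proof -
    from that have "p \<notin> F" "a \<in> cdom \<Delta> F" "\<phi> (insert p F) \<noteq> 0" by (auto simp: \<psi>_def split: if_splits)
    then show ?thesis using \<phi>[of "insert p F"] fin by auto
  qed
  moreover have "\<phi> F = cob \<psi> F" if F: "a \<in> cdom \<Delta> F" for F
  proof (cases "p \<in> F")
    case True
    then have "a \<in> cdom \<Delta> (F - {p})" using F ins[of "F - {p}"] by (simp add: insert_absorb)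
    then have "sg p (F - {p}) * \<psi> (F - {p}) = \<phi> F" using True by (simp add: \<psi>_def insert_absorb)
    moreover have "cob \<psi> F = sg p (F - {p}) * \<psi> (F - {p}) + (\<Sum>w\<in>F - {p}. sg w (F - {w}) * \<psi> (F - {w}))"
      unfolding cob_def using True fin[OF F] by (rule sum.remove[rotated])
    moreover have "(\<Sum>w\<in>F - {p}. sg w (F - {w}) * \<psi> (F - {w})) = 0"
      using True by (intro sum.neutral) (auto simp: \<psi>_def)
    ultimately show ?thesis by simp
  next
    case False
    have "0 = cob \<phi> (insert p F)" using cocyc F ins by simp
    also have "\<dots> = sg p F * \<phi> F + (\<Sum>w\<in>F. sg w (insert p F - {w}) * \<phi> (insert p F - {w}))"
      unfolding cob_def using False fin[OF F] by simp
    finally have "sg p F * \<phi> F = - (\<Sum>w\<in>F. sg w (insert p F - {w}) * \<phi> (insert p F - {w}))"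
      (is "_ = - ?S") by (simp only: eq_neg_iff_add_eq_0)
    then have "sg p F * (sg p F * \<phi> F) = sg p F * - ?S" by (rule arg_cong)
    then have "\<phi> F = - (sg p F * ?S)" by (simp only: sg_sg_mult mult_minus_right)
    also have "\<dots> = (\<Sum>w\<in>F. sg w (F - {w}) * \<psi> (F - {w}))"
      unfolding sum_distrib_left sum_negf[symmetric]
    proof (intro sum.cong refl)
      fix w assume w: "w \<in> F"
      then have eq: "insert p F - {w} = insert p (F - {w})" using False by auto
      show "- (sg p F * (sg w (insert p F - {w}) * \<phi> (insert p F - {w}))) = sg w (F - {w}) * \<psi> (F - {w})"
      proof (cases "a \<in> cdom \<Delta> (F - {w})")
        case True
        have "sg p (insert w (F - {w})) * sg w (insert p (F - {w})) = - (sg w (F - {w}) * (sg p (F - {w}) :: 'k))"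
          by (rule sg_swap') (use w False fin[OF F] in auto)
        then have "- (sg p F * sg w (insert p (F - {w}))) = sg w (F - {w}) * (sg p (F - {w}) :: 'k)"
          using w by (simp add: insert_absorb)
        moreover have "\<psi> (F - {w}) = sg p (F - {w}) * \<phi> (insert p (F - {w}))"
          using True False by (simp add: \<psi>_def)
        ultimately show ?thesis
          unfolding eq by (simp only: mult.assoc[symmetric] mult_minus_left[symmetric])
      next
        case Fa: False
        then have "a \<notin> cdom \<Delta> (insert p (F - {w}))" using ins by simp
        then have "\<phi> (insert p (F - {w})) = 0" using \<phi> by blast
        then show ?thesis using Fa unfolding eq by (simp add: \<psi>_def)
      qed
    qed
    finally show ?thesis by (simp add: cob_def)
  qed
  ultimately show ?thesis by blast
qed

text \<open>Without positive exponents, \<open>a\<close> lies in the localization at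
  \<open>F\<close> exactly if \<open>F\<close> is a face containing the support \<open>G\<close> of
  \<open>a\<close>. The complex is therefore the augmented cochain complex of the link of
  \<open>G\<close>, shifted by the size of \<open>G\<close>, and \<open>j < d\<close> puts it below
  the top degree of that link.\<close>

lemma cech_exact_link:
  fixes \<phi> :: "'a::linorder set \<Rightarrow> 'k::field" and a :: "'a \<Rightarrow> int"
  assumes \<Delta>: "simplicial_complex \<Delta>" and np: "\<And>w. a w \<le> 0" and j: "j < d"
    and link: "\<And>G i. G \<in> \<Delta> \<Longrightarrow> i + 1 < int d - int (card G) \<Longrightarrow> hom_zero TYPE('k) (lk \<Delta> G) i"
    and \<phi>: "\<And>F. \<phi> F \<noteq> 0 \<Longrightarrow> card F = j \<and> a \<in> cdom \<Delta> F"
    and cocyc: "\<And>F. a \<in> cdom \<Delta> F \<Longrightarrow> cob \<phi> F = 0"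
  shows "\<exists>\<psi>. (\<forall>F. \<psi> F \<noteq> 0 \<longrightarrow> Suc (card F) = j \<and> a \<in> cdom \<Delta> F) \<and>
    (\<forall>F. a \<in> cdom \<Delta> F \<longrightarrow> \<phi> F = cob \<psi> F)"
proof -
  define G where "G = {w. a w \<noteq> 0}"
  have dom: "a \<in> cdom \<Delta> F \<longleftrightarrow> G \<subseteq> F \<and> F \<in> \<Delta>" for F
  proof
    assume aF: "a \<in> cdom \<Delta> F"
    have "G \<subseteq> F"
    proof
      fix w assume "w \<in> G"
      then show "w \<in> F" using aF np[of w] unfolding G_def cdom_def by force
    qed
    then show "G \<subseteq> F \<and> F \<in> \<Delta>" using aF by (auto simp: cdom_def G_def Un_absorb1)
  next
    assume *: "G \<subseteq> F \<and> F \<in> \<Delta>"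
    then have "a w = 0" if "w \<notin> F" for w using that by (auto simp: G_def)
    then show "a \<in> cdom \<Delta> F" using * by (auto simp: cdom_def G_def Un_absorb1)
  qed
  show ?thesis
  proof (cases "G \<in> \<Delta>")
    case False
    then have "a \<notin> cdom \<Delta> F" for F using dom simplicial_complexD[OF \<Delta>] by blast
    then show ?thesis by (intro exI[of _ "\<lambda>_. 0"]) auto
  next
    case True
    let ?L = "lk \<Delta> G"
    have finG: "finite G" using True simplicial_complex_finite[OF \<Delta>] by blast
    have L: "K \<in> ?L \<longleftrightarrow> K \<inter> G = {} \<and> a \<in> cdom \<Delta> (K \<union> G)" for K
      unfolding lk_def dom using simplicial_complexD[OF \<Delta>, of "K \<union> G" K] by auto
    have finL: "finite K" if "K \<in> ?L" for K
      using that simplicial_complex_finite[OF \<Delta>] by (auto simp: lk_def)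
    have \<phi>0: "\<phi> F = 0" if "\<not> G \<subseteq> F" for F using \<phi>[of F] that dom by blast
    define g where "g H = twist G H * \<phi> (H \<union> G)" for H
    \<comment> \<open>\<open>j\<close> counts vertices including those of \<open>G\<close>; the
      corresponding face of the link has dimension one less than its number of vertices.\<close>
    define i where "i = int j - int (card G) - 1"
    have "hom_zero TYPE('k) ?L i" by (rule link[OF True]) (use j in \<open>simp add: i_def\<close>)
    moreover have "(\<Sum>w\<in>K. sg w (K - {w}) * g (K - {w})) = 0" if "K \<in> ?L" for K
      using cob_twist[where \<phi> = \<phi>, OF finG finL[OF that] _ \<phi>0] that cocyc[of "K \<union> G"]
      by (simp add: L g_def cob_def)
    ultimately obtain h where h: "\<And>K. K \<in> ?L \<Longrightarrow> int (card K) = i + 1 \<Longrightarrow> g K = cob h K"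
      unfolding cob_def using hom_zero_dual[OF simplicial_complex_lk[OF \<Delta>], of G i g] by blast
    define \<psi> where "\<psi> F = (if Suc (card F) = j \<and> a \<in> cdom \<Delta> F then twist G (F - G) * h (F - G) else 0)" for F
    have "\<phi> F = cob \<psi> F" if F: "a \<in> cdom \<Delta> F" for F
    proof (cases "card F = j")
      case False
      have "\<psi> (F - {w}) = 0" if "w \<in> F" for w
      proof -
        have "finite F" using F dom simplicial_complex_finite[OF \<Delta>] by blast
        then have "Suc (card (F - {w})) = card F" using that by (rule card_Suc_Diff1)
        then show ?thesis using False by (simp add: \<psi>_def)
      qed
      then have "cob \<psi> F = 0" unfolding cob_def by simp
      then show ?thesis using \<phi>[of F] False by auto
    next
      case card: True
      define K where "K = F - G"
      have KG: "K \<union> G = F" and KL: "K \<in> ?L" using F dom L by (auto simp: K_def Un_absorb2)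
      have KG0: "K \<inter> G = {}" by (auto simp: K_def)
      have "finite K" using finL KL by blast
      have cK: "int (card K) = i + 1"
        using card_Un_disjoint[OF \<open>finite K\<close> finG KG0] card KG by (simp add: i_def)
      have \<psi>0: "\<psi> F = 0" if "\<not> G \<subseteq> F" for F using that dom by (auto simp: \<psi>_def)
      have "cob (\<lambda>H. twist G H * \<psi> (H \<union> G)) K = cob h K"
        unfolding cob_def
      proof (intro sum.cong refl)
        fix w assume w: "w \<in> K"
        have KwL: "K - {w} \<in> ?L" using simplicial_complexD[OF simplicial_complex_lk[OF \<Delta>] KL] by blast
        have "K - {w} \<union> G = F - {w}" using w KG KG0 by auto
        moreover have "finite F" using F dom simplicial_complex_finite[OF \<Delta>] by blast
        then have "Suc (card (F - {w})) = j"
          by (subst card_Suc_Diff1) (use w card in \<open>auto simp: K_def\<close>)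
        ultimately have "Suc (card (K - {w} \<union> G)) = j" by simp
        moreover have "(K - {w} \<union> G) - G = K - {w}" using KG0 by auto
        ultimately have "\<psi> (K - {w} \<union> G) = twist G (K - {w}) * h (K - {w})"
          using KwL by (simp add: \<psi>_def L)
        then show "sg w (K - {w}) * (twist G (K - {w}) * \<psi> (K - {w} \<union> G)) = sg w (K - {w}) * h (K - {w})"
          by (simp add: twist_square flip: mult.assoc)
      qed
      also have "\<dots> = g K" using h[OF KL cK] by simp
      also have "\<dots> = twist G K * \<phi> F" by (simp add: g_def KG)
      finally have "twist G K * cob \<psi> F = twist G K * \<phi> F"
        using cob_twist[where \<phi> = \<psi>, OF finG \<open>finite K\<close> KG0 \<psi>0] KG by simp
      then have "twist G K * twist G K * cob \<psi> F = twist G K * twist G K * \<phi> F"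
        by (simp only: mult.assoc)
      then show ?thesis by (simp add: twist_square)
    qed
    moreover have "Suc (card F) = j \<and> a \<in> cdom \<Delta> F" if "\<psi> F \<noteq> 0" for F
      using that by (auto simp: \<psi>_def split: if_splits)
    ultimately show ?thesis by blast
  qed
qed

lemma cech_exact:
  fixes \<phi> :: "'a::linorder set \<Rightarrow> 'k::field" and a :: "'a \<Rightarrow> int"
  assumes "simplicial_complex \<Delta>" "j < d"
    and "\<And>G i. G \<in> \<Delta> \<Longrightarrow> i + 1 < int d - int (card G) \<Longrightarrow> hom_zero TYPE('k) (lk \<Delta> G) i"
    and "\<And>F. \<phi> F \<noteq> 0 \<Longrightarrow> card F = j \<and> a \<in> cdom \<Delta> F"
    and "\<And>F. a \<in> cdom \<Delta> F \<Longrightarrow> cob \<phi> F = 0"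
  shows "\<exists>\<psi>. (\<forall>F. \<psi> F \<noteq> 0 \<longrightarrow> Suc (card F) = j \<and> a \<in> cdom \<Delta> F) \<and>
    (\<forall>F. a \<in> cdom \<Delta> F \<longrightarrow> \<phi> F = cob \<psi> F)"
proof (cases "\<exists>p. 0 < a p")
  case True
  then show ?thesis using cech_exact_cone[OF assms(1) _ assms(4,5)] by blast
next
  case False
  then have "a w \<le> 0" for w by (meson not_le)
  from cech_exact_link[OF assms(1) this assms(2-5)] show ?thesis by blast
qed

section \<open>The double complex and its zigzag\<close>

definition dchain :: "'a set set \<Rightarrow> 'i set \<Rightarrow> nat \<Rightarrow> nat \<Rightarrow>
    ('a set \<Rightarrow> 'i set \<Rightarrow> ('a \<Rightarrow> int) \<Rightarrow> 'k::field) \<Rightarrow> bool" where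
  "dchain \<Delta> N j p c \<longleftrightarrow> (\<forall>F B a. c F B a \<noteq> 0 \<longrightarrow> card F = j \<and> B \<subseteq> N \<and> card B = p \<and> a \<in> cdom \<Delta> F)"

text \<open>\<open>F\<close> lists the inverted variables, so \<open>j\<close> in
  \<open>dchain\<close> is the Cech degree and \<open>p\<close> the Koszul degree. All sets
  \<open>F\<close> are allowed, since \<open>cdom\<close> is empty for non-faces of a simplicial
  complex.\<close>

definition rowd :: "'a set set \<Rightarrow> 'i::linorder set \<Rightarrow> ('i \<Rightarrow> 'a \<Rightarrow> 'k::field) \<Rightarrow>
    ('a set \<Rightarrow> 'i set \<Rightarrow> ('a \<Rightarrow> int) \<Rightarrow> 'k) \<Rightarrow> 'a set \<Rightarrow> 'i set \<Rightarrow> ('a \<Rightarrow> int) \<Rightarrow> 'k" where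
  "rowd \<Delta> N t c F = kz N (\<lambda>i. mulop (\<Union>\<Delta>) (cdom \<Delta> F) (t i)) (c F)"

definition cold :: "'a::linorder set set \<Rightarrow> ('a set \<Rightarrow> 'i set \<Rightarrow> ('a \<Rightarrow> int) \<Rightarrow> 'k::field) \<Rightarrow>
    'a set \<Rightarrow> 'i set \<Rightarrow> ('a \<Rightarrow> int) \<Rightarrow> 'k" where
  "cold \<Delta> c F B a = (if a \<in> cdom \<Delta> F then cob (\<lambda>F. c F B a) F else 0)"

lemma dchain_kchain: "dchain \<Delta> N j p c \<Longrightarrow> kchain N p (cdom \<Delta> F) (c F)"
  unfolding dchain_def kchain_def by blast

lemma dchain_diff: "dchain \<Delta> N j p c \<Longrightarrow> dchain \<Delta> N j p e \<Longrightarrow> dchain \<Delta> N j p (\<lambda>F B a. c F B a - e F B a)"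
  unfolding dchain_def by (metis diff_zero)

lemma finite_cdom: "simplicial_complex \<Delta> \<Longrightarrow> a \<in> cdom \<Delta> F \<Longrightarrow> finite F"
  using simplicial_complex_finite[of \<Delta> "{w. a w \<noteq> 0} \<union> F"] by (simp add: cdom_def)

lemma dchain_rowd:
  assumes "dchain \<Delta> N j (Suc p) c" "finite N"
  shows "dchain \<Delta> N j p (rowd \<Delta> N t c)"
  unfolding dchain_def
proof (intro allI impI)
  fix F B a assume nz: "rowd \<Delta> N t c F B a \<noteq> 0"
  have "kchain N p (cdom \<Delta> F) (rowd \<Delta> N t c F)"
    unfolding rowd_def by (rule kchain_kz[OF dchain_kchain[OF assms(1)] assms(2)])
  then have "B \<subseteq> N \<and> card B = p \<and> a \<in> cdom \<Delta> F" using nz unfolding kchain_def by blast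
  moreover have "card F = j"
  proof (rule ccontr)
    assume "card F \<noteq> j"
    then have "c F = (\<lambda>B x. 0)" using assms(1) unfolding dchain_def fun_eq_iff by blast
    then show False using nz by (simp add: rowd_def)
  qed
  ultimately show "card F = j \<and> B \<subseteq> N \<and> card B = p \<and> a \<in> cdom \<Delta> F" by blast
qed

lemma dchain_cold:
  assumes "simplicial_complex \<Delta>" "dchain \<Delta> N j p c"
  shows "dchain \<Delta> N (Suc j) p (cold \<Delta> c)"
  unfolding dchain_def
proof (intro allI impI)
  fix F B a assume nz: "cold \<Delta> c F B a \<noteq> 0"
  then have a: "a \<in> cdom \<Delta> F" and "cob (\<lambda>F. c F B a) F \<noteq> 0" by (auto simp: cold_def split: if_splits)
  then obtain w where w: "w \<in> F" "c (F - {w}) B a \<noteq> 0"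
    unfolding cob_def by (metis (no_types, lifting) mult_zero_right sum.neutral)
  then have "card (F - {w}) = j" "B \<subseteq> N" "card B = p" using assms(2) unfolding dchain_def by blast+
  then show "card F = Suc j \<and> B \<subseteq> N \<and> card B = p \<and> a \<in> cdom \<Delta> F"
    using a card_Suc_Diff1[OF finite_cdom[OF assms(1) a] w(1)] by simp
qed

lemma rowd_rowd:
  assumes "simplicial_complex \<Delta>" "finite N" "dchain \<Delta> N j p c"
  shows "rowd \<Delta> N t (rowd \<Delta> N t c) = (\<lambda>F B a. 0)"
  using kz_kz[OF assms(2) dec_convex_cdom[OF assms(1)] dchain_kchain[OF assms(3)]]
  by (simp add: rowd_def fun_eq_iff)

lemma rowd_diff: "rowd \<Delta> N t (\<lambda>F B a. c F B a - e F B a) F B a = rowd \<Delta> N t c F B a - rowd \<Delta> N t e F B a"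
  by (simp add: rowd_def kz_diff)

lemma cold_diff: "cold \<Delta> (\<lambda>F B a. c F B a - e F B a) F B a = cold \<Delta> c F B a - cold \<Delta> e F B a"
  by (simp add: cold_def cob_def right_diff_distrib sum_subtractf)

lemma cold_zero [simp]: "cold \<Delta> (\<lambda>F B a. 0) = (\<lambda>F B a. 0)"
  by (simp add: cold_def cob_def fun_eq_iff)

lemma rowd_zero [simp]: "rowd \<Delta> N t (\<lambda>F B a. 0) = (\<lambda>F B a. 0)"
  by (simp add: rowd_def fun_eq_iff)

lemma cdom_remove:
  assumes "simplicial_complex \<Delta>" "a \<in> cdom \<Delta> F" "G \<subseteq> F" "\<And>w. w \<notin> G \<Longrightarrow> 0 \<le> a w"
  shows "a \<in> cdom \<Delta> G"
proof -
  have "{w. a w \<noteq> 0} \<union> G \<in> \<Delta>"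
    by (rule simplicial_complexD[OF assms(1), of "{w. a w \<noteq> 0} \<union> F"])
      (use assms(2,3) in \<open>auto simp: cdom_def\<close>)
  then show ?thesis using assms(4) by (simp add: cdom_def)
qed

lemma cold_cold:
  fixes c :: "'a::linorder set \<Rightarrow> 'i set \<Rightarrow> ('a \<Rightarrow> int) \<Rightarrow> 'k::field"
  assumes \<Delta>: "simplicial_complex \<Delta>" and c: "dchain \<Delta> N j p c"
  shows "cold \<Delta> (cold \<Delta> c) F B a = 0"
proof (cases "a \<in> cdom \<Delta> F")
  case True
  have finF: "finite F" using finite_cdom[OF \<Delta> True] .
  have "cold \<Delta> c (F - {w}) B a =
      (\<Sum>v\<in>F - {w}. sg v (F - {w} - {v}) * c (F - {w} - {v}) B a)" for w
  proof (cases "a \<in> cdom \<Delta> (F - {w})")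
    case False
    then have "\<not> (\<forall>u. u \<notin> F - {w} \<longrightarrow> 0 \<le> a u)" using cdom_remove[OF \<Delta> True, of "F - {w}"] by blast
    then have "a \<notin> cdom \<Delta> (F - {w} - {v})" for v by (auto simp: cdom_def)
    then have "c (F - {w} - {v}) B a = 0" for v using c unfolding dchain_def by blast
    then show ?thesis using False by (simp add: cold_def)
  qed (simp add: cold_def cob_def)
  then have "cold \<Delta> (cold \<Delta> c) F B a =
      (\<Sum>w\<in>F. \<Sum>v\<in>F - {w}. sg w (F - {w}) * (sg v (F - {w} - {v}) * c (F - {w} - {v}) B a))"
    using True by (simp add: cold_def[of \<Delta> "cold \<Delta> c"] cob_def sum_distrib_left)
  also have "\<dots> = 0"
  proof (rule sum_antisym_pairs_eq_0[OF finF])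
    fix w v assume wv: "w \<in> F" "v \<in> F" "w \<noteq> v"
    define G where "G = F - {w} - {v}"
    have G: "F - {w} - {v} = G" "F - {v} - {w} = G" "F - {w} = insert v G" "F - {v} = insert w G"
      "finite G" "w \<notin> G" "v \<notin> G" "G - {v} = G" "G - {w} = G"
      using wv finF by (auto simp: G_def)
    have "sg v G * sg w (insert v G) = - (sg w G * (sg v (insert w G) :: 'k))"
      by (rule sg_swap) (use G wv in auto)
    from arg_cong[OF this, of "\<lambda>r. r * c G B a"]
    show "sg w (F - {w}) * (sg v (F - {w} - {v}) * c (F - {w} - {v}) B a) =
        - (sg v (F - {v}) * (sg w (F - {v} - {w}) * c (F - {v} - {w}) B a))"
      unfolding G(3,4) by (simp add: G(8,9) mult_ac)
  qed
  finally show ?thesis .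
qed (simp add: cold_def)

lemma cold_rowd:
  fixes c :: "'a::linorder set \<Rightarrow> 'i::linorder set \<Rightarrow> ('a \<Rightarrow> int) \<Rightarrow> 'k::field"
  assumes \<Delta>: "simplicial_complex \<Delta>" and c: "dchain \<Delta> N j p c"
  shows "cold \<Delta> (rowd \<Delta> N t c) F B a = rowd \<Delta> N t (cold \<Delta> c) F B a"
proof (cases "a \<in> cdom \<Delta> F")
  case True
  let ?Y = "\<Union>\<Delta>"
  \<comment> \<open>Both truncations are harmless: wherever one cuts off a term, the coefficient of
    \<open>c\<close> is zero anyway (facts 1 and 2). What remains is a reordering of a triple
    sum.\<close>
  have 1: "mulop ?Y (cdom \<Delta> (F - {w})) s (c (F - {w}) B') a =
      (\<Sum>y\<in>?Y. s y * c (F - {w}) B' (dec a y))" for w s B'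
  proof (cases "a \<in> cdom \<Delta> (F - {w})")
    case False
    have "c (F - {w}) B' (dec a y) = 0" for y
    proof (rule ccontr)
      assume "c (F - {w}) B' (dec a y) \<noteq> 0"
      then have "dec a y \<in> cdom \<Delta> (F - {w})" using c unfolding dchain_def by blast
      then have "0 \<le> a u" if "u \<notin> F - {w}" for u
        using that order_trans[OF _ dec_le[of a y u], of 0] unfolding cdom_def by blast
      then show False using cdom_remove[OF \<Delta> True, of "F - {w}"] False by blast
    qed
    then show ?thesis using False by (simp add: mulop_def)
  qed (simp add: mulop_def)
  have 2: "cold \<Delta> c F B' (dec a y) = cob (\<lambda>F. c F B' (dec a y)) F" for B' y
  proof (cases "dec a y \<in> cdom \<Delta> F")
    case False
    then have "\<not> (\<forall>u. u \<notin> F \<longrightarrow> 0 \<le> dec a y u)" using cdom_dec[OF \<Delta> True] by blast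
    then have "dec a y \<notin> cdom \<Delta> (F - {w})" for w by (auto simp: cdom_def)
    then have "c (F - {w}) B' (dec a y) = 0" for w using c unfolding dchain_def by blast
    then show ?thesis using False by (simp add: cold_def cob_def)
  qed (simp add: cold_def)
  have "cold \<Delta> (rowd \<Delta> N t c) F B a = (\<Sum>w\<in>F. \<Sum>i\<in>N - B. \<Sum>y\<in>?Y.
      sg w (F - {w}) * (sg i B * (t i y * c (F - {w}) (insert i B) (dec a y))))"
    using True by (simp add: cold_def cob_def rowd_def kz_def 1 sum_distrib_left)
  also have "\<dots> = (\<Sum>i\<in>N - B. \<Sum>w\<in>F. \<Sum>y\<in>?Y.
      sg w (F - {w}) * (sg i B * (t i y * c (F - {w}) (insert i B) (dec a y))))"
    by (rule sum.swap)
  also have "\<dots> = (\<Sum>i\<in>N - B. \<Sum>y\<in>?Y. \<Sum>w\<in>F.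
      sg w (F - {w}) * (sg i B * (t i y * c (F - {w}) (insert i B) (dec a y))))"
    by (intro sum.cong refl sum.swap)
  also have "\<dots> = (\<Sum>i\<in>N - B. \<Sum>y\<in>?Y. \<Sum>w\<in>F.
      sg i B * (t i y * (sg w (F - {w}) * c (F - {w}) (insert i B) (dec a y))))"
    by (simp only: mult.left_commute)
  also have "\<dots> = rowd \<Delta> N t (cold \<Delta> c) F B a"
    using True by (simp add: rowd_def kz_def mulop_def 2 cob_def sum_distrib_left)
  finally show ?thesis .
next
  case False
  then show ?thesis by (simp add: cold_def rowd_def kz_def mulop_def)
qed

text \<open>The index \<open>Suc j\<close> forces \<open>F\<close> to be nonempty, so some variable
  is invertible and the localized Koszul complex is exact.\<close>

lemma rowd_exact:
  fixes c :: "'a::linorder set \<Rightarrow> 'i::linorder set \<Rightarrow> ('a \<Rightarrow> int) \<Rightarrow> 'k::field"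
  assumes \<Delta>: "simplicial_complex \<Delta>" and N: "finite N"
    and span: "\<And>G w. G \<in> \<Delta> \<Longrightarrow> w \<in> G \<Longrightarrow>
      \<exists>\<alpha>. \<forall>y\<in>G. (\<Sum>i\<in>N. \<alpha> i * t i y) = (if y = w then 1 else 0)"
    and c: "dchain \<Delta> N (Suc j) p c" and cyc: "rowd \<Delta> N t c = (\<lambda>F B a. 0)"
  shows "\<exists>b. dchain \<Delta> N (Suc j) (Suc p) b \<and> c = rowd \<Delta> N t b"
proof -
  let ?X = "\<lambda>F i. mulop (\<Union>\<Delta>) (cdom \<Delta> F) (t i)"
  have "\<exists>b. kchain N (Suc p) (cdom \<Delta> F) b \<and> c F = kz N (?X F) b \<and> (card F \<noteq> Suc j \<longrightarrow> b = (\<lambda>B a. 0))" for F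
  proof (cases "card F = Suc j")
    case True
    then obtain w where w: "w \<in> F" by fastforce
    have "kz N (?X F) (c F) = (\<lambda>B a. 0)" using cyc by (simp add: rowd_def fun_eq_iff)
    from koszul_exact_localization[OF \<Delta> N w span dchain_kchain[OF c] this]
    show ?thesis using True by simp
  next
    case False
    then have "c F = (\<lambda>B a. 0)" using c unfolding dchain_def fun_eq_iff by blast
    then show ?thesis by (intro exI[of _ "\<lambda>B a. 0"]) simp
  qed
  then obtain b where b: "\<And>F. kchain N (Suc p) (cdom \<Delta> F) (b F)" "\<And>F. c F = kz N (?X F) (b F)"
    "\<And>F. card F \<noteq> Suc j \<Longrightarrow> b F = (\<lambda>B a. 0)"
    by metis
  have "dchain \<Delta> N (Suc j) (Suc p) b"
    using b(1,3) unfolding dchain_def kchain_def by metis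
  moreover have "c = rowd \<Delta> N t b" using b(2) by (simp add: rowd_def fun_eq_iff)
  ultimately show ?thesis by blast
qed

text \<open>Columns are exact separately for each basis element \<open>B\<close> and exponent
  \<open>a\<close>. For \<open>j = 0\<close> there is no preceding column; the zero preimage then
  says that \<open>cold\<close> is injective.\<close>

lemma cold_exact:
  fixes c :: "'a::linorder set \<Rightarrow> 'i::linorder set \<Rightarrow> ('a \<Rightarrow> int) \<Rightarrow> 'k::field"
  assumes \<Delta>: "simplicial_complex \<Delta>" "j < d"
    and link: "\<And>G i. G \<in> \<Delta> \<Longrightarrow> i + 1 < int d - int (card G) \<Longrightarrow> hom_zero TYPE('k) (lk \<Delta> G) i"
    and c: "dchain \<Delta> N j p c" and cyc: "cold \<Delta> c = (\<lambda>F B a. 0)"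
  shows "\<exists>e. (\<forall>j'. j = Suc j' \<longrightarrow> dchain \<Delta> N j' p e) \<and> (j = 0 \<longrightarrow> e = (\<lambda>F B a. 0)) \<and> c = cold \<Delta> e"
proof -
  have "\<exists>\<psi>. (\<forall>F. \<psi> F \<noteq> 0 \<longrightarrow> Suc (card F) = j \<and> a \<in> cdom \<Delta> F \<and> B \<subseteq> N \<and> card B = p) \<and>
    (\<forall>F. a \<in> cdom \<Delta> F \<longrightarrow> c F B a = cob \<psi> F)" for B and a :: "'a \<Rightarrow> int"
  proof (cases "B \<subseteq> N \<and> card B = p")
    case True
    have 1: "cob (\<lambda>F. c F B a) F = 0" if "a \<in> cdom \<Delta> F" for F
      using cyc that unfolding cold_def fun_eq_iff by metis
    have 2: "card F = j \<and> a \<in> cdom \<Delta> F" if "c F B a \<noteq> 0" for F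
      using c that unfolding dchain_def by blast
    have "\<exists>\<psi>. (\<forall>F. \<psi> F \<noteq> 0 \<longrightarrow> Suc (card F) = j \<and> a \<in> cdom \<Delta> F) \<and>
        (\<forall>F. a \<in> cdom \<Delta> F \<longrightarrow> c F B a = cob \<psi> F)"
      by (rule cech_exact[OF \<Delta>]) (use link 1 2 in auto)
    then obtain \<psi> where "\<forall>F. \<psi> F \<noteq> 0 \<longrightarrow> Suc (card F) = j \<and> a \<in> cdom \<Delta> F"
      "\<forall>F. a \<in> cdom \<Delta> F \<longrightarrow> c F B a = cob \<psi> F"
      by (elim exE conjE)
    then show ?thesis using True by (intro exI[of _ \<psi>]) simp
  next
    case False
    then have "c F B a = 0" for F using c unfolding dchain_def by blast
    then show ?thesis by (intro exI[of _ "\<lambda>F. 0"]) (simp add: cob_def)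
  qed
  then have "\<exists>e. \<forall>B a. (\<forall>F. e B a F \<noteq> 0 \<longrightarrow>
        Suc (card F) = j \<and> a \<in> cdom \<Delta> F \<and> B \<subseteq> N \<and> card B = p) \<and>
      (\<forall>F. a \<in> cdom \<Delta> F \<longrightarrow> c F B a = cob (e B a) F)"
    by (intro choice allI)
  then obtain e where e0: "\<forall>B a. (\<forall>F. e B a F \<noteq> 0 \<longrightarrow>
        Suc (card F) = j \<and> a \<in> cdom \<Delta> F \<and> B \<subseteq> N \<and> card B = p) \<and>
      (\<forall>F. a \<in> cdom \<Delta> F \<longrightarrow> c F B a = cob (e B a) F)" ..
  have e1: "Suc (card F) = j \<and> a \<in> cdom \<Delta> F \<and> B \<subseteq> N \<and> card B = p" if "e B a F \<noteq> 0" for B a F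
    using e0 that by simp
  have e2: "c F B a = cob (e B a) F" if "a \<in> cdom \<Delta> F" for B a F
    using e0 that by simp
  define e' where "e' F B a = e B a F" for F B a
  have "c F B a = cold \<Delta> e' F B a" for F B a
  proof (cases "a \<in> cdom \<Delta> F")
    case False
    then have "c F B a = 0" using c unfolding dchain_def by blast
    then show ?thesis using False by (simp add: cold_def)
  qed (simp add: cold_def e'_def e2)
  moreover have "dchain \<Delta> N j' p e'" if "j = Suc j'" for j'
    unfolding dchain_def e'_def using e1 that by blast
  moreover have "e' = (\<lambda>F B a. 0)" if "j = 0"
    using e1 that by (auto simp: e'_def fun_eq_iff)
  ultimately show ?thesis by (intro exI[of _ e']) (simp add: fun_eq_iff)
qed

lemma dchain_zero [simp]: "dchain \<Delta> N j p (\<lambda>F B a. 0)"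
  by (simp add: dchain_def)

lemma dchain_gt_card:
  assumes "dchain \<Delta> N j p c" "finite N" "card N < p"
  shows "c = (\<lambda>F B a. 0)"
  using kchain_gt_card[OF dchain_kchain[OF assms(1)] assms(2,3)] by (simp add: fun_eq_iff)

text \<open>\<open>cold \<Delta> e\<close> is a row cycle, hence a row boundary of some
  \<open>b\<close> one column further. By induction \<open>b\<close> can be changed by a row
  boundary into a column cycle, which is the image of some \<open>f\<close>; rows and columns
  commute, so \<open>f\<close> is the required chain. Columns are exact only up to
  \<open>card N\<close>, but \<open>j < p\<close> makes \<open>b\<close> vanish beyond that point
  because its Koszul degree exceeds \<open>card N\<close>.\<close>

lemma koszul_zigzag:
  fixes e :: "'a::linorder set \<Rightarrow> 'i::linorder set \<Rightarrow> ('a \<Rightarrow> int) \<Rightarrow> 'k::field"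
  assumes \<Delta>: "simplicial_complex \<Delta>" and N: "finite N"
    and link: "\<And>G i. G \<in> \<Delta> \<Longrightarrow> i + 1 < int (card N) - int (card G) \<Longrightarrow> hom_zero TYPE('k) (lk \<Delta> G) i"
    and span: "\<And>G w. G \<in> \<Delta> \<Longrightarrow> w \<in> G \<Longrightarrow>
      \<exists>\<alpha>. \<forall>y\<in>G. (\<Sum>i\<in>N. \<alpha> i * t i y) = (if y = w then 1 else 0)"
    and "j < p" "dchain \<Delta> N j p e" "cold \<Delta> (rowd \<Delta> N t e) = (\<lambda>F B a. 0)"
  shows "\<exists>g. dchain \<Delta> N j (Suc p) g \<and> cold \<Delta> e = cold \<Delta> (rowd \<Delta> N t g)"
  using assms(5-7)
proof (induction "card N - j" arbitrary: j p e)
  case 0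
  then have "e = (\<lambda>F B a. 0)" using dchain_gt_card[OF _ N, of \<Delta> j p e] by simp
  then show ?case by (intro exI[of _ "\<lambda>F B a. 0"]) simp
next
  case (Suc n)
  have comm: "cold \<Delta> (rowd \<Delta> N t c) = rowd \<Delta> N t (cold \<Delta> c)"
    if "dchain \<Delta> N j p c" for j p and c :: "'a set \<Rightarrow> 'i set \<Rightarrow> ('a \<Rightarrow> int) \<Rightarrow> 'k"
    by (intro ext cold_rowd[OF \<Delta> that])
  have c: "dchain \<Delta> N (Suc j) p (cold \<Delta> e)" by (rule dchain_cold[OF \<Delta> Suc.prems(2)])
  have "rowd \<Delta> N t (cold \<Delta> e) = (\<lambda>F B a. 0)" using Suc.prems(3) comm[OF Suc.prems(2)] by simp
  from rowd_exact[OF \<Delta> N span c this] obtain b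
    where b: "dchain \<Delta> N (Suc j) (Suc p) b" "cold \<Delta> e = rowd \<Delta> N t b" by blast
  show ?case
  proof (cases "Suc j < card N")
    case False
    then have "b = (\<lambda>F B a. 0)" using dchain_gt_card[OF b(1) N] Suc.prems(1) by simp
    then show ?thesis using b(2) by (intro exI[of _ "\<lambda>F B a. 0"]) simp
  next
    case True
    have "cold \<Delta> (rowd \<Delta> N t b) = (\<lambda>F B a. 0)"
      unfolding b(2)[symmetric] using cold_cold[OF \<Delta> Suc.prems(2)] by (simp add: fun_eq_iff)
    moreover have "n = card N - Suc j" using Suc.hyps(2) by simp
    ultimately obtain g where g: "dchain \<Delta> N (Suc j) (Suc (Suc p)) g" "cold \<Delta> b = cold \<Delta> (rowd \<Delta> N t g)"
      using Suc.hyps(1)[of "Suc j" "Suc p" b] Suc.prems(1) b(1) by auto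
    define x where "x = (\<lambda>F B a. b F B a - rowd \<Delta> N t g F B a)"
    have x: "dchain \<Delta> N (Suc j) (Suc p) x"
      unfolding x_def by (rule dchain_diff[OF b(1) dchain_rowd[OF g(1) N]])
    have "cold \<Delta> x = (\<lambda>F B a. 0)" using g(2) by (simp add: x_def cold_diff fun_eq_iff)
    from cold_exact[OF \<Delta> True link x this] obtain f
      where f: "dchain \<Delta> N j (Suc p) f" "x = cold \<Delta> f" by blast
    have "rowd \<Delta> N t x = rowd \<Delta> N t b"
      using rowd_rowd[OF \<Delta> N g(1)] by (simp add: x_def rowd_diff fun_eq_iff)
    then have "cold \<Delta> e = cold \<Delta> (rowd \<Delta> N t f)" using b(2) f(2) comm[OF f(1)] by simp
    then show ?thesis using f(1) by blast
  qed
qed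

text \<open>The face ring itself sits at \<open>F = {}\<close>. The zigzag changes \<open>c\<close>
  by a Koszul boundary into an element that \<open>cold\<close> kills, and \<open>cold\<close> is
  injective on this column. The condition \<open>0 < p\<close> is \<open>j < p\<close> at
  \<open>j = 0\<close>.\<close>

theorem koszul_exact:
  fixes c :: "'i::linorder set \<Rightarrow> ('a::linorder \<Rightarrow> int) \<Rightarrow> 'k::field"
  assumes \<Delta>: "simplicial_complex \<Delta>" and N: "finite N"
    and link: "\<And>G i. G \<in> \<Delta> \<Longrightarrow> i + 1 < int (card N) - int (card G) \<Longrightarrow> hom_zero TYPE('k) (lk \<Delta> G) i"
    and span: "\<And>G w. G \<in> \<Delta> \<Longrightarrow> w \<in> G \<Longrightarrow>
      \<exists>\<alpha>. \<forall>y\<in>G. (\<Sum>i\<in>N. \<alpha> i * t i y) = (if y = w then 1 else 0)"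
    and p: "0 < p" and c: "kchain N p (cdom \<Delta> {}) c"
    and cyc: "kz N (\<lambda>i. mulop (\<Union>\<Delta>) (cdom \<Delta> {}) (t i)) c = (\<lambda>B a. 0)"
  shows "\<exists>b. kchain N (Suc p) (cdom \<Delta> {}) b \<and> c = kz N (\<lambda>i. mulop (\<Union>\<Delta>) (cdom \<Delta> {}) (t i)) b"
proof (cases "card N = 0")
  case True
  then have "c = (\<lambda>B a. 0)" using kchain_gt_card[OF c N] p by simp
  then show ?thesis by (intro exI[of _ "\<lambda>B a. 0"]) simp
next
  case False
  define e where "e F = (if F = {} then c else (\<lambda>B a. 0))" for F :: "'a set"
  have e: "dchain \<Delta> N 0 p e" using c by (auto simp: dchain_def kchain_def e_def)
  have "rowd \<Delta> N t e = (\<lambda>F B a. 0)" using cyc by (auto simp: rowd_def e_def fun_eq_iff)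
  then have "cold \<Delta> (rowd \<Delta> N t e) = (\<lambda>F B a. 0)" by simp
  from koszul_zigzag[OF \<Delta> N link span p e this] obtain g
    where g: "dchain \<Delta> N 0 (Suc p) g" "cold \<Delta> e = cold \<Delta> (rowd \<Delta> N t g)" by blast
  define x where "x = (\<lambda>F B a. e F B a - rowd \<Delta> N t g F B a)"
  have x: "dchain \<Delta> N 0 p x"
    unfolding x_def by (rule dchain_diff[OF e dchain_rowd[OF g(1) N]])
  have "cold \<Delta> x = (\<lambda>F B a. 0)" using g(2) by (simp add: x_def cold_diff fun_eq_iff)
  with cold_exact[OF \<Delta> _ link x] False have "x = (\<lambda>F B a. 0)" by auto
  then have "x {} B a = 0" for B a by simp
  then have "c = kz N (\<lambda>i. mulop (\<Union>\<Delta>) (cdom \<Delta> {}) (t i)) (g {})"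
    by (simp add: x_def e_def rowd_def fun_eq_iff)
  then show ?thesis using dchain_kchain[OF g(1)] by blast
qed

section \<open>Carrier conditions\<close>

abbreviation supp :: "('a \<Rightarrow> int) \<Rightarrow> 'a set" where
  "supp a \<equiv> {w. a w \<noteq> 0}"

text \<open>To be read with \<open>\<Delta> = lk \<Gamma> E\<close>, \<open>\<kappa> G = \<sigma> (G \<union> E)\<close> and \<open>t i y\<close> the coefficient of \<open>x\<^sub>y\<close> in \<open>\<theta>\<^sub>i\<close>.\<close>

locale carrier_complex =
  fixes \<Delta> :: "'a::linorder set set" and \<kappa> :: "'a set \<Rightarrow> 'b set" and V :: "'b set"
    and N :: "'i::linorder set" and t :: "'i \<Rightarrow> 'a \<Rightarrow> 'k::field" and \<iota> :: "'b \<Rightarrow> 'i"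
  assumes \<Delta>: "simplicial_complex \<Delta>" and N: "finite N"
    and mono: "\<And>G H. H \<in> \<Delta> \<Longrightarrow> G \<subseteq> H \<Longrightarrow> \<kappa> G \<subseteq> \<kappa> H"
    and \<kappa>V: "\<And>G. G \<in> \<Delta> \<Longrightarrow> \<kappa> G \<subseteq> V"
    and inj: "inj_on \<iota> (V - \<kappa> {})"
    and special: "\<And>u y. u \<in> V - \<kappa> {} \<Longrightarrow> {y} \<in> \<Delta> \<Longrightarrow> t (\<iota> u) y \<noteq> 0 \<Longrightarrow> u \<in> \<kappa> {y}"
    and span: "\<And>G w. G \<in> \<Delta> \<Longrightarrow> w \<in> G \<Longrightarrow>
      \<exists>\<alpha>. \<forall>y\<in>G. (\<Sum>i\<in>N. \<alpha> i * t i y) = (if y = w then 1 else 0)"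
    and link: "\<And>W G i. \<kappa> {} \<subseteq> W \<Longrightarrow> W \<subseteq> V \<Longrightarrow> G \<in> \<Delta> \<Longrightarrow> \<kappa> G \<subseteq> W \<Longrightarrow>
      i + 1 < int (card (N - \<iota> ` (V - W))) - int (card G) \<Longrightarrow>
      hom_zero TYPE('k) (lk {H \<in> \<Delta>. \<kappa> H \<subseteq> W} G) i"
begin

definition below :: "'b set \<Rightarrow> 'a set set" where
  "below W = {H \<in> \<Delta>. \<kappa> H \<subseteq> W}"

text \<open>The parameters left on \<open>below W\<close>: those of the elements of V - W vanish
  there when \<open>W\<close> contains the carrier of the empty set.\<close>

definition idx :: "'b set \<Rightarrow> 'i set" where
  "idx W = N - \<iota> ` (V - W)"

abbreviation dom :: "'b set \<Rightarrow> ('a \<Rightarrow> int) set" where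
  "dom W \<equiv> cdom (below W) {}"

definition bdK :: "'b set \<Rightarrow> ('i set \<Rightarrow> ('a \<Rightarrow> int) \<Rightarrow> 'k) \<Rightarrow> 'i set \<Rightarrow> ('a \<Rightarrow> int) \<Rightarrow> 'k" where
  "bdK W = kz (idx W) (\<lambda>i. mulop (\<Union>(below W)) (dom W) (t i))"

text \<open>The subcomplex of the Koszul complex of the face ring of \<open>below W\<close> in which a monomial in the
  component \<open>B\<close> must have a carrier containing every \<open>s \<in> S\<close> with \<open>\<iota> s \<notin> B\<close>.\<close>

definition relaxed :: "'b set \<Rightarrow> 'b set \<Rightarrow> nat \<Rightarrow> ('i set \<Rightarrow> ('a \<Rightarrow> int) \<Rightarrow> 'k) \<Rightarrow> bool" where
  "relaxed W S p c \<longleftrightarrow> kchain (idx W) p (dom W) c \<and>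
     (\<forall>B a s. c B a \<noteq> 0 \<longrightarrow> s \<in> S \<longrightarrow> \<iota> s \<notin> B \<longrightarrow> s \<in> \<kappa> (supp a))"

lemma simplicial_complex_below: "simplicial_complex (below W)"
  unfolding simplicial_complex_def
proof (intro conjI ballI allI impI)
  show "finite (below W)" using \<Delta> by (simp add: simplicial_complex_def below_def)
  fix F assume F: "F \<in> below W"
  then show "finite F" using simplicial_complex_finite[OF \<Delta>] by (simp add: below_def)
  fix G assume "G \<subseteq> F"
  then show "G \<in> below W"
    using F mono[of F G] simplicial_complexD[OF \<Delta>, of F G] by (auto simp: below_def)
qed

lemma finite_idx: "finite (idx W)"
  using N by (simp add: idx_def)

lemma dom_iff: "a \<in> dom W \<longleftrightarrow> (\<forall>w. 0 \<le> a w) \<and> supp a \<in> \<Delta> \<and> \<kappa> (supp a) \<subseteq> W"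
  by (auto simp: cdom_def below_def)

lemma supp_dec: "y \<in> supp a \<Longrightarrow> supp (dec a y) \<subseteq> supp a"
  by (auto simp: dec_def split: if_splits)

lemma supp_carrier: "supp a \<in> \<Delta> \<Longrightarrow> y \<in> supp a \<Longrightarrow> \<kappa> (supp (dec a y)) \<subseteq> \<kappa> (supp a)"
  by (rule mono[OF _ supp_dec])

lemma special_supp:
  assumes "supp a \<in> \<Delta>" "y \<in> supp a" "u \<in> V" "u \<notin> \<kappa> (supp a)"
  shows "t (\<iota> u) y = 0"
proof (rule ccontr)
  assume nz: "t (\<iota> u) y \<noteq> 0"
  have y: "{y} \<in> \<Delta>" using simplicial_complexD[OF \<Delta> assms(1), of "{y}"] assms(2) by blast
  have "\<kappa> {} \<subseteq> \<kappa> (supp a)" "\<kappa> {y} \<subseteq> \<kappa> (supp a)" using mono[OF assms(1)] assms(2) by auto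
  then show False using special[OF _ y nz] assms(3,4) by blast
qed

lemma bdK_eq:
  assumes "kchain M p (dom W) c" "a \<in> dom W"
  shows "bdK W c B a = (\<Sum>i\<in>idx W - B. sg i B * (\<Sum>y\<in>supp a. t i y * c (insert i B) (dec a y)))"
proof -
  have "(\<Sum>y\<in>\<Union>(below W). t i y * c (insert i B) (dec a y)) =
      (\<Sum>y\<in>supp a. t i y * c (insert i B) (dec a y))" for i
  proof (rule sum.mono_neutral_right)
    show "finite (\<Union>(below W))" by (rule simplicial_complex_finite_Union[OF simplicial_complex_below])
    show "supp a \<subseteq> \<Union>(below W)" using assms(2) unfolding cdom_def by auto
    show "\<forall>y\<in>\<Union>(below W) - supp a. t i y * c (insert i B) (dec a y) = 0"
    proof
      fix y assume "y \<in> \<Union>(below W) - supp a"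
      then have "\<not> 0 \<le> dec a y y" by (simp add: dec_def)
      then have "dec a y \<notin> dom W" unfolding dom_iff by blast
      then have "c (insert i B) (dec a y) = 0" using assms(1) unfolding kchain_def by blast
      then show "t i y * c (insert i B) (dec a y) = 0" by simp
    qed
  qed
  then show ?thesis using assms(2) by (simp add: bdK_def kz_def mulop_def)
qed

lemma kchain_bdK: "kchain (idx W) (Suc p) (dom W) c \<Longrightarrow> kchain (idx W) p (dom W) (bdK W c)"
  unfolding bdK_def by (rule kchain_kz[OF _ finite_idx])

text \<open>Removing \<open>\<iota> s\<close> from \<open>B\<close> imposes a new condition on
  \<open>s\<close>. It holds because multiplication by the parameter of \<open>s\<close> brings in a
  vertex whose carrier contains \<open>s\<close>.\<close>

lemma relaxed_bdK:
  assumes "relaxed W S (Suc p) c" "S \<subseteq> V"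
  shows "relaxed W S p (bdK W c)"
proof -
  have c: "kchain (idx W) (Suc p) (dom W) c" using assms(1) by (simp add: relaxed_def)
  have "s \<in> \<kappa> (supp a)" if nz: "bdK W c B a \<noteq> 0" and s: "s \<in> S" "\<iota> s \<notin> B" for B a s
  proof (rule ccontr)
    assume ns: "s \<notin> \<kappa> (supp a)"
    have a: "a \<in> dom W" using kchain_bdK[OF c] nz unfolding kchain_def by blast
    then have \<Delta>a: "supp a \<in> \<Delta>" by (simp add: dom_iff)
    have "t i y * c (insert i B) (dec a y) = 0" if "y \<in> supp a" for i y
    proof (cases "i = \<iota> s")
      case True
      then show ?thesis using special_supp[OF \<Delta>a that _ ns] s assms(2) by auto
    next
      case False
      have "s \<notin> \<kappa> (supp (dec a y))" using supp_carrier[OF \<Delta>a that] ns by blast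
      then have "c (insert i B) (dec a y) = 0"
        using assms(1) s False unfolding relaxed_def by (metis insert_iff)
      then show ?thesis by simp
    qed
    then have "(\<Sum>y\<in>supp a. t i y * c (insert i B) (dec a y)) = 0" for i
      by (intro sum.neutral) blast
    then have "bdK W c B a = 0" unfolding bdK_eq[OF c a] by simp
    then show False using nz by simp
  qed
  then show ?thesis using kchain_bdK[OF c] unfolding relaxed_def by blast
qed

text \<open>The dropped parameters have zero coefficients on the faces of \<open>below W\<close>, so
  the remaining ones still separate the vertices of each face.\<close>

lemma bdK_exact:
  assumes W: "\<kappa> {} \<subseteq> W" "W \<subseteq> V" and p: "0 < p" and c: "kchain (idx W) p (dom W) c"
    and cyc: "bdK W c = (\<lambda>B a. 0)"
  shows "\<exists>b. kchain (idx W) (Suc p) (dom W) b \<and> c = bdK W b"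
  unfolding bdK_def
proof (rule koszul_exact[OF simplicial_complex_below finite_idx _ _ p c cyc[unfolded bdK_def]])
  fix G i assume G: "G \<in> below W" and i: "i + 1 < int (card (idx W)) - int (card G)"
  show "hom_zero TYPE('k) (lk (below W) G) i"
    unfolding below_def by (rule link) (use G i W in \<open>auto simp: below_def idx_def\<close>)
next
  fix G w assume G: "G \<in> below W" and w: "w \<in> G"
  then have G\<Delta>: "G \<in> \<Delta>" and GW: "\<kappa> G \<subseteq> W" by (auto simp: below_def)
  from span[OF G\<Delta> w] obtain \<alpha> where \<alpha>: "\<forall>y\<in>G. (\<Sum>i\<in>N. \<alpha> i * t i y) = (if y = w then 1 else 0)" ..
  have "(\<Sum>i\<in>idx W. \<alpha> i * t i y) = (\<Sum>i\<in>N. \<alpha> i * t i y)" if y: "y \<in> G" for y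
  proof (rule sum.mono_neutral_left[OF N])
    show "idx W \<subseteq> N" by (auto simp: idx_def)
    show "\<forall>i\<in>N - idx W. \<alpha> i * t i y = 0"
    proof
      fix i assume "i \<in> N - idx W"
      then obtain u where u: "u \<in> V - W" "i = \<iota> u" by (auto simp: idx_def)
      have y\<Delta>: "{y} \<in> \<Delta>" using simplicial_complexD[OF \<Delta> G\<Delta>, of "{y}"] y by blast
      have "\<kappa> {y} \<subseteq> W" using mono[OF G\<Delta>, of "{y}"] y GW by blast
      then have "t i y = 0" using special[OF _ y\<Delta>, of u] u W(1) by blast
      then show "\<alpha> i * t i y = 0" by simp
    qed
  qed
  then have "\<forall>y\<in>G. (\<Sum>i\<in>idx W. \<alpha> i * t i y) = (if y = w then 1 else 0)" using \<alpha> by simp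
  then show "\<exists>\<alpha>. \<forall>y\<in>G. (\<Sum>i\<in>idx W. \<alpha> i * t i y) = (if y = w then 1 else 0)"
    by (intro exI[of _ \<alpha>])
qed

text \<open>To gain the condition for \<open>u\<close>, consider the part \<open>bb\<close> of a
  preimage that violates it. It lives on the faces whose carrier misses \<open>u\<close>, where the
  parameter of \<open>u\<close> vanishes. Since \<open>r\<close> has no violating part,
  \<open>bb\<close> is a cycle of that smaller Koszul complex, so it is a boundary there, and
  subtracting the corresponding boundary in the large complex removes it.\<close>

lemma relaxed_boundary:
  assumes "finite S" "\<kappa> {} \<subseteq> W" "W \<subseteq> V" "S \<subseteq> W - \<kappa> {}" "relaxed W S p r"
    and "kchain (idx W) (Suc p) (dom W) b" "r = bdK W b"
  shows "\<exists>b'. relaxed W S (Suc p) b' \<and> r = bdK W b'"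
  using assms
proof (induction S arbitrary: W p r b)
  case empty
  then show ?case by (intro exI[of _ b]) (simp add: relaxed_def)
next
  case (insert u S)
  have uW: "u \<in> W" "u \<notin> \<kappa> {}" and SW: "S \<subseteq> W - \<kappa> {}" using insert.prems by auto
  have "relaxed W S p r" using insert.prems(4) by (simp add: relaxed_def)
  from insert.IH[OF insert.prems(1,2) SW this insert.prems(5,6)] obtain b1
    where b1: "relaxed W S (Suc p) b1" "r = bdK W b1" by blast
  have b1k: "kchain (idx W) (Suc p) (dom W) b1" using b1(1) by (simp add: relaxed_def)
  define W' where "W' = W - {u}"
  have W': "\<kappa> {} \<subseteq> W'" "W' \<subseteq> V" "S \<subseteq> W' - \<kappa> {}"
    using insert.prems insert.hyps uW by (auto simp: W'_def)
  have idx': "idx W' = idx W - {\<iota> u}"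
    using uW insert.prems(2) by (auto simp: idx_def W'_def)
  have dom': "a \<in> dom W' \<longleftrightarrow> a \<in> dom W \<and> u \<notin> \<kappa> (supp a)" for a
    by (auto simp: dom_iff W'_def)
  have special_u: "t (\<iota> u) y = 0" if "a \<in> dom W'" "y \<in> supp a" for a y
    using special_supp[OF _ that(2), of u] that(1) uW(1) insert.prems(2) by (auto simp: dom_iff W'_def)
  define bb where "bb B a = (if \<iota> u \<notin> B \<and> u \<notin> \<kappa> (supp a) then b1 B a else 0)" for B a
  have bb: "relaxed W' S (Suc p) bb"
    using b1(1) unfolding relaxed_def kchain_def bb_def idx' dom' by (auto split: if_splits)
  then have bbk: "kchain (idx W') (Suc p) (dom W') bb" by (simp add: relaxed_def)
  have "bdK W' bb B a = 0" for B a
  proof (cases "a \<in> dom W' \<and> \<iota> u \<notin> B")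
    case False
    show ?thesis
    proof (cases "a \<in> dom W'")
      case True
      then have "bb (insert i B) x = 0" for i x using False by (simp add: bb_def)
      then show ?thesis unfolding bdK_eq[OF bbk True] by simp
    next
      case False
      then show ?thesis using kchain_bdK[OF bbk] unfolding kchain_def by blast
    qed
  next
    case True
    then have a: "a \<in> dom W'" and aW: "a \<in> dom W" and nu: "u \<notin> \<kappa> (supp a)" and uB: "\<iota> u \<notin> B"
      using dom' by auto
    have \<Delta>a: "supp a \<in> \<Delta>" using a by (simp add: dom_iff)
    have "bb (insert i B) (dec a y) = b1 (insert i B) (dec a y)" if "i \<in> idx W' - B" "y \<in> supp a" for i y
      using supp_carrier[OF \<Delta>a that(2)] that(1) nu uB by (auto simp: bb_def idx')
    then have "(\<Sum>y\<in>supp a. t i y * bb (insert i B) (dec a y)) =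
        (\<Sum>y\<in>supp a. t i y * b1 (insert i B) (dec a y))" if "i \<in> idx W' - B" for i
      using that by (intro sum.cong refl) simp
    then have "bdK W' bb B a =
        (\<Sum>i\<in>idx W' - B. sg i B * (\<Sum>y\<in>supp a. t i y * b1 (insert i B) (dec a y)))"
      unfolding bdK_eq[OF bbk a] by simp
    \<comment> \<open>The extra index \<open>\<iota> u\<close> contributes nothing, because its
      parameter vanishes on the support of \<open>a\<close>.\<close>
    also have "\<dots> = (\<Sum>i\<in>idx W - B. sg i B * (\<Sum>y\<in>supp a. t i y * b1 (insert i B) (dec a y)))"
      using finite_idx special_u[OF a] by (intro sum.mono_neutral_left) (auto simp: idx')
    also have "\<dots> = r B a" unfolding b1(2) bdK_eq[OF b1k aW] ..
    also have "\<dots> = 0"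
      using insert.prems(4) nu uB unfolding relaxed_def by blast
    finally show ?thesis .
  qed
  then have "bdK W' bb = (\<lambda>B a. 0)" by (simp add: fun_eq_iff)
  from bdK_exact[OF W'(1,2) _ bbk this] obtain c0
    where "kchain (idx W') (Suc (Suc p)) (dom W') c0" "bb = bdK W' c0" by blast
  \<comment> \<open>The induction hypothesis for the smaller \<open>W'\<close> makes
    \<open>c\<close> satisfy the conditions in \<open>S\<close>, so that subtracting its boundary
    keeps those already won.\<close>
  from insert.IH[OF W' bb this] obtain c
    where c: "relaxed W' S (Suc (Suc p)) c" "bb = bdK W' c" by blast
  have ck': "kchain (idx W') (Suc (Suc p)) (dom W') c" using c(1) by (simp add: relaxed_def)
  have cW: "relaxed W S (Suc (Suc p)) c"
    using c(1) unfolding relaxed_def kchain_def idx' dom' by blast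
  then have ck: "kchain (idx W) (Suc (Suc p)) (dom W) c" by (simp add: relaxed_def)
  have dc: "relaxed W S (Suc p) (bdK W c)"
    by (rule relaxed_bdK[OF cW]) (use SW insert.prems(2) in auto)
  define b' where "b' = (\<lambda>B a. b1 B a - bdK W c B a)"
  have "kchain (idx W) (Suc p) (dom W) b'"
    unfolding b'_def using b1k dc by (intro kchain_diff) (simp_all add: relaxed_def)
  moreover have "s \<in> \<kappa> (supp a)" if nz: "b' B a \<noteq> 0" and s: "s \<in> insert u S" "\<iota> s \<notin> B" for B a s
  proof (cases "s = u")
    case False
    then have "s \<in> S" using s by blast
    moreover have "b1 B a \<noteq> 0 \<or> bdK W c B a \<noteq> 0" using nz by (auto simp: b'_def)
    ultimately show ?thesis using b1(1) dc s(2) unfolding relaxed_def by blast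
  next
    case True
    show ?thesis
    proof (rule ccontr)
      assume "s \<notin> \<kappa> (supp a)"
      then have nu: "u \<notin> \<kappa> (supp a)" "\<iota> u \<notin> B" using True s by auto
      have aW: "a \<in> dom W" using \<open>kchain (idx W) (Suc p) (dom W) b'\<close> nz unfolding kchain_def by blast
      then have a: "a \<in> dom W'" using dom' nu by blast
      have "c (insert (\<iota> u) B) x = 0" for x
        using ck' unfolding kchain_def idx' by blast
      \<comment> \<open>\<open>c\<close> has no component containing \<open>\<iota> u\<close>, so at
        this monomial its boundaries in the two complexes agree.\<close>
      then have "bdK W c B a = bdK W' c B a"
        unfolding bdK_eq[OF ck aW] bdK_eq[OF ck' a] using finite_idx
        by (intro sum.mono_neutral_right) (auto simp: idx')
      also have "\<dots> = bb B a" by (simp only: c(2))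
      also have "\<dots> = b1 B a" using nu by (simp add: bb_def)
      finally show False using nz by (simp add: b'_def)
    qed
  qed
  ultimately have "relaxed W (insert u S) (Suc p) b'" unfolding relaxed_def by blast
  moreover have "bdK W b' = r"
    using kz_kz[OF finite_idx dec_convex_cdom[OF simplicial_complex_below] ck]
    by (simp add: b1(2) b'_def bdK_def kz_diff fun_eq_iff)
  ultimately show ?case by blast
qed

end

section \<open>Disjoint interior sets\<close>

text \<open>A matrix of full column rank has a nonzero maximal minor, hence a nonzero term in its
  expansion. Here the term is found by elimination: the combination \<open>x\<close> sees only
  column \<open>c0\<close>, so subtracting multiples of it removes row \<open>r0\<close> from other
  combinations without changing their values on the other columns.\<close>

lemma spanning_rows_injection:
  fixes M :: "'r \<Rightarrow> 'c \<Rightarrow> 'k::field"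
  assumes "finite C" "finite R"
    and "\<And>c0. c0 \<in> C \<Longrightarrow> \<exists>x. \<forall>c\<in>C. (\<Sum>r\<in>R. x r * M r c) = (if c = c0 then 1 else 0)"
  shows "\<exists>f. inj_on f C \<and> f ` C \<subseteq> R \<and> (\<forall>c\<in>C. M (f c) c \<noteq> 0)"
  using assms
proof (induction C arbitrary: R)
  case (insert c0 C)
  obtain x where x: "\<forall>c\<in>insert c0 C. (\<Sum>r\<in>R. x r * M r c) = (if c = c0 then 1 else 0)"
    using insert.prems(2)[of c0] by auto
  then have "(\<Sum>r\<in>R. x r * M r c0) \<noteq> 0" by simp
  then obtain r0 where r0: "r0 \<in> R" "x r0 * M r0 c0 \<noteq> 0" by (meson sum.neutral)
  have "\<exists>z. \<forall>c\<in>C. (\<Sum>r\<in>R - {r0}. z r * M r c) = (if c = c1 then 1 else 0)" if c1: "c1 \<in> C" for c1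
  proof -
    obtain y where y: "\<forall>c\<in>insert c0 C. (\<Sum>r\<in>R. y r * M r c) = (if c = c1 then 1 else 0)"
      using insert.prems(2)[of c1] c1 by auto
    define z where "z r = y r - y r0 / x r0 * x r" for r
    have "(\<Sum>r\<in>R - {r0}. z r * M r c) = (if c = c1 then 1 else 0)" if "c \<in> C" for c
    proof -
      have "z r0 = 0" using r0 by (simp add: z_def)
      then have "(\<Sum>r\<in>R - {r0}. z r * M r c) = (\<Sum>r\<in>R. z r * M r c)"
        using insert.prems(1) r0 by (simp add: sum.remove)
      also have "\<dots> = (\<Sum>r\<in>R. y r * M r c) - y r0 / x r0 * (\<Sum>r\<in>R. x r * M r c)"
        by (simp add: z_def left_diff_distrib sum_subtractf sum_distrib_left mult.assoc)
      also have "\<dots> = (if c = c1 then 1 else 0)" using x y that insert.hyps(2) by auto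
      finally show ?thesis .
    qed
    then show ?thesis by (intro exI[of _ z]) blast
  qed
  then obtain f where f: "inj_on f C" "f ` C \<subseteq> R - {r0}" "\<forall>c\<in>C. M (f c) c \<noteq> 0"
    using insert.IH[of "R - {r0}"] insert.prems(1) by auto
  have "inj_on (f(c0 := r0)) (insert c0 C)"
    using f(1,2) insert.hyps(2) by (auto simp: inj_on_def)
  moreover have "(f(c0 := r0)) ` insert c0 C \<subseteq> R" using f(2) r0 by auto
  moreover have "\<forall>c\<in>insert c0 C. M ((f(c0 := r0)) c) c \<noteq> 0" using f(3) r0 by auto
  ultimately show ?case by blast
qed simp

section \<open>Combinatorics of minimal interior sets\<close>

definition minimal_in :: "'a set \<Rightarrow> ('a set \<Rightarrow> bool) \<Rightarrow> 'a set \<Rightarrow> bool" where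
  "minimal_in P U G \<longleftrightarrow> G \<subseteq> P \<and> U G \<and> (\<forall>H. H \<subset> G \<longrightarrow> \<not> U H)"

lemma minimal_inD:
  "minimal_in P U G \<Longrightarrow> U G" "minimal_in P U G \<Longrightarrow> G \<subseteq> P"
  "minimal_in P U G \<Longrightarrow> H \<subset> G \<Longrightarrow> \<not> U H" "minimal_in P U G \<Longrightarrow> H \<subseteq> G \<Longrightarrow> U H \<Longrightarrow> H = G"
  by (auto simp: minimal_in_def)

lemma minimal_in_exists:
  assumes "finite P" "G \<subseteq> P" "U G"
  obtains H where "H \<subseteq> G" "minimal_in P U H"
proof -
  have "finite G" using assms finite_subset by blast
  from this assms(2,3) have "\<exists>H\<subseteq>G. minimal_in P U H"
  proof (induction G rule: finite_psubset_induct)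
    case (psubset G)
    show ?case
    proof (cases "minimal_in P U G")
      case False
      then obtain H where "H \<subset> G" "U H" using psubset.prems by (auto simp: minimal_in_def)
      then show ?thesis using psubset.IH[of H] psubset.prems by blast
    qed blast
  qed
  then show ?thesis using that by blast
qed

text \<open>The injection \<open>G \<mapsto> G - {y G}\<close> alone does not exclude a 4-cycle \<open>a b c d\<close> of two-element minimal sets;
  there the matrix it comes from is singular.\<close>

lemma no_disjoint_pair:
  fixes U :: "'a set \<Rightarrow> bool" and UU :: "'b \<Rightarrow> 'a set \<Rightarrow> bool" and T :: "'b \<Rightarrow> 'a \<Rightarrow> bool"
  assumes P: "finite P"
    and UUup: "\<And>u G H. UU u G \<Longrightarrow> G \<subseteq> H \<Longrightarrow> H \<subseteq> P \<Longrightarrow> UU u H"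
    and UU2: "\<And>u v G. UU u G \<Longrightarrow> UU v G \<Longrightarrow> G \<subseteq> P \<Longrightarrow> u \<noteq> v \<Longrightarrow> U G"
    and T: "\<And>u G y. UU u G \<Longrightarrow> G \<subseteq> P \<Longrightarrow> y \<in> P \<Longrightarrow> T u y \<Longrightarrow> U (insert y G)"
    and del: "\<And>G. minimal_in P U G \<Longrightarrow> y G \<in> G \<and> T (u G) (y G) \<and> UU (u G) (G - {y G})"
    and del_inj: "\<And>G H. minimal_in P U G \<Longrightarrow> minimal_in P U H \<Longrightarrow> G - {y G} = H - {y H} \<Longrightarrow> G = H"
    and cycle: "\<And>a b c d v r. minimal_in P U {a, b} \<Longrightarrow> minimal_in P U {a, d} \<Longrightarrow>
      minimal_in P U {c, b} \<Longrightarrow> minimal_in P U {c, d} \<Longrightarrow> a \<noteq> b \<Longrightarrow> a \<noteq> c \<Longrightarrow> a \<noteq> d \<Longrightarrow> b \<noteq> c \<Longrightarrow> b \<noteq> d \<Longrightarrow> c \<noteq> d \<Longrightarrow>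
      UU v {a} \<Longrightarrow> UU v {c} \<Longrightarrow> UU r {b} \<Longrightarrow> UU r {d} \<Longrightarrow> T v b \<Longrightarrow> T v d \<Longrightarrow> T r a \<Longrightarrow> T r c \<Longrightarrow> False"
    and F: "F1 \<subseteq> P" "F2 \<subseteq> P" "F1 \<inter> F2 = {}" "U F1" "U F2" "card F1 \<le> 2"
  shows False
proof -
  \<comment> \<open>Reading: \<open>U\<close> is interior, \<open>UU u G\<close> says that
    \<open>G\<close> misses at most \<open>u\<close>, and \<open>T u y\<close> that \<open>y\<close>
    can supply \<open>u\<close>. Each case forces two distinct minimal sets to have the same
    deletion, except for one that ends in the 4-cycle.\<close>
  obtain M1 where M1: "M1 \<subseteq> F1" "minimal_in P U M1" using minimal_in_exists[where U = U, OF P F(1,4)] .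
  obtain M2 where M2: "M2 \<subseteq> F2" "minimal_in P U M2" using minimal_in_exists[where U = U, OF P F(2,5)] .
  note m1 = minimal_inD[OF M1(2)] and m2 = minimal_inD[OF M2(2)]
  have disj: "M1 \<inter> M2 = {}" using M1 M2 F(3) by blast
  define w' v where "w' = y M1" and "v = u M1"
  have w': "w' \<in> M1" "T v w'" "UU v (M1 - {w'})" using del[OF M1(2)] by (auto simp: w'_def v_def)
  define z q H where "z = y M2" and "q = u M2" and "H = M2 - {z}"
  have z: "z \<in> M2" "T q z" "UU q H" using del[OF M2(2)] by (auto simp: z_def q_def H_def)
  have HP: "H \<subseteq> P" and zP: "z \<in> P" and w'P: "w' \<in> P" using z w' m1(2) m2(2) by (auto simp: H_def)
  have nH: "\<not> U H" using m2(3)[of H] z(1) by (auto simp: H_def)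
  have M2H: "M2 = insert z H" and zH: "z \<notin> H" using z(1) by (auto simp: H_def)
  have delM1: "G = M1" if "minimal_in P U G" "G - {y G} = M1 - {w'}" for G
    using del_inj[OF that(1) M1(2)] that(2) by (simp add: w'_def)
  have delM2: "G = M2" if "minimal_in P U G" "G - {y G} = H" for G
    using del_inj[OF that(1) M2(2)] that(2) by (simp add: z_def H_def)
  have "finite F1" using F(1) P finite_subset by blast
  then have "card M1 \<le> 2" using F(6) card_mono[OF _ M1(1)] by simp
  moreover have "card M1 \<noteq> 0" using w'(1) finite_subset[OF M1(1) \<open>finite F1\<close>] by auto
  ultimately consider "card M1 = 1" | "card M1 = 2" by linarith
  then show False
  proof cases
    case 1
    then have M1': "M1 = {w'}" using w'(1) by (metis card_1_singletonE singletonD)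
    then have v0: "UU v {}" using w'(3) by simp
    then have "UU v H" using UUup[of v "{}" H] HP by simp
    then have "q = v" using UU2[OF z(3) _ HP] nH by blast
    then have "U {z}" using T[OF v0, of z] z(2) zP by simp
    then have "M2 = {z}" using m2(4)[of "{z}"] z(1) by simp
    then have "H = {}" using M2H zH by auto
    moreover have "M1 - {y M1} = {}" unfolding w'_def[symmetric] by (subst M1') simp
    ultimately have "M1 = M2" using delM2[OF M1(2)] by simp
    then show False using disj w'(1) by blast
  next
    case 2
    then obtain w where M1': "M1 = {w, w'}" "w \<noteq> w'"
      using w'(1) by (auto simp: card_2_iff doubleton_eq_iff)
    have wP: "w \<in> P" using m1(2) M1' by blast
    have M1w: "M1 - {w'} = {w}" using M1' by auto
    have vw: "UU v {w}" using w'(3) M1w by simp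
    have w2: "w \<notin> M2" "w' \<notin> M2" using disj M1' by auto
    have nw: "\<not> U {w}" "\<not> U {w'}" "\<not> U {}" using m1(3) M1' by auto
    show False
    proof (cases "q = v")
      case False
      have wH: "insert w H \<subseteq> P" using wP HP by blast
      \<comment> \<open>\<open>H\<close> misses at most \<open>q\<close> and {w} at most
        \<open>v\<close>; as these differ, the union misses nothing.\<close>
      have "U (insert w H)"
        using UU2[OF UUup[OF z(3) _ wH] UUup[OF vw _ wH] wH] False by blast
      then obtain G' where G': "G' \<subseteq> insert w H" "minimal_in P U G'"
        using minimal_in_exists[where U = U, OF P wH] by blast
      note g = minimal_inD[OF G'(2)]
      define x s where "x = y G'" and "s = u G'"
      have x: "x \<in> G'" "T s x" "UU s (G' - {x})" using del[OF G'(2)] by (auto simp: x_def s_def)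
      have wG: "w \<in> G'"
      proof (rule ccontr)
        assume "w \<notin> G'"
        then have "G' \<subset> M2" using G'(1) M2H zH by blast
        then show False using m2(3) g(1) by blast
      qed
      show False
      proof (cases "x = w")
        case True
        let ?G = "G' - {w}"
        have sub: "?G \<subseteq> H" using G'(1) by blast
        have "s = q" using UU2[OF UUup[OF x(3) _ HP] z(3) HP] nH sub True by blast
        then have "U (insert z ?G)" using T[OF x(3) _ zP] z(2) g(2) True by blast
        then have "insert z ?G = insert z H" using m2(4)[of "insert z ?G"] sub M2H by blast
        then have "?G = H" by (subst (asm) insert_ident) (use sub zH in auto)
        then have "G' = M2" using delM2[OF G'(2)] True by (simp flip: x_def)
        then show False using wG w2 by blast
      next
        case False
        have subP: "G' - {x} \<subseteq> P" using g(2) by blast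
        have "\<not> U (G' - {x})" using g(3)[of "G' - {x}"] x(1) by blast
        then have "s = v" using UU2[OF x(3) UUup[OF vw _ subP] subP] False wG by blast
        then have "U {x, w}" using T[OF vw, of x] x g(2) wP by auto
        then have "{x, w} = G'" using g(4)[of "{x, w}"] x(1) wG by blast
        then have "G' - {x} = {w}" using False by auto
        then have "G' = M1" using delM1[OF G'(2)] M1w by (simp flip: x_def)
        then have "x = w'" using x(1) M1' False by blast
        then show False using x(1) G'(1) False w2 M2H by blast
      qed
    next
      case True
      have Tz: "T v z" and vH: "UU v H" using z True by auto
      have nz: "\<not> U {z}"
      proof
        assume "U {z}"
        then have "M2 = {z}" using m2(4)[of "{z}"] z(1) by simp
        then have "H = {}" using M2H zH by auto
        then show False using T[OF vH HP w'P w'(2)] nw(2) by simp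
      qed
      have "U {z, w}" using T[OF vw _ zP Tz] wP by simp
      moreover have "\<not> U K" if "K \<subset> {z, w}" for K
      proof -
        from that have "K = {} \<or> K = {z} \<or> K = {w}" by blast
        then show ?thesis using nz nw by auto
      qed
      ultimately have mwz: "minimal_in P U {z, w}" using wP zP by (simp add: minimal_in_def)
      define r where "r = u {z, w}"
      have zw: "z \<noteq> w" using z(1) w2 by blast
      \<comment> \<open>Deleting \<open>z\<close> would leave {w}, which is already the deletion of
        \<open>M1\<close>.\<close>
      have yzw: "y {z, w} = w"
      proof (rule ccontr)
        assume "y {z, w} \<noteq> w"
        then have "y {z, w} = z" using del[OF mwz] by blast
        then have "{z, w} = M1" using delM1[OF mwz] M1w zw by auto
        then show False using z(1) disj by blast
      qed
      then have Trw: "T r w" and rz: "UU r {z}" using del[OF mwz] zw by (auto simp: r_def insert_Diff_if)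
      have delz: "G = {z, w}" if "minimal_in P U G" "G - {y G} = {z}" for G
        by (rule del_inj[OF that(1) mwz]) (use that(2) yzw zw in auto)
      have rv: "r \<noteq> v" using T[of v "{z}" z] rz Tz zP nz by auto
      have wH: "insert w' H \<subseteq> P" using w'P HP by blast
      have "U (insert w' H)" using T[OF vH HP w'P w'(2)] .
      then obtain G' where G': "G' \<subseteq> insert w' H" "minimal_in P U G'"
        using minimal_in_exists[where U = U, OF P wH] by blast
      note g = minimal_inD[OF G'(2)]
      define x s where "x = y G'" and "s = u G'"
      have x: "x \<in> G'" "T s x" "UU s (G' - {x})" using del[OF G'(2)] by (auto simp: x_def s_def)
      have wG: "w' \<in> G'"
      proof (rule ccontr)
        assume "w' \<notin> G'"
        then have "G' \<subset> M2" using G'(1) M2H zH by blast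
        then show False using m2(3) g(1) by blast
      qed
      show False
      proof (cases "x = w'")
        case True
        let ?G = "G' - {w'}"
        have sub: "?G \<subseteq> H" using G'(1) by blast
        have "s = v" using UU2[OF UUup[OF x(3) _ HP] vH HP] nH sub True by blast
        then have "U (insert z ?G)" using T[OF x(3) _ zP] Tz g(2) True by blast
        then have "insert z ?G = insert z H" using m2(4)[of "insert z ?G"] sub M2H by blast
        then have "?G = H" by (subst (asm) insert_ident) (use sub zH in auto)
        then have "G' = M2" using delM2[OF G'(2)] True by (simp flip: x_def)
        then show False using wG w2 by blast
      next
        case False
        define K where "K = G' - {x}"
        have xH: "x \<in> H" using x(1) G'(1) False by blast
        have xP: "x \<in> P" using xH HP by blast
        have KP: "K \<subseteq> P" using g(2) by (auto simp: K_def)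
        have nK: "\<not> U K" using g(3)[of K] x(1) by (auto simp: K_def)
        have w'K: "w' \<in> K" using wG False by (simp add: K_def)
        have sK: "UU s K" using x(3) by (simp add: K_def)
        have xz: "x \<noteq> z" using xH zH by blast
        \<comment> \<open>\<open>K\<close> already contains \<open>w'\<close>, which supplies
          \<open>v\<close>.\<close>
        have "s \<noteq> v" using T[of v K w'] sK KP w'P w'(2) nK w'K by (auto simp: insert_absorb)
        show False
        proof (cases "s = r")
          case True
          then have "U {x, z}" using T[OF rz _ xP] x(2) zP by auto
          then have M2': "M2 = {x, z}" using m2(4)[of "{x, z}"] xH M2H by blast
          then have H': "H = {x}" using M2H zH xz by auto
          then have G'': "G' = {x, w'}" using G'(1) x(1) wG by blast
          then have K': "K = {w'}" using False by (auto simp: K_def)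
          have ne: "w \<noteq> x" "w' \<noteq> x" "w' \<noteq> z" using w2 M2' by auto
          \<comment> \<open>The 4-cycle has a = w, b = w', c = x, d = z; its edges are
            \<open>M1\<close>, {z, w}, \<open>G'\<close> and \<open>M2\<close>.\<close>
          show False
            by (rule cycle[of w w' z x v r])
              (use M1(2) mwz G'(2) M2(2) M1' M2' G'' ne zw xz vw vH H' sK K' rz True w'(2) Tz Trw x(2)
                in \<open>auto simp: insert_commute\<close>)
        next
          case False
          have zK: "insert z K \<subseteq> P" using KP zP by blast
          \<comment> \<open>Again two sets missing at most different elements: \<open>K\<close> at
            most \<open>s\<close> and {z} at most \<open>r\<close>.\<close>
          have "U (insert z K)"
            using UU2[OF UUup[OF sK _ zK] UUup[OF rz _ zK] zK] False by blast
          then obtain L where L: "L \<subseteq> insert z K" "minimal_in P U L"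
            using minimal_in_exists[where U = U, OF P zK] by blast
          note l = minimal_inD[OF L(2)]
          have zL: "z \<in> L"
          proof (rule ccontr)
            assume "z \<notin> L"
            then have "L \<subset> G'" using L(1) x(1) by (auto simp: K_def)
            then show False using g(3) l(1) by blast
          qed
          have w'L: "w' \<in> L"
          proof (rule ccontr)
            assume "w' \<notin> L"
            then have "L \<subseteq> M2 - {x}" using L(1) G'(1) xz unfolding K_def M2H by blast
            then have "L \<subset> M2" using xH M2H by blast
            then show False using m2(3) l(1) by blast
          qed
          define a b where "a = y L" and "b = u L"
          have a: "a \<in> L" "T b a" "UU b (L - {a})" using del[OF L(2)] by (auto simp: a_def b_def)
          show False
          proof (cases "a = z")
            case True
            have sub: "L - {z} \<subseteq> K" using L(1) by blast
            have "b = s" using UU2[OF UUup[OF a(3) _ KP] sK KP] nK sub True by blast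
            then have "U (insert x (L - {z}))" using T[OF a(3) _ xP] x(2) l(2) True by blast
            then have "insert x (L - {z}) = G'"
              using g(4)[of "insert x (L - {z})"] sub x(1) by (auto simp: K_def)
            moreover have "x \<notin> L - {z}" using sub by (auto simp: K_def)
            ultimately have "L - {z} = K" unfolding K_def by blast
            then have "L = G'" using del_inj[OF L(2) G'(2)] True by (simp add: K_def flip: a_def x_def)
            then show False using zL G'(1) zH w2 z(1) by blast
          next
            case False
            have subP: "L - {a} \<subseteq> P" using l(2) by blast
            have "\<not> U (L - {a})" using l(3)[of "L - {a}"] a(1) by blast
            then have "b = r" using UU2[OF a(3) UUup[OF rz _ subP] subP] False zL by blast
            then have "U {a, z}" using T[OF rz, of a] a l(2) zP by auto
            then have L': "{a, z} = L" using l(4)[of "{a, z}"] a(1) zL by blast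
            then have "a = w'" using w'L w2 z(1) by blast
            moreover have "L - {a} = {z}" using L' False by auto
            then have "L = {z, w}" using delz[OF L(2)] by (simp flip: a_def)
            ultimately have "w' = z \<or> w' = w" using a(1) by blast
            then show False using M1'(2) w2 z(1) by blast
          qed
        qed
      qed
    qed
  qed
qed

section \<open>Relations between interior monomials on one face\<close>

definition ind :: "'a set \<Rightarrow> 'a \<Rightarrow> int" where
  "ind G w = (if w \<in> G then 1 else 0)"

lemma supp_ind [simp]: "supp (ind G) = G"
  by (simp add: ind_def)

lemma dec_ind: "y \<in> G \<Longrightarrow> dec (ind G) y = ind (G - {y})"
  by (auto simp: dec_def ind_def fun_eq_iff)

lemma ind_eq_iff: "ind G = ind H \<longleftrightarrow> G = H"
  by (metis supp_ind)

text \<open>As a linear system in a, b, c, d this has a singular matrix: the multipliers s*r, -q*r,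
  -s*p, q*p cancel all unknowns, and the right-hand sides then give s*r = 0.\<close>

lemma four_cycle_singular:
  fixes a b c d :: "'k::field"
  assumes "p * b + q * a = 1" "p * d + s * a = 0" "r * b + q * c = 0" "r * d + s * c = 0"
  shows "s * r = 0"
proof -
  have "s * r = s * r * (p * b + q * a) - q * r * (p * d + s * a) - s * p * (r * b + q * c)
      + q * p * (r * d + s * c)"
    by (simp only: assms) simp
  also have "\<dots> = 0" by (simp add: algebra_simps)
  finally show ?thesis .
qed

context carrier_complex
begin

lemma idx_V: "idx V = N"
  by (simp add: idx_def)

text \<open>Coefficientwise form of the statement that x^G is the sum of the theta_i g_i in the face
  ring.\<close>

definition lin_rel :: "'a set \<Rightarrow> ('i \<Rightarrow> ('a \<Rightarrow> int) \<Rightarrow> 'k) \<Rightarrow> bool" where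
  "lin_rel G g \<longleftrightarrow> (\<forall>i a. g i a \<noteq> 0 \<longrightarrow> i \<in> N \<and> a \<in> dom V) \<and>
     (\<forall>a\<in>dom V. (\<Sum>i\<in>N. \<Sum>y\<in>supp a. t i y * g i (dec a y)) = (if a = ind G then 1 else 0))"

text \<open>The relation is a Koszul 1-chain with boundary x^G, and x^G is relaxed because
  \<open>G\<close> is interior; \<open>relaxed_boundary\<close> in degree 0 applies. In the result a
  monomial of \<open>g i\<close> misses at most the element whose parameter is
  \<open>i\<close>.\<close>

lemma refined_relation:
  assumes V: "finite V" and G: "G \<in> \<Delta>" "\<kappa> G = V" and g0: "lin_rel G g0"
  shows "\<exists>g. lin_rel G g \<and> (\<forall>i a s. g i a \<noteq> 0 \<longrightarrow> s \<in> V - \<kappa> {} \<longrightarrow> \<iota> s \<noteq> i \<longrightarrow> s \<in> \<kappa> (supp a))"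
proof -
  define b0 where "b0 B a = (if \<exists>i\<in>N. B = {i} then g0 (the_elem B) a else 0)" for B a
  have b0: "kchain (idx V) (Suc 0) (dom V) b0"
    unfolding kchain_def idx_V
  proof (intro allI impI)
    fix B a assume nz: "b0 B a \<noteq> 0"
    then obtain i where "i \<in> N" "B = {i}" "g0 i a \<noteq> 0" by (auto simp: b0_def split: if_splits)
    then show "B \<subseteq> N \<and> card B = Suc 0 \<and> a \<in> dom V" using g0 by (simp add: lin_rel_def)
  qed
  define r where "r B a = (if B = {} \<and> a = ind G then 1 else 0 :: 'k)" for B :: "'i set" and a
  have bd_empty: "bdK V b {} a = (\<Sum>i\<in>N. \<Sum>y\<in>supp a. t i y * b {i} (dec a y))"
    if "kchain (idx V) (Suc 0) (dom V) b" "a \<in> dom V" for b a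
    unfolding bdK_eq[OF that] idx_V by (simp add: sg_def)
  have indG: "ind G \<in> dom V" using G by (simp add: dom_iff) (simp add: ind_def)
  have "r = bdK V b0"
  proof (intro ext)
    fix B a
    show "r B a = bdK V b0 B a"
    proof (cases "B = {} \<and> a \<in> dom V")
      case True
      have "(\<Sum>i\<in>N. \<Sum>y\<in>supp a. t i y * b0 {i} (dec a y)) =
          (\<Sum>i\<in>N. \<Sum>y\<in>supp a. t i y * g0 i (dec a y))"
        by (intro sum.cong refl) (simp add: b0_def)
      then show ?thesis
        using True g0 bd_empty[OF b0, of a] by (simp add: r_def lin_rel_def)
    next
      case False
      then have "r B a = 0" using indG by (auto simp: r_def)
      moreover have "bdK V b0 B a = 0"
        using kchain_bdK[OF b0] False finite_idx[of V] finite_subset[of B "idx V"]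
        unfolding kchain_def by (metis card_0_eq)
      ultimately show ?thesis by simp
    qed
  qed
  moreover have "relaxed V (V - \<kappa> {}) 0 r"
    using G indG unfolding relaxed_def kchain_def by (auto simp: r_def split: if_splits)
  moreover have "\<kappa> {} \<subseteq> V" using mono[OF G(1)] G(2) by blast
  ultimately obtain b where b: "relaxed V (V - \<kappa> {}) (Suc 0) b" "r = bdK V b"
    using relaxed_boundary[OF _ _ subset_refl subset_refl _ b0] V by auto
  define g where "g i a = b {i} a" for i a
  have bk: "kchain (idx V) (Suc 0) (dom V) b" using b(1) by (simp add: relaxed_def)
  have "lin_rel G g"
    unfolding lin_rel_def
  proof (intro conjI allI impI ballI)
    fix i a assume "g i a \<noteq> 0"
    then have "{i} \<subseteq> N \<and> card {i} = Suc 0 \<and> a \<in> dom V"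
      using bk unfolding kchain_def idx_V g_def by blast
    then show "i \<in> N" "a \<in> dom V" by auto
  next
    fix a assume a: "a \<in> dom V"
    have "bdK V b {} a = (if a = ind G then 1 else 0)" unfolding b(2)[symmetric] by (simp add: r_def)
    then show "(\<Sum>i\<in>N. \<Sum>y\<in>supp a. t i y * g i (dec a y)) = (if a = ind G then 1 else 0)"
      unfolding bd_empty[OF bk a] g_def .
  qed
  moreover have "s \<in> \<kappa> (supp a)" if "g i a \<noteq> 0" "s \<in> V - \<kappa> {}" "\<iota> s \<noteq> i" for i a s
    using b(1) that unfolding relaxed_def g_def by blast
  ultimately show ?thesis by blast
qed

lemma no_interior_partition:
  assumes V: "finite V" and F: "F \<in> \<Delta>" "A \<subseteq> F"
    and apex: "\<And>w. w \<in> A \<Longrightarrow> \<exists>u\<in>V. \<exists>u'\<in>V. u \<noteq> u' \<and> u \<notin> \<kappa> (F - {w}) \<and> u' \<notin> \<kappa> (F - {w})"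
    and F12: "F1 \<subseteq> F - A" "F2 \<subseteq> F - A" "F1 \<inter> F2 = {}" "\<kappa> (F1 \<union> A) = V" "\<kappa> (F2 \<union> A) = V" "card F1 \<le> 2"
    and rel: "\<And>G. G \<in> \<Delta> \<Longrightarrow> \<kappa> G = V \<Longrightarrow> \<exists>g. lin_rel G g"
  shows False
proof -
  define P where "P = F - A"
  define V' where "V' = V - \<kappa> {}"
  define U where "U G \<longleftrightarrow> \<kappa> (G \<union> A) = V" for G
  define UU where "UU u G \<longleftrightarrow> u \<in> V' \<and> V - {u} \<subseteq> \<kappa> (G \<union> A)" for u G
  define T where "T u y \<longleftrightarrow> u \<in> V' \<and> t (\<iota> u) y \<noteq> 0" for u y
  let ?min = "minimal_in P U"
  have finF: "finite F" using F simplicial_complex_finite[OF \<Delta>] by blast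
  then have finP: "finite P" by (simp add: P_def)
  have finV': "finite V'" using V by (simp add: V'_def)
  have face: "G \<union> A \<in> \<Delta>" if "G \<subseteq> P" for G
    using simplicial_complexD[OF \<Delta> F(1), of "G \<union> A"] that F(2) by (auto simp: P_def)
  have \<kappa>mono: "\<kappa> (G \<union> A) \<subseteq> \<kappa> (H \<union> A)" if "G \<subseteq> H" "H \<subseteq> P" for G H
    using mono[OF face[OF that(2)], of "G \<union> A"] that by blast
  have \<kappa>0: "\<kappa> {} \<subseteq> \<kappa> (G \<union> A)" if "G \<subseteq> P" for G using mono[OF face[OF that]] by blast
  have UUup: "UU u H" if "UU u G" "G \<subseteq> H" "H \<subseteq> P" for u G H
    using that \<kappa>mono[of G H] by (auto simp: UU_def)
  have UU2: "U G" if "UU u G" "UU v G" "G \<subseteq> P" "u \<noteq> v" for u v G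
    using that \<kappa>V[OF face[OF that(3)]] unfolding UU_def U_def by blast
  have TU: "U (insert y G)" if "UU u G" "G \<subseteq> P" "y \<in> P" "T u y" for u G y
  proof -
    have sub: "insert y G \<subseteq> P" using that by blast
    have "{y} \<in> \<Delta>" using simplicial_complexD[OF \<Delta> F(1), of "{y}"] that(3) by (auto simp: P_def)
    then have "u \<in> \<kappa> {y}" using special[of u y] that(4) by (simp add: T_def V'_def)
    then have "u \<in> \<kappa> (insert y G \<union> A)" using mono[OF face[OF sub], of "{y}"] by blast
    moreover have "V - {u} \<subseteq> \<kappa> (insert y G \<union> A)"
      using that(1) \<kappa>mono[of G "insert y G"] sub by (auto simp: UU_def)
    ultimately show ?thesis using \<kappa>V[OF face[OF sub]] unfolding U_def by blast
  qed
  \<comment> \<open>\<open>x u H\<close> will be the coefficient of the monomial of H and A in the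
    factor of the parameter of \<open>u\<close>. The equation for \<open>G\<close> compares
    coefficients at the monomial of G and A.\<close>
  have coef: "\<exists>x. (\<forall>u H. x u H \<noteq> 0 \<longrightarrow> H \<subseteq> P \<longrightarrow> u \<in> V' \<longrightarrow> UU u H) \<and>
      (\<forall>G. ?min G \<longrightarrow> (\<Sum>y\<in>G. \<Sum>u\<in>V'. t (\<iota> u) y * x u (G - {y})) = (if G = G0 then 1 else 0))"
    if G0: "?min G0" for G0
  proof -
    have "G0 \<subseteq> P" "\<kappa> (G0 \<union> A) = V" using minimal_inD(1,2)[OF G0] by (auto simp: U_def)
    then obtain g where g: "lin_rel (G0 \<union> A) g"
      and gs: "\<forall>i a s. g i a \<noteq> 0 \<longrightarrow> s \<in> V - \<kappa> {} \<longrightarrow> \<iota> s \<noteq> i \<longrightarrow> s \<in> \<kappa> (supp a)"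
      using refined_relation[OF V face] rel[OF face] by metis
    define x where "x u H = g (\<iota> u) (ind (H \<union> A))" for u H
    have "UU u H" if "x u H \<noteq> 0" "H \<subseteq> P" "u \<in> V'" for u H
    proof -
      have "s \<in> \<kappa> (H \<union> A)" if s: "s \<in> V" "s \<noteq> u" for s
      proof (cases "s \<in> \<kappa> {}")
        case True
        then show ?thesis using \<kappa>0[OF \<open>H \<subseteq> P\<close>] by blast
      next
        case False
        then have "\<iota> s \<noteq> \<iota> u" using inj s \<open>u \<in> V'\<close> by (auto simp: inj_on_def V'_def)
        then show ?thesis using gs[rule_format, of "\<iota> u" "ind (H \<union> A)" s] \<open>x u H \<noteq> 0\<close> s(1) False
          by (simp add: x_def)
      qed
      then show ?thesis using \<open>u \<in> V'\<close> by (auto simp: UU_def)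
    qed
    moreover have "(\<Sum>y\<in>G. \<Sum>u\<in>V'. t (\<iota> u) y * x u (G - {y})) = (if G = G0 then 1 else 0)"
      if G: "?min G" for G
    proof -
      have GP: "G \<subseteq> P" using minimal_inD(2)[OF G] .
      have finG: "finite G" using GP finP finite_subset by blast
      have finA: "finite A" using F(2) finF finite_subset by blast
      have GA: "G \<inter> A = {}" "G0 \<inter> A = {}" using GP \<open>G0 \<subseteq> P\<close> by (auto simp: P_def)
      have indGA: "ind (G \<union> A) \<in> dom V"
        using face[OF GP] \<kappa>V by (simp add: dom_iff) (simp add: ind_def)
      have "\<forall>a\<in>dom V. (\<Sum>i\<in>N. \<Sum>y\<in>supp a. t i y * g i (dec a y)) = (if a = ind (G0 \<union> A) then 1 else 0)"
        using g unfolding lin_rel_def by (rule conjunct2)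
      from bspec[OF this indGA]
      have "(\<Sum>i\<in>N. \<Sum>y\<in>G \<union> A. t i y * g i (dec (ind (G \<union> A)) y)) =
          (if ind (G \<union> A) = ind (G0 \<union> A) then 1 else 0)"
        unfolding supp_ind .
      moreover have "G \<union> A = G0 \<union> A \<longleftrightarrow> G = G0" using GA by blast
      ultimately have "(if G = G0 then 1 else 0) =
          (\<Sum>i\<in>N. \<Sum>y\<in>G \<union> A. t i y * g i (ind (G \<union> A - {y})))"
        by (simp add: ind_eq_iff dec_ind)
      also have "\<dots> = (\<Sum>y\<in>G \<union> A. \<Sum>i\<in>N. t i y * g i (ind (G \<union> A - {y})))"
        by (rule sum.swap)
      also have "\<dots> = (\<Sum>y\<in>G. \<Sum>i\<in>N. t i y * g i (ind (G \<union> A - {y})))"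
      proof (rule sum.mono_neutral_right)
        show "\<forall>y\<in>G \<union> A - G. (\<Sum>i\<in>N. t i y * g i (ind (G \<union> A - {y}))) = 0"
        proof
          \<comment> \<open>Deleting an apex loses two elements \<open>u\<close> and
            \<open>u'\<close>. A nonzero coefficient would make \<open>i\<close> the parameter of
            both.\<close>
          fix y assume y: "y \<in> G \<union> A - G"
          then obtain u u' where u: "u \<in> V" "u' \<in> V" "u \<noteq> u'" "u \<notin> \<kappa> (F - {y})" "u' \<notin> \<kappa> (F - {y})"
            using apex by blast
          have Fy: "F - {y} \<in> \<Delta>" using simplicial_complexD[OF \<Delta> F(1)] by blast
          have sub: "\<kappa> (G \<union> A - {y}) \<subseteq> \<kappa> (F - {y})" "\<kappa> {} \<subseteq> \<kappa> (F - {y})"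
            using mono[OF Fy, of "G \<union> A - {y}"] mono[OF Fy, of "{}"] GP F(2) by (auto simp: P_def)
          have "g i (ind (G \<union> A - {y})) = 0" for i
          proof (rule ccontr)
            assume "g i (ind (G \<union> A - {y})) \<noteq> 0"
            then have "s \<in> V - \<kappa> {} \<Longrightarrow> s \<notin> \<kappa> (G \<union> A - {y}) \<Longrightarrow> \<iota> s = i" for s
              using gs[rule_format, of i "ind (G \<union> A - {y})" s] unfolding supp_ind by blast
            then have "\<iota> u = i" "\<iota> u' = i" using u sub by blast+
            then show False using inj u sub(2) by (auto simp: inj_on_def)
          qed
          then show "(\<Sum>i\<in>N. t i y * g i (ind (G \<union> A - {y}))) = 0" by simp
        qed
      qed (use finG finA in auto)
      also have "\<dots> = (\<Sum>y\<in>G. \<Sum>u\<in>V'. t (\<iota> u) y * x u (G - {y}))"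
      proof (intro sum.cong refl)
        fix y assume y: "y \<in> G"
        have eq: "G \<union> A - {y} = G - {y} \<union> A" using y GA by blast
        have sub: "G - {y} \<subseteq> P" using GP by blast
        \<comment> \<open>By minimality some \<open>s\<close> is missed, so only the parameter of
          \<open>s\<close> can contribute; this reduces the sum to the special parameters.\<close>
        have "\<not> U (G - {y})" using minimal_inD(3)[OF G, of "G - {y}"] y by blast
        then obtain s where s: "s \<in> V" "s \<notin> \<kappa> (G - {y} \<union> A)"
          using \<kappa>V[OF face[OF sub]] unfolding U_def by blast
        then have sV': "s \<in> V'" using \<kappa>0[OF sub] by (auto simp: V'_def)
        have z: "g i (ind (G - {y} \<union> A)) = 0" if "i \<notin> \<iota> ` V'" for i
        proof (rule ccontr)
          assume "g i (ind (G - {y} \<union> A)) \<noteq> 0"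
          then have "\<iota> s = i"
            using gs[rule_format, of i "ind (G - {y} \<union> A)" s] sV' s(2) unfolding supp_ind V'_def by blast
          then show False using that sV' by blast
        qed
        have z': "g i (ind (G - {y} \<union> A)) = 0" if "i \<notin> N" for i
          using g that unfolding lin_rel_def by blast
        have "(\<Sum>i\<in>N. t i y * g i (ind (G - {y} \<union> A))) =
            (\<Sum>i\<in>N \<inter> \<iota> ` V'. t i y * g i (ind (G - {y} \<union> A)))"
          using N z by (intro sum.mono_neutral_right) auto
        also have "\<dots> = (\<Sum>i\<in>\<iota> ` V'. t i y * g i (ind (G - {y} \<union> A)))"
          using finV' z' by (intro sum.mono_neutral_left) auto
        also have "\<dots> = (\<Sum>u\<in>V'. t (\<iota> u) y * g (\<iota> u) (ind (G - {y} \<union> A)))"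
          using inj by (subst sum.reindex) (auto simp: V'_def)
        finally show "(\<Sum>i\<in>N. t i y * g i (ind (G \<union> A - {y}))) = (\<Sum>u\<in>V'. t (\<iota> u) y * x u (G - {y}))"
          by (simp add: eq x_def)
      qed
      finally show ?thesis by simp
    qed
    ultimately show ?thesis by (intro exI[of _ x] conjI allI impI)
  qed
  define R where "R = {(u, H). u \<in> V' \<and> H \<subseteq> P \<and> UU u H}"
  define C where "C = {G. ?min G}"
  \<comment> \<open>At most one summand is nonzero, since distinct vertices \<open>y\<close> of
    \<open>G\<close> give distinct sets G - {y}.\<close>
  define M where "M r G = (\<Sum>y\<in>G. if snd r = G - {y} then t (\<iota> (fst r)) y else 0)" for r G
  have finC: "finite C"
    using finP by (auto simp: C_def minimal_in_def intro: finite_subset[of _ "Pow P"])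
  have finR: "finite R"
    by (rule finite_subset[of _ "V' \<times> Pow P"]) (use finP finV' in \<open>auto simp: R_def\<close>)
  have "\<exists>x. \<forall>G\<in>C. (\<Sum>r\<in>R. x r * M r G) = (if G = G0 then 1 else 0)" if G0: "G0 \<in> C" for G0
  proof -
    obtain x where x: "\<forall>u H. x u H \<noteq> 0 \<longrightarrow> H \<subseteq> P \<longrightarrow> u \<in> V' \<longrightarrow> UU u H"
      "\<forall>G. ?min G \<longrightarrow> (\<Sum>y\<in>G. \<Sum>u\<in>V'. t (\<iota> u) y * x u (G - {y})) = (if G = G0 then 1 else 0)"
      using coef[of G0] G0 by (auto simp: C_def)
    have "(\<Sum>r\<in>R. (case r of (u, H) \<Rightarrow> x u H) * M r G) = (if G = G0 then 1 else 0)" if G: "G \<in> C" for G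
    proof -
      have GP: "G \<subseteq> P" using G minimal_inD(2) by (auto simp: C_def)
      have "(\<Sum>r\<in>R. (case r of (u, H) \<Rightarrow> x u H) * M r G) =
          (\<Sum>y\<in>G. \<Sum>r\<in>R. (case r of (u, H) \<Rightarrow> x u H) * (if snd r = G - {y} then t (\<iota> (fst r)) y else 0))"
        unfolding M_def sum_distrib_left by (rule sum.swap)
      also have "\<dots> = (\<Sum>y\<in>G. \<Sum>u\<in>V'. t (\<iota> u) y * x u (G - {y}))"
      proof (intro sum.cong refl)
        fix y assume "y \<in> G"
        have "(\<Sum>r\<in>R. (case r of (u, H) \<Rightarrow> x u H) * (if snd r = G - {y} then t (\<iota> (fst r)) y else 0)) =
            (\<Sum>r\<in>(\<lambda>u. (u, G - {y})) ` V'. (case r of (u, H) \<Rightarrow> x u H) * t (\<iota> (fst r)) y)"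
          using finR finV' x(1) GP
          by (intro sum.mono_neutral_cong) (auto simp: R_def)
        also have "\<dots> = (\<Sum>u\<in>V'. t (\<iota> u) y * x u (G - {y}))"
          by (subst sum.reindex) (auto simp: inj_on_def mult.commute)
        finally show "(\<Sum>r\<in>R. (case r of (u, H) \<Rightarrow> x u H) * (if snd r = G - {y} then t (\<iota> (fst r)) y else 0)) =
            (\<Sum>u\<in>V'. t (\<iota> u) y * x u (G - {y}))" .
      qed
      also have "\<dots> = (if G = G0 then 1 else 0)" using x(2) G by (simp add: C_def)
      finally show ?thesis .
    qed
    then show ?thesis by (intro exI[of _ "\<lambda>r. case r of (u, H) \<Rightarrow> x u H"]) blast
  qed
  from spanning_rows_injection[OF finC finR this] obtain f
    where f: "inj_on f C" "f ` C \<subseteq> R" "\<forall>G\<in>C. M (f G) G \<noteq> 0" by blast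
  have "\<exists>y. y \<in> G \<and> snd (f G) = G - {y} \<and> T (fst (f G)) y" if G: "?min G" for G
  proof -
    have "M (f G) G \<noteq> 0" and "f G \<in> R" using f(2,3) G by (auto simp: C_def)
    from this(1) obtain y where "y \<in> G" "(if snd (f G) = G - {y} then t (\<iota> (fst (f G))) y else 0) \<noteq> 0"
      unfolding M_def by (rule sum.not_neutral_contains_not_neutral)
    then show ?thesis using \<open>f G \<in> R\<close> by (auto simp: T_def R_def split: if_splits)
  qed
  then obtain y where y: "\<And>G. ?min G \<Longrightarrow> y G \<in> G \<and> snd (f G) = G - {y G} \<and> T (fst (f G)) (y G)"
    by metis
  have fUU: "UU (fst (f G)) (G - {y G})" if "?min G" for G
    using f(2) y[OF that] that by (auto simp: C_def R_def)
  show False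
  proof (rule no_disjoint_pair[where P = P and U = U and UU = UU and T = T and ?F1.0 = F1 and ?F2.0 = F2
        and y = y and u = "\<lambda>G. fst (f G)"])
    show "finite P" by (rule finP)
    show "UU u H" if "UU u G" "G \<subseteq> H" "H \<subseteq> P" for u G H using that by (rule UUup)
    show "U G" if "UU u G" "UU v G" "G \<subseteq> P" "u \<noteq> v" for u v G using that by (rule UU2)
    show "U (insert y G)" if "UU u G" "G \<subseteq> P" "y \<in> P" "T u y" for u G y using that by (rule TU)
  next
    fix G assume "?min G"
    then show "y G \<in> G \<and> T (fst (f G)) (y G) \<and> UU (fst (f G)) (G - {y G})"
      using y fUU by blast
  next
    fix G H assume G: "?min G" and H: "?min H" and eq: "G - {y G} = H - {y H}"
    \<comment> \<open>A non-interior set misses at most one \<open>u\<close> in only one way, so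
      equal deletions give equal rows.\<close>
    have "\<not> U (G - {y G})" using minimal_inD(3)[OF G, of "G - {y G}"] y[OF G] by blast
    moreover have "G - {y G} \<subseteq> P" using minimal_inD(2)[OF G] by blast
    ultimately have "fst (f G) = fst (f H)" using UU2[OF fUU[OF G]] fUU[OF H] eq by metis
    then have "f G = f H" using y[OF G] y[OF H] eq by (simp add: prod_eq_iff)
    then show "G = H" using f(1) G H by (simp add: inj_on_def C_def)
  next
    fix a b c d v r
    assume m: "?min {a, b}" "?min {a, d}" "?min {c, b}" "?min {c, d}"
      and ne: "a \<noteq> b" "a \<noteq> c" "a \<noteq> d" "b \<noteq> c" "b \<noteq> d" "c \<noteq> d"
      and UUs: "UU v {a}" "UU v {c}" "UU r {b}" "UU r {d}" and Ts: "T v b" "T v d" "T r a" "T r c"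
    obtain x where x: "\<forall>u H. x u H \<noteq> 0 \<longrightarrow> H \<subseteq> P \<longrightarrow> u \<in> V' \<longrightarrow> UU u H"
      "\<forall>G. ?min G \<longrightarrow> (\<Sum>y\<in>G. \<Sum>u\<in>V'. t (\<iota> u) y * x u (G - {y})) = (if G = {a, b} then 1 else 0)"
      using coef[OF m(1)] by (elim exE conjE)
    \<comment> \<open>For a non-interior {p} only one row with second component {p} can carry a
      nonzero coefficient.\<close>
    have single: "(\<Sum>u\<in>V'. t (\<iota> u) z * x u {p}) = t (\<iota> q) z * x q {p}"
      if q: "UU q {p}" and p: "p \<in> P" "\<not> U {p}" for q p z
    proof -
      have "x u {p} = 0" if "u \<in> V'" "u \<noteq> q" for u
      proof (rule ccontr)
        assume "x u {p} \<noteq> 0"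
        then have "UU u {p}" using x(1) that(1) p(1) by simp
        then show False using UU2[OF q, of u] that(2) p by blast
      qed
      then have "(\<Sum>u\<in>V'. t (\<iota> u) z * x u {p}) = (\<Sum>u\<in>{q}. t (\<iota> u) z * x u {p})"
        using finV' q by (intro sum.mono_neutral_right) (auto simp: UU_def)
      then show ?thesis by simp
    qed
    have nU: "\<not> U {p}" "\<not> U {q}" and pq: "p \<in> P" "q \<in> P" if "?min {p, q}" "p \<noteq> q" for p q
      using minimal_inD(3)[OF that(1)] minimal_inD(2)[OF that(1)] that(2) by auto
    have eqn: "t (\<iota> l) p * x l {q} + t (\<iota> k) q * x k {p} = (if {p, q} = {a, b} then 1 else 0)"
      if "?min {p, q}" "p \<noteq> q" "UU k {p}" "UU l {q}" for p q k l
    proof -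
      have "{p, q} - {p} = {q}" "{p, q} - {q} = {p}" using that(2) by auto
      then have "(\<Sum>u\<in>V'. t (\<iota> u) p * x u {q}) + (\<Sum>u\<in>V'. t (\<iota> u) q * x u {p}) =
          (if {p, q} = {a, b} then 1 else 0)"
        using x(2)[rule_format, OF that(1)] that(2) by simp
      then show ?thesis using single that nU pq by simp
    qed
    have "t (\<iota> r) a * x r {b} + t (\<iota> v) b * x v {a} = 1"
      using eqn[OF m(1) ne(1) UUs(1,3)] by simp
    moreover have "t (\<iota> r) a * x r {d} + t (\<iota> v) d * x v {a} = 0"
      using eqn[OF m(2) ne(3) UUs(1,4)] ne by (simp add: doubleton_eq_iff)
    moreover have "t (\<iota> r) c * x r {b} + t (\<iota> v) b * x v {c} = 0"
      using eqn[OF m(3) ne(4)[symmetric] UUs(2,3)] ne by (simp add: doubleton_eq_iff)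
    moreover have "t (\<iota> r) c * x r {d} + t (\<iota> v) d * x v {c} = 0"
      using eqn[OF m(4) ne(6) UUs(2,4)] ne by (simp add: doubleton_eq_iff)
    ultimately have "t (\<iota> v) d * t (\<iota> r) c = 0" by (rule four_cycle_singular)
    then show False using Ts by (simp add: T_def)
  qed (use F12 in \<open>auto simp: P_def U_def\<close>)
qed

end

section \<open>Polynomials and parameter systems\<close>

lemma poly_mapping_sum_single: "p = (\<Sum>m\<in>Poly_Mapping.keys p. Poly_Mapping.single m (Poly_Mapping.lookup p m))"
proof (rule poly_mapping_eqI)
  fix k
  have "Poly_Mapping.lookup (\<Sum>m\<in>Poly_Mapping.keys p. Poly_Mapping.single m (Poly_Mapping.lookup p m)) k =
      (\<Sum>m\<in>Poly_Mapping.keys p. if m = k then Poly_Mapping.lookup p m else 0)"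
    unfolding lookup_sum by (intro sum.cong refl) (simp add: lookup_single when_def)
  also have "\<dots> = Poly_Mapping.lookup p k" by (simp add: in_keys_iff)
  finally show "Poly_Mapping.lookup p k =
    Poly_Mapping.lookup (\<Sum>m\<in>Poly_Mapping.keys p. Poly_Mapping.single m (Poly_Mapping.lookup p m)) k" by simp
qed

lemma poly_mapping_add_induct:
  fixes p :: "'x \<Rightarrow>\<^sub>0 'y::comm_monoid_add"
  assumes "\<And>m b. Q (Poly_Mapping.single m b)" and "\<And>p q. Q p \<Longrightarrow> Q q \<Longrightarrow> Q (p + q)"
  shows "Q p"
proof -
  have "Q (\<Sum>m\<in>M. Poly_Mapping.single m (Poly_Mapping.lookup p m))" for M
  proof (induction M rule: infinite_finite_induct)
    case (insert x F)
    then show ?case using assms by simp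
  qed (use assms(1)[of undefined 0] in simp_all)
  then show ?thesis using poly_mapping_sum_single[of p] by metis
qed

lemma monom_eq_single:
  "monom G = Poly_Mapping.single (\<Sum>w\<in>G. Poly_Mapping.single w 1) (1::'k::field)"
  unfolding monom_def
  by (induction G rule: infinite_finite_induct) (simp_all add: var_def mult_single)

lemma lookup_sum_single_one:
  "finite G \<Longrightarrow> Poly_Mapping.lookup (\<Sum>w\<in>G. Poly_Mapping.single w (1::nat)) v = (if v \<in> G then 1 else 0)"
  by (simp add: lookup_sum lookup_single when_def)

lemma const_times_var: "const a * var w = Poly_Mapping.single (Poly_Mapping.single w 1) a"
  by (simp add: const_def var_def mult_single)

text \<open>Every monomial of a multiple of x^G has support containing \<open>G\<close>, which is
  impossible on a face if \<open>G\<close> is not one.\<close>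

lemma lookup_SR_ideal:
  assumes \<Delta>: "simplicial_complex \<Delta>" and p: "p \<in> ideal_gen (SR_gens \<Delta>)" and m: "Poly_Mapping.keys m \<in> \<Delta>"
  shows "Poly_Mapping.lookup p m = 0"
proof -
  obtain A c where A: "A \<subseteq> SR_gens \<Delta>" "p = (\<Sum>s\<in>A. c s * s)" using p unfolding ideal_gen_def by blast
  have "Poly_Mapping.lookup (c s * s) m = 0" if "s \<in> A" for s
  proof (rule ccontr)
    assume "Poly_Mapping.lookup (c s * s) m \<noteq> 0"
    then have mk: "m \<in> Poly_Mapping.keys (c s * s)" by (simp add: in_keys_iff)
    have "s \<in> SR_gens \<Delta>" using that A(1) by (rule subsetD[rotated])
    then obtain G where G: "finite G" "G \<notin> \<Delta>" "s = monom G" unfolding SR_gens_def by auto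
    obtain m' where m': "m = m' + (\<Sum>w\<in>G. Poly_Mapping.single w 1)"
      using mk keys_mult[of "c s" s] unfolding G(3) monom_eq_single by auto
    have "G \<subseteq> Poly_Mapping.keys m"
    proof
      fix x assume "x \<in> G"
      then have "Poly_Mapping.lookup m x = Poly_Mapping.lookup m' x + 1"
        unfolding m' lookup_add lookup_sum_single_one[OF G(1)] by simp
      then show "x \<in> Poly_Mapping.keys m" by (simp add: in_keys_iff)
    qed
    then show False using simplicial_complexD[OF \<Delta> m] G(2) by blast
  qed
  then show ?thesis unfolding A(2) lookup_sum by simp
qed

lemma single_one_add_eq_iff:
  fixes m m0 :: "'a \<Rightarrow>\<^sub>0 nat"
  shows "m0 + Poly_Mapping.single y 1 = m \<longleftrightarrow> y \<in> Poly_Mapping.keys m \<and> m0 = m - Poly_Mapping.single y 1"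
proof
  assume *: "y \<in> Poly_Mapping.keys m \<and> m0 = m - Poly_Mapping.single y 1"
  then have "Poly_Mapping.lookup m y \<noteq> 0" by (simp add: in_keys_iff)
  then have "m - Poly_Mapping.single y 1 + Poly_Mapping.single y 1 = m"
    by (intro poly_mapping_eqI) (auto simp: lookup_add lookup_minus lookup_single when_def)
  then show "m0 + Poly_Mapping.single y 1 = m" using * by simp
qed (auto simp: in_keys_iff lookup_add)

lemma lookup_times_var:
  fixes p :: "('a, 'k::field) poly"
  shows "Poly_Mapping.lookup (p * Poly_Mapping.single (Poly_Mapping.single y 1) a) m =
    (if y \<in> Poly_Mapping.keys m then a * Poly_Mapping.lookup p (m - Poly_Mapping.single y 1) else 0)"
proof (induction p rule: poly_mapping_add_induct)
  case (1 m0 b)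
  show ?case
    using single_one_add_eq_iff[of m0 y m] by (auto simp: mult_single lookup_single when_def)
qed (simp add: distrib_right lookup_add distrib_left)

lemma lin_form_eq:
  assumes "lin_form_on S \<theta>"
  obtains W where "finite W" "W \<subseteq> S"
    "\<theta> = (\<Sum>w\<in>W. Poly_Mapping.single (Poly_Mapping.single w 1) (Poly_Mapping.lookup \<theta> (Poly_Mapping.single w 1)))"
    "\<And>w. w \<notin> W \<Longrightarrow> Poly_Mapping.lookup \<theta> (Poly_Mapping.single w 1) = 0"
proof -
  obtain W c where W: "finite W" "W \<subseteq> S" and \<theta>: "\<theta> = (\<Sum>w\<in>W. const (c w) * var w)"
    using assms unfolding lin_form_on_def by blast
  have inj: "Poly_Mapping.single w (1::nat) = Poly_Mapping.single v 1 \<longleftrightarrow> w = v" for w v :: 'a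
    by (metis keys_single singleton_inject zero_neq_one)
  have "Poly_Mapping.lookup \<theta> (Poly_Mapping.single v 1) = (if v \<in> W then c v else 0)" for v
    unfolding \<theta> const_times_var lookup_sum lookup_single inj using W(1) by (simp add: when_def)
  then show ?thesis using that[of W] W \<theta> by (simp add: const_times_var)
qed

lemma lookup_times_lin_form:
  fixes p \<theta> :: "('a, 'k::field) poly"
  assumes "lin_form_on S \<theta>"
  shows "Poly_Mapping.lookup (p * \<theta>) m =
    (\<Sum>y\<in>Poly_Mapping.keys m. Poly_Mapping.lookup \<theta> (Poly_Mapping.single y 1) *
       Poly_Mapping.lookup p (m - Poly_Mapping.single y 1))"
proof -
  let ?t = "\<lambda>y. Poly_Mapping.lookup \<theta> (Poly_Mapping.single y 1)"
  obtain W where W: "finite W" "\<theta> = (\<Sum>w\<in>W. Poly_Mapping.single (Poly_Mapping.single w 1) (?t w))"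
    "\<And>w. w \<notin> W \<Longrightarrow> ?t w = 0"
    using lin_form_eq[OF assms] by metis
  have "Poly_Mapping.lookup (p * \<theta>) m =
      (\<Sum>w\<in>W. if w \<in> Poly_Mapping.keys m then ?t w * Poly_Mapping.lookup p (m - Poly_Mapping.single w 1) else 0)"
    by (subst W(2)) (simp only: sum_distrib_left lookup_sum lookup_times_var)
  also have "\<dots> = (\<Sum>y\<in>Poly_Mapping.keys m \<inter> W. ?t y * Poly_Mapping.lookup p (m - Poly_Mapping.single y 1))"
    using W(1) by (intro sum.mono_neutral_cong_right) auto
  also have "\<dots> = (\<Sum>y\<in>Poly_Mapping.keys m. ?t y * Poly_Mapping.lookup p (m - Poly_Mapping.single y 1))"
    using W(3) by (intro sum.mono_neutral_left) auto
  finally show ?thesis .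
qed

lemma ideal_gen_Un_image:
  assumes "p \<in> ideal_gen (S \<union> \<theta> ` I)"
  shows "\<exists>p0 q J. finite J \<and> J \<subseteq> I \<and> p0 \<in> ideal_gen S \<and> p = p0 + (\<Sum>i\<in>J. q i * \<theta> i)"
proof -
  obtain A c where A: "finite A" "A \<subseteq> S \<union> \<theta> ` I" and p: "p = (\<Sum>s\<in>A. c s * s)"
    using assms unfolding ideal_gen_def by blast
  have "A - S \<subseteq> \<theta> ` I" using A(2) by blast
  \<comment> \<open>Different indices may give the same generator; \<open>J\<close> picks one index
    for each.\<close>
  then obtain J where J: "J \<subseteq> I" "inj_on \<theta> J" "A - S = \<theta> ` J" using subset_image_inj by metis
  have "finite J" using A(1) J(2,3) finite_imageD[of \<theta> J] by (metis finite_Diff)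
  have "p = (\<Sum>s\<in>A \<inter> S. c s * s) + (\<Sum>s\<in>A - S. c s * s)"
    unfolding p using A(1) by (subst sum.union_disjoint[symmetric]) (auto intro!: sum.cong)
  also have "(\<Sum>s\<in>A - S. c s * s) = (\<Sum>i\<in>J. c (\<theta> i) * \<theta> i)"
    unfolding J(3) by (rule sum.reindex_cong[OF J(2)]) auto
  finally have "p = (\<Sum>s\<in>A \<inter> S. c s * s) + (\<Sum>i\<in>J. c (\<theta> i) * \<theta> i)" .
  moreover have "(\<Sum>s\<in>A \<inter> S. c s * s) \<in> ideal_gen S" using A(1) unfolding ideal_gen_def by blast
  ultimately show ?thesis
    using \<open>finite J\<close> J(1)
    by (intro exI[of _ "\<Sum>s\<in>A \<inter> S. c s * s"] exI[of _ "\<lambda>i. c (\<theta> i)"] exI[of _ J] conjI)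
qed

section \<open>Parameters restricted to a face\<close>

lemma fredholm_alternative:
  fixes t :: "'i \<Rightarrow> 'a \<Rightarrow> 'k::field"
  assumes "finite N" "finite G"
  shows "(\<exists>\<alpha>. \<forall>y\<in>G. (\<Sum>i\<in>N. \<alpha> i * t i y) = e y) \<or>
    (\<exists>x. (\<forall>i\<in>N. (\<Sum>y\<in>G. t i y * x y) = 0) \<and> (\<Sum>y\<in>G. e y * x y) \<noteq> 0)"
  using assms(1)
proof (induction N arbitrary: e)
  case empty
  show ?case
  proof (cases "\<forall>y\<in>G. e y = 0")
    case False
    then obtain z where "z \<in> G" "e z \<noteq> 0" by blast
    then have "(\<Sum>y\<in>G. e y * (if y = z then 1 else 0)) \<noteq> 0" using assms(2) by (simp add: if_distrib cong: if_cong)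
    then show ?thesis by (intro disjI2 exI[of _ "\<lambda>y. if y = z then 1 else 0"]) simp
  qed auto
next
  case (insert k N)
  define dot where "dot f x = (\<Sum>y\<in>G. f y * x y)" for f x :: "'a \<Rightarrow> 'k"
  have dot1: "dot (\<lambda>y. f y - r * g y) x = dot f x - r * dot g x" for f g x r
    by (simp add: dot_def left_diff_distrib sum_subtractf sum_distrib_left mult.assoc)
  have dot2: "dot f (\<lambda>y. x y - r * z y) = dot f x - r * dot f z" for f x z r
    by (simp add: dot_def right_diff_distrib sum_subtractf sum_distrib_left mult_ac)
  have IH: "(\<exists>\<alpha>. \<forall>y\<in>G. (\<Sum>i\<in>N. \<alpha> i * t i y) = e' y) \<or> (\<exists>x. (\<forall>i\<in>N. dot (t i) x = 0) \<and> dot e' x \<noteq> 0)" for e'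
    using insert.IH[of e'] by (simp add: dot_def)
  have goal: "\<exists>\<alpha>. \<forall>y\<in>G. (\<Sum>i\<in>insert k N. \<alpha> i * t i y) = e y"
    if "\<forall>y\<in>G. (\<Sum>i\<in>N. \<alpha> i * t i y) = e y - r * t k y" for \<alpha> r
  proof (intro exI[of _ "\<alpha>(k := r)"] ballI)
    fix y assume "y \<in> G"
    have "(\<Sum>i\<in>N. (\<alpha>(k := r)) i * t i y) = (\<Sum>i\<in>N. \<alpha> i * t i y)"
      using insert.hyps(2) by (intro sum.cong) auto
    then show "(\<Sum>i\<in>insert k N. (\<alpha>(k := r)) i * t i y) = e y"
      using insert.hyps that \<open>y \<in> G\<close> by simp
  qed
  show ?case
    unfolding dot_def[symmetric]
  proof (cases "\<exists>\<alpha>. \<forall>y\<in>G. (\<Sum>i\<in>N. \<alpha> i * t i y) = e y")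
    case True
    then show "(\<exists>\<alpha>. \<forall>y\<in>G. (\<Sum>i\<in>insert k N. \<alpha> i * t i y) = e y) \<or>
      (\<exists>x. (\<forall>i\<in>insert k N. dot (t i) x = 0) \<and> dot e x \<noteq> 0)"
      using goal[of _ 0] by auto
  next
    case False
    then obtain x where x: "\<forall>i\<in>N. dot (t i) x = 0" "dot e x \<noteq> 0" using IH[of e] by auto
    show "(\<exists>\<alpha>. \<forall>y\<in>G. (\<Sum>i\<in>insert k N. \<alpha> i * t i y) = e y) \<or>
      (\<exists>x. (\<forall>i\<in>insert k N. dot (t i) x = 0) \<and> dot e x \<noteq> 0)"
    proof (cases "dot (t k) x = 0")
      case True
      then show ?thesis using x by auto
    next
      case nz: False
      \<comment> \<open>With this \<open>r\<close> the functional \<open>e - r * t k\<close>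
        vanishes at \<open>x\<close>. Correcting a certificate \<open>z\<close> for it by a multiple
        of \<open>x\<close> therefore keeps its value nonzero, and \<open>q\<close> is chosen so
        that row \<open>k\<close> vanishes at the corrected vector.\<close>
      define r where "r = dot e x / dot (t k) x"
      show ?thesis
      proof (cases "\<exists>\<alpha>. \<forall>y\<in>G. (\<Sum>i\<in>N. \<alpha> i * t i y) = e y - r * t k y")
        case True
        then show ?thesis using goal by blast
      next
        case False
        then obtain z where z: "\<forall>i\<in>N. dot (t i) z = 0" "dot (\<lambda>y. e y - r * t k y) z \<noteq> 0"
          using IH[of "\<lambda>y. e y - r * t k y"] by auto
        define q where "q = dot (t k) z / dot (t k) x"
        define x' where "x' = (\<lambda>y. z y - q * x y)"
        have q: "q * dot (t k) x = dot (t k) z" using nz by (simp add: q_def)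
        then have "\<forall>i\<in>insert k N. dot (t i) x' = 0" using x z by (simp add: x'_def dot2)
        moreover have "q * dot e x = r * dot (t k) z" by (simp add: q_def r_def)
        then have "dot e x' \<noteq> 0" using z(2) by (simp add: x'_def dot1 dot2)
        ultimately show ?thesis by blast
      qed
    qed
  qed
qed

definition tdeg :: "('a \<Rightarrow>\<^sub>0 nat) \<Rightarrow> nat" where
  "tdeg m = (\<Sum>y\<in>Poly_Mapping.keys m. Poly_Mapping.lookup m y)"

definition mval :: "('a \<Rightarrow> 'k::field) \<Rightarrow> ('a \<Rightarrow>\<^sub>0 nat) \<Rightarrow> 'k" where
  "mval x m = (\<Prod>y\<in>Poly_Mapping.keys m. x y ^ Poly_Mapping.lookup m y)"

text \<open>The value at the point \<open>x\<close> of the homogeneous component of \<open>f\<close>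
  of degree \<open>n\<close>.\<close>

definition hval :: "('a \<Rightarrow> 'k::field) \<Rightarrow> nat \<Rightarrow> ('a, 'k) poly \<Rightarrow> 'k" where
  "hval x n f = (\<Sum>m\<in>Poly_Mapping.keys f. if tdeg m = n then Poly_Mapping.lookup f m * mval x m else 0)"

lemma tdeg_superset: "finite K \<Longrightarrow> Poly_Mapping.keys m \<subseteq> K \<Longrightarrow> tdeg m = (\<Sum>y\<in>K. Poly_Mapping.lookup m y)"
  unfolding tdeg_def by (rule sum.mono_neutral_left) (auto simp: in_keys_iff)

lemma mval_superset: "finite K \<Longrightarrow> Poly_Mapping.keys m \<subseteq> K \<Longrightarrow> mval x m = (\<Prod>y\<in>K. x y ^ Poly_Mapping.lookup m y)"
  unfolding mval_def by (rule prod.mono_neutral_left) (auto simp: in_keys_iff)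

lemma tdeg_add: "tdeg (m + m') = tdeg m + tdeg m'"
proof -
  let ?K = "Poly_Mapping.keys m \<union> Poly_Mapping.keys m'"
  have "finite ?K" "Poly_Mapping.keys (m + m') \<subseteq> ?K" using Poly_Mapping.keys_add[of m m'] by auto
  then show ?thesis
    using tdeg_superset[of ?K m] tdeg_superset[of ?K m'] tdeg_superset[of ?K "m + m'"]
    by (simp add: lookup_add sum.distrib)
qed

lemma mval_add: "mval x (m + m') = mval x m * mval x m'"
proof -
  let ?K = "Poly_Mapping.keys m \<union> Poly_Mapping.keys m'"
  have "finite ?K" "Poly_Mapping.keys (m + m') \<subseteq> ?K" using Poly_Mapping.keys_add[of m m'] by auto
  then show ?thesis
    using mval_superset[of ?K m x] mval_superset[of ?K m' x] mval_superset[of ?K "m + m'" x]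
    by (simp add: lookup_add power_add prod.distrib)
qed

lemma hval_add: "hval x n (f + g) = hval x n f + hval x n g"
  unfolding hval_def by (rule setsum_keys_plus_distrib) (simp_all add: distrib_right)

lemma hval_single: "hval x n (Poly_Mapping.single m b) = (if tdeg m = n then b * mval x m else 0)"
  by (simp add: hval_def)

lemma hval_sum: "hval x n (\<Sum>s\<in>S. f s) = (\<Sum>s\<in>S. hval x n (f s))"
proof (induction S rule: infinite_finite_induct)
  case (insert s S)
  then show ?case by (simp add: hval_add)
qed (simp_all add: hval_def)

lemma hval_times_single:
  "hval x n (f * Poly_Mapping.single k b) =
    (if tdeg k \<le> n then b * mval x k * hval x (n - tdeg k) f else 0)"
proof (induction f rule: poly_mapping_add_induct)
  case (1 m c)
  show ?case by (auto simp: mult_single hval_single tdeg_add mval_add)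
qed (simp add: distrib_right hval_add distrib_left)

lemma hval_const_times: "hval x n (const b * f) = b * hval x n f"
  using hval_times_single[of x n f 0 b] by (simp add: const_def mult.commute tdeg_def mval_def)

lemma tdeg_single: "tdeg (Poly_Mapping.single y n) = n"
  by (cases "n = 0") (simp_all add: tdeg_def)

lemma mval_single: "mval x (Poly_Mapping.single y n) = x y ^ n"
  by (cases "n = 0") (simp_all add: mval_def)

lemma hval_ideal:
  assumes "\<And>s f. s \<in> S \<Longrightarrow> hval x n (f * s) = 0" "p \<in> ideal_gen S"
  shows "hval x n p = 0"
proof -
  obtain A c where A: "A \<subseteq> S" "p = (\<Sum>s\<in>A. c s * s)" using assms(2) unfolding ideal_gen_def by blast
  then show ?thesis using assms(1) by (auto simp: hval_sum intro!: sum.neutral)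
qed

text \<open>Otherwise the parameters vanish on a line in the coordinate subspace of \<open>G\<close>, on which the powers of
  \<open>x\<^sub>w\<close> have unbounded degree.\<close>

lemma lsop_spans:
  fixes \<theta> :: "nat \<Rightarrow> ('a, 'k::field) poly"
  assumes \<Delta>: "simplicial_complex \<Delta>" and lsop: "lsop \<Delta> d \<theta>" and G: "G \<in> \<Delta>" "w \<in> G"
  shows "\<exists>\<alpha>. \<forall>y\<in>G. (\<Sum>i<d. \<alpha> i * Poly_Mapping.lookup (\<theta> i) (Poly_Mapping.single y 1)) = (if y = w then 1 else 0)"
proof (rule ccontr)
  let ?t = "\<lambda>i y. Poly_Mapping.lookup (\<theta> i) (Poly_Mapping.single y 1)"
  have finG: "finite G" using simplicial_complex_finite[OF \<Delta> G(1)] .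
  assume "\<not> ?thesis"
  then obtain x0 where x0: "\<forall>i\<in>{..<d}. (\<Sum>y\<in>G. ?t i y * x0 y) = 0"
    "(\<Sum>y\<in>G. (if y = w then 1 else 0) * x0 y) \<noteq> 0"
    using fredholm_alternative[of "{..<d}" G ?t "\<lambda>y. if y = w then 1 else 0"] finG by auto
  have x0w: "x0 w \<noteq> 0" using x0(2) finG G(2) by (simp add: if_distrib[of "\<lambda>r. r * _"] cong: if_cong)
  \<comment> \<open>Extension by zero gives a point of the coordinate subspace of \<open>G\<close>:
    monomials of non-faces vanish there, and the parameters vanish by the choice of
    \<open>x0\<close>.\<close>
  define x where "x y = (if y \<in> G then x0 y else 0)" for y
  have lin: "lin_form_on UNIV (\<theta> i)" if "i < d" for i using lsop that unfolding lsop_def by blast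
  have kill: "hval x n (f * s) = 0" if s: "s \<in> SR_gens \<Delta> \<union> \<theta> ` {..<d}" for n f s
  proof (cases "s \<in> SR_gens \<Delta>")
    case True
    then obtain H where H: "s = monom H" "finite H" "H \<notin> \<Delta>" unfolding SR_gens_def by auto
    then obtain v where v: "v \<in> H" "v \<notin> G" using simplicial_complexD[OF \<Delta> G(1)] by blast
    have "v \<in> Poly_Mapping.keys (\<Sum>w\<in>H. Poly_Mapping.single w (1::nat))"
      unfolding in_keys_iff lookup_sum_single_one[OF H(2)] using v(1) by simp
    moreover have "x v ^ Poly_Mapping.lookup (\<Sum>w\<in>H. Poly_Mapping.single w (1::nat)) v = 0"
      unfolding lookup_sum_single_one[OF H(2)] using v by (simp add: x_def)
    ultimately have "mval x (\<Sum>w\<in>H. Poly_Mapping.single w 1) = 0"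
      unfolding mval_def by (intro prod_zero) auto
    then show ?thesis unfolding H(1) monom_eq_single hval_times_single by simp
  next
    case False
    then obtain i where i: "i < d" "s = \<theta> i" using s by auto
    obtain W where W: "finite W"
      "\<theta> i = (\<Sum>w\<in>W. Poly_Mapping.single (Poly_Mapping.single w 1) (?t i w))" "\<And>w. w \<notin> W \<Longrightarrow> ?t i w = 0"
      using lin_form_eq[OF lin[OF i(1)]] by metis
    have "hval x n (f * \<theta> i) = (\<Sum>w\<in>W. if 1 \<le> n then ?t i w * x w * hval x (n - 1) f else 0)"
      by (subst W(2)) (simp only: sum_distrib_left hval_sum hval_times_single tdeg_single mval_single power_one_right)
    also have "\<dots> = (if 1 \<le> n then (\<Sum>w\<in>W. ?t i w * x w) * hval x (n - 1) f else 0)"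
      by (simp add: sum_distrib_right)
    also have "(\<Sum>w\<in>W. ?t i w * x w) = (\<Sum>w\<in>W \<inter> G. ?t i w * x w)"
      using W(1) by (intro sum.mono_neutral_right) (auto simp: x_def)
    also have "\<dots> = (\<Sum>w\<in>G. ?t i w * x0 w)"
      using W(3) finG by (intro sum.mono_neutral_cong_left) (auto simp: x_def)
    also have "\<dots> = 0" using x0(1) i(1) by simp
    finally show ?thesis by (simp add: i(2))
  qed
  have ideal: "hval x n p = 0" if "p \<in> ideal_gen (SR_gens \<Delta> \<union> \<theta> ` {..<d})" for n p
    by (rule hval_ideal[OF kill that])
  obtain S where S: "finite S"
    "\<forall>p. \<exists>c. p - (\<Sum>s\<in>S. const (c s) * s) \<in> ideal_gen (SR_gens \<Delta> \<union> \<theta> ` {..<d})"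
    using lsop unfolding lsop_def by blast
  \<comment> \<open>A degree beyond all monomials of the finite spanning set, so that all its
    elements have zero component there; the inserted 0 keeps the maximum defined when there are no
    monomials.\<close>
  define n where "n = Suc (Max (insert 0 (tdeg ` (\<Union>s\<in>S. Poly_Mapping.keys s))))"
  have "tdeg m \<noteq> n" if "s \<in> S" "m \<in> Poly_Mapping.keys s" for s m
  proof -
    have "tdeg m \<le> Max (insert 0 (tdeg ` (\<Union>s\<in>S. Poly_Mapping.keys s)))"
      by (rule Max_ge) (use S(1) that in auto)
    then show ?thesis by (simp add: n_def)
  qed
  then have hS: "hval x n s = 0" if "s \<in> S" for s unfolding hval_def using that by (intro sum.neutral) auto
  obtain c where c: "Poly_Mapping.single (Poly_Mapping.single w n) 1 - (\<Sum>s\<in>S. const (c s) * s)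
      \<in> ideal_gen (SR_gens \<Delta> \<union> \<theta> ` {..<d})" (is "?f - ?g \<in> _")
    using S(2) by blast
  have "hval x n ?f = hval x n (?f - ?g) + hval x n ?g" by (simp flip: hval_add)
  also have "\<dots> = 0" using ideal[OF c] hS by (simp add: hval_sum hval_const_times)
  finally show False using x0w G(2) by (simp add: hval_single tdeg_single mval_single x_def)
qed

section \<open>Homology triangulations\<close>

lemma hball_bd_acyclic: "hball_bd K d \<Delta> B \<Longrightarrow> acyclic_cx K \<Delta>"
  by (erule hball_bd.cases) simp

lemma triangulation_ball:
  assumes "homology_triangulation TYPE('k::field) \<Gamma> \<sigma> V" "U \<subseteq> V" "U \<noteq> {}"
  obtains B where "hball_bd TYPE('k) (int (card U) - 1) (restr \<Gamma> \<sigma> U) B"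
    "restr \<Gamma> \<sigma> U - B = {F \<in> \<Gamma>. \<sigma> F = U}"
  using assms unfolding homology_triangulation_def by blast

lemma lk_empty: "lk \<Delta> {} = \<Delta>"
  by (auto simp: lk_def)

text \<open>For empty \<open>G\<close> the ball is acyclic; for a nonempty boundary face the link is
  a ball, again acyclic; for an interior face it is a sphere, with homology only in the excluded
  degree.\<close>

lemma triangulation_link_hom_zero:
  fixes \<Gamma> :: "'a::linorder set set"
  assumes tri: "homology_triangulation TYPE('k::field) \<Gamma> \<sigma> V" and U: "U \<subseteq> V" "U \<noteq> {}"
    and G: "G \<in> restr \<Gamma> \<sigma> U" and i: "i \<noteq> int (card U) - 1 - int (card G)"
  shows "hom_zero TYPE('k) (lk (restr \<Gamma> \<sigma> U) G) i"
proof -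
  let ?R = "restr \<Gamma> \<sigma> U" and ?d = "int (card U) - 1"
  obtain B where B: "hball_bd TYPE('k) ?d ?R B" using triangulation_ball[OF tri U] by blast
  from B show ?thesis
  proof cases
    case 1
    show ?thesis
    proof (cases "G = {}")
      case True
      then show ?thesis using 1(3) by (simp add: lk_empty acyclic_cx_def)
    next
      case False
      show ?thesis
      proof (cases "G \<in> B")
        case True
        then obtain B' where "hball_bd TYPE('k) (?d - int (card G)) (lk ?R G) B'" using 1(8) False by blast
        then show ?thesis using hball_bd_acyclic unfolding acyclic_cx_def by blast
      next
        case False
        then have sph: "hsphere TYPE('k) (?d - int (card G)) (lk ?R G)" using 1(7) G by blast
        have "{} \<in> lk ?R G"
          using G simplicial_complexD[OF 1(1) G, of "{}"] by (simp add: lk_def)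
        then have "hom_zero TYPE('k) (lk (lk ?R G) {}) i"
          using sph i unfolding hsphere_def by (metis card.empty diff_zero of_nat_0)
        then show ?thesis by (simp add: lk_empty)
      qed
    qed
  qed
qed

text \<open>Monotonicity comes from each restriction being a simplicial complex. For an empty
  carrier there is no ball to use directly, so the ball over a singleton {v} is taken:
  \<open>F\<close> lies in its boundary, hence so does \<open>G\<close>, whose carrier is then a
  proper subset of {v}.\<close>

lemma carrier_mono:
  fixes \<Gamma> :: "'a::linorder set set"
  assumes tri: "homology_triangulation TYPE('k::field) \<Gamma> \<sigma> V" and F: "F \<in> \<Gamma>" "G \<subseteq> F"
  shows "\<sigma> G \<subseteq> \<sigma> F"
proof (cases "\<sigma> F = {}")
  case False
  have "\<sigma> F \<subseteq> V" using tri F(1) unfolding homology_triangulation_def by blast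
  then obtain B where B: "hball_bd TYPE('k) (int (card (\<sigma> F)) - 1) (restr \<Gamma> \<sigma> (\<sigma> F)) B"
    using triangulation_ball[OF tri _ False] by blast
  have "simplicial_complex (restr \<Gamma> \<sigma> (\<sigma> F))" using B by cases
  moreover have "F \<in> restr \<Gamma> \<sigma> (\<sigma> F)" using F(1) by (simp add: restr_def)
  ultimately have "G \<in> restr \<Gamma> \<sigma> (\<sigma> F)" using simplicial_complexD F(2) by blast
  then show ?thesis by (simp add: restr_def)
next
  case True
  obtain v where v: "v \<in> V" using tri unfolding homology_triangulation_def by blast
  then obtain B where B: "hball_bd TYPE('k) (int (card {v}) - 1) (restr \<Gamma> \<sigma> {v}) B"
    "restr \<Gamma> \<sigma> {v} - B = {F \<in> \<Gamma>. \<sigma> F = {v}}"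
    using triangulation_ball[OF tri, of "{v}"] by blast
  have R: "simplicial_complex (restr \<Gamma> \<sigma> {v})" "simplicial_complex B" using B(1) by (cases, simp)+
  have F': "F \<in> restr \<Gamma> \<sigma> {v}" using F(1) True by (simp add: restr_def)
  then have "F \<in> B" using B(2) True by blast
  then have "G \<in> B" using simplicial_complexD[OF R(2)] F(2) by blast
  moreover have "G \<in> restr \<Gamma> \<sigma> {v}" using simplicial_complexD[OF R(1) F' F(2)] .
  ultimately have "\<sigma> G \<subseteq> {v}" "\<sigma> G \<noteq> {v}" using B(2) by (auto simp: restr_def)
  then show ?thesis by blast
qed

text \<open>Makes the natural-number difference \<open>card V - card E\<close> a genuine
  one.\<close>

lemma card_face_le:
  fixes \<Gamma> :: "'a::linorder set set"
  assumes tri: "homology_triangulation TYPE('k::field) \<Gamma> \<sigma> V" and F: "F \<in> \<Gamma>"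
  shows "card F \<le> card V"
proof -
  have "V \<noteq> {}" "\<sigma> F \<subseteq> V" using tri F unfolding homology_triangulation_def by blast+
  then obtain B where B: "hball_bd TYPE('k) (int (card V) - 1) (restr \<Gamma> \<sigma> V) B"
    using triangulation_ball[OF tri subset_refl] by blast
  have "has_dim (restr \<Gamma> \<sigma> V) (int (card V) - 1)" using B by cases
  moreover have "F \<in> restr \<Gamma> \<sigma> V" using F \<open>\<sigma> F \<subseteq> V\<close> by (simp add: restr_def)
  ultimately show ?thesis unfolding has_dim_def by force
qed

text \<open>No set has negative cardinality, so there are no nonzero chains. This serves
  \<open>W = {}\<close>, over which no ball is given.\<close>

lemma hom_zero_below:
  assumes "i < -1"
  shows "hom_zero TYPE('k::field) \<Delta> i"
  unfolding hom_zero_def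
proof (intro allI impI)
  fix c :: "'a set \<Rightarrow> 'k" assume "is_cycle \<Delta> i c"
  then have "c = (\<lambda>_. 0)" using assms unfolding is_cycle_def chain_def by force
  then show "is_boundary \<Delta> i c"
    unfolding is_boundary_def by (intro exI[of _ "\<lambda>_. 0"]) (simp add: chain_def bd_def fun_eq_iff)
qed

text \<open>Monotone carriers reduce membership on both sides to the largest face involved, the
  union of \<open>H\<close>, \<open>G\<close> and \<open>E\<close>.\<close>

lemma lk_lk_restr:
  fixes \<Gamma> :: "'a::linorder set set"
  assumes tri: "homology_triangulation TYPE('k::field) \<Gamma> \<sigma> V" and G: "G \<in> lk \<Gamma> E" "\<sigma> (G \<union> E) \<subseteq> W"
  shows "lk {H \<in> lk \<Gamma> E. \<sigma> (H \<union> E) \<subseteq> W} G = lk (restr \<Gamma> \<sigma> W) (G \<union> E)"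
proof -
  have sc: "simplicial_complex \<Gamma>" using tri unfolding homology_triangulation_def by blast
  show ?thesis
  proof (intro equalityI subsetI)
    fix H assume H: "H \<in> lk {H \<in> lk \<Gamma> E. \<sigma> (H \<union> E) \<subseteq> W} G"
    then have *: "H \<union> G \<union> E \<in> \<Gamma>" "\<sigma> (H \<union> G \<union> E) \<subseteq> W" "H \<inter> (G \<union> E) = {}" by (auto simp: lk_def)
    then have "H \<in> \<Gamma>" "\<sigma> H \<subseteq> W"
      using simplicial_complexD[OF sc *(1), of H] carrier_mono[OF tri *(1), of H] by auto
    then show "H \<in> lk (restr \<Gamma> \<sigma> W) (G \<union> E)" using * by (simp add: lk_def restr_def Un_assoc)
  next
    fix H assume H: "H \<in> lk (restr \<Gamma> \<sigma> W) (G \<union> E)"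
    then have *: "H \<union> G \<union> E \<in> \<Gamma>" "\<sigma> (H \<union> G \<union> E) \<subseteq> W" "H \<inter> (G \<union> E) = {}"
      by (auto simp: lk_def restr_def Un_assoc)
    have sub: "X \<in> \<Gamma> \<and> \<sigma> X \<subseteq> W" if "X \<subseteq> H \<union> G \<union> E" for X
      using simplicial_complexD[OF sc *(1) that] carrier_mono[OF tri *(1) that] *(2) by auto
    have "G \<inter> E = {}" using G by (simp add: lk_def)
    then show "H \<in> lk {H \<in> lk \<Gamma> E. \<sigma> (H \<union> E) \<subseteq> W} G"
      using sub[of H] sub[of "H \<union> E"] sub[of "H \<union> G"] * by (auto simp: lk_def)
  qed
qed

text \<open>The Cohen-Macaulay condition is a count: |W| - |E| parameters survive over
  \<open>W\<close>, and the link of G and E in a ball of dimension |W| - 1 can have homology only in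
  dimension |W| - 1 - |G| - |E|, the first one not below the bound.\<close>

lemma carrier_complex_lk:
  fixes \<Gamma> :: "'a::linorder set set" and \<theta> :: "nat \<Rightarrow> ('a, 'k::field) poly"
  assumes tri: "homology_triangulation TYPE('k) \<Gamma> \<sigma> V" and E: "E \<in> \<Gamma>"
    and lsop: "lsop (lk \<Gamma> E) (card V - card E) \<theta>"
    and \<iota>: "inj_on \<iota> (V - \<sigma> E)" "\<iota> ` (V - \<sigma> E) \<subseteq> {..<card V - card E}"
    and spec: "\<forall>v\<in>V - \<sigma> E. \<exists>l. lin_form_on {w \<in> vertices (lk \<Gamma> E). v \<in> \<sigma> {w}} l \<and>
      \<theta> (\<iota> v) - l \<in> ideal_gen (SR_gens (lk \<Gamma> E))"
  shows "carrier_complex (lk \<Gamma> E) (\<lambda>G. \<sigma> (G \<union> E)) V {..<card V - card E}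
    (\<lambda>i y. Poly_Mapping.lookup (\<theta> i) (Poly_Mapping.single y 1)) \<iota>"
proof
  have sc: "simplicial_complex \<Gamma>" and V: "finite V" and \<sigma>V: "\<And>F. F \<in> \<Gamma> \<Longrightarrow> \<sigma> F \<subseteq> V"
    using tri unfolding homology_triangulation_def by blast+
  show sc\<Delta>: "simplicial_complex (lk \<Gamma> E)" by (rule simplicial_complex_lk[OF sc])
  show "finite {..<card V - card E}" by simp
  show "\<sigma> (G \<union> E) \<subseteq> \<sigma> (H \<union> E)" if "H \<in> lk \<Gamma> E" "G \<subseteq> H" for G H
    by (rule carrier_mono[OF tri]) (use that in \<open>auto simp: lk_def\<close>)
  show "\<sigma> (G \<union> E) \<subseteq> V" if "G \<in> lk \<Gamma> E" for G by (rule \<sigma>V) (use that in \<open>simp add: lk_def\<close>)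
  show "inj_on \<iota> (V - \<sigma> ({} \<union> E))" using \<iota>(1) by simp
  show "u \<in> \<sigma> ({y} \<union> E)"
    if "u \<in> V - \<sigma> ({} \<union> E)" "{y} \<in> lk \<Gamma> E"
      "Poly_Mapping.lookup (\<theta> (\<iota> u)) (Poly_Mapping.single y 1) \<noteq> 0" for u y
  proof -
    have "u \<in> V - \<sigma> E" using that(1) by simp
    from bspec[OF spec this] obtain l where l: "lin_form_on {w \<in> vertices (lk \<Gamma> E). u \<in> \<sigma> {w}} l"
      "\<theta> (\<iota> u) - l \<in> ideal_gen (SR_gens (lk \<Gamma> E))"
      by (elim exE conjE)
    have "Poly_Mapping.lookup (\<theta> (\<iota> u) - l) (Poly_Mapping.single y 1) = 0"
      by (rule lookup_SR_ideal[OF sc\<Delta> l(2)]) (use that(2) in simp)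
    then have nz: "Poly_Mapping.lookup l (Poly_Mapping.single y 1) \<noteq> 0"
      using that(3) by (simp add: lookup_minus)
    obtain W where W: "W \<subseteq> {w \<in> vertices (lk \<Gamma> E). u \<in> \<sigma> {w}}"
      "\<And>w. w \<notin> W \<Longrightarrow> Poly_Mapping.lookup l (Poly_Mapping.single w 1) = 0"
      using lin_form_eq[OF l(1)] by metis
    then have "u \<in> \<sigma> {y}" using nz by blast
    moreover have "\<sigma> {y} \<subseteq> \<sigma> ({y} \<union> E)"
      by (rule carrier_mono[OF tri]) (use that(2) in \<open>auto simp: lk_def\<close>)
    ultimately show ?thesis by blast
  qed
  show "\<exists>\<alpha>. \<forall>y\<in>G. (\<Sum>i\<in>{..<card V - card E}. \<alpha> i * Poly_Mapping.lookup (\<theta> i) (Poly_Mapping.single y 1)) =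
      (if y = w then 1 else 0)" if "G \<in> lk \<Gamma> E" "w \<in> G" for G w
    by (rule lsop_spans[OF sc\<Delta> lsop that])
  show "hom_zero TYPE('k) (lk {H \<in> lk \<Gamma> E. \<sigma> (H \<union> E) \<subseteq> W} G) i"
    if W: "\<sigma> ({} \<union> E) \<subseteq> W" "W \<subseteq> V" and G: "G \<in> lk \<Gamma> E" "\<sigma> (G \<union> E) \<subseteq> W"
      and i: "i + 1 < int (card ({..<card V - card E} - \<iota> ` (V - W))) - int (card G)" for W G i
  proof -
    have sub: "V - W \<subseteq> V - \<sigma> E" using W by auto
    have "card (\<iota> ` (V - W)) = card (V - W)"
      by (rule card_image[OF inj_on_subset[OF \<iota>(1) sub]])
    moreover have im: "\<iota> ` (V - W) \<subseteq> {..<card V - card E}" using sub \<iota>(2) by blast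
    moreover have "card (V - W) = card V - card W" "card W \<le> card V"
      using W(2) V by (simp_all add: card_Diff_subset finite_subset card_mono)
    moreover have "card ({..<card V - card E} - \<iota> ` (V - W)) = card V - card E - card (\<iota> ` (V - W))"
      using im finite_subset[OF im] by (simp add: card_Diff_subset)
    moreover have "card (\<iota> ` (V - W)) \<le> card V - card E" using card_mono[OF _ im] by simp
    ultimately have N: "int (card ({..<card V - card E} - \<iota> ` (V - W))) = int (card W) - int (card E)"
      using card_face_le[OF tri E] by linarith
    have "finite G" "finite E" "G \<inter> E = {}"
      using simplicial_complex_finite[OF sc] E G(1) by (auto simp: lk_def)
    then have GE: "card (G \<union> E) = card G + card E" by (rule card_Un_disjoint)
    show ?thesis
    proof (cases "W = {}")
      case True
      \<comment> \<open>For empty \<open>W\<close> the bound forces \<open>i\<close> below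
        -1.\<close>
      then show ?thesis using i N by (intro hom_zero_below) simp
    next
      case False
      have "G \<union> E \<in> restr \<Gamma> \<sigma> W" using G by (simp add: restr_def lk_def)
      then show ?thesis
        unfolding lk_lk_restr[OF tri G]
        by (rule triangulation_link_hom_zero[OF tri W(2) False]) (use i N GE in simp)
    qed
  qed
qed

text \<open>Translates integer exponent vectors of face rings into exponents of polynomials; it is
  faithful on vectors that are nonnegative with finite support.\<close>

definition pm :: "('a \<Rightarrow> int) \<Rightarrow> 'a \<Rightarrow>\<^sub>0 nat" where
  "pm a = Poly_Mapping.Abs_poly_mapping (\<lambda>w. nat (a w))"

lemma lookup_pm:
  assumes "finite (supp a)"
  shows "Poly_Mapping.lookup (pm a) w = nat (a w)"
proof -
  have "finite {w. nat (a w) \<noteq> 0}" by (rule finite_subset[OF _ assms]) auto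
  then show ?thesis by (simp add: pm_def)
qed

section \<open>From ideal membership to relations between coefficient functions\<close>

context carrier_complex
begin

text \<open>Coefficients are compared only at monomials supported on faces, where elements of the
  Stanley-Reisner ideal have none.\<close>

lemma lin_rel_from_ideal:
  fixes \<theta> :: "'i \<Rightarrow> ('a, 'k) poly"
  assumes lin: "\<And>i. i \<in> N \<Longrightarrow> lin_form_on UNIV (\<theta> i)"
    and t: "t = (\<lambda>i y. Poly_Mapping.lookup (\<theta> i) (Poly_Mapping.single y 1))"
    and G: "G \<in> \<Delta>" and mem: "monom G \<in> ideal_gen (SR_gens \<Delta> \<union> \<theta> ` N)"
  shows "\<exists>g. lin_rel G g"
proof -
  obtain p0 q J where J: "finite J" "J \<subseteq> N" and p0: "p0 \<in> ideal_gen (SR_gens \<Delta>)"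
    and eq: "monom G = p0 + (\<Sum>i\<in>J. q i * \<theta> i)"
    using ideal_gen_Un_image[OF mem] by (elim exE conjE)
  have finG: "finite G" using simplicial_complex_finite[OF \<Delta> G] .
  have domV: "a \<in> dom V \<longleftrightarrow> (\<forall>w. 0 \<le> a w) \<and> supp a \<in> \<Delta>" for a
    using \<kappa>V unfolding dom_iff by blast
  define g where "g i a = (if i \<in> J \<and> a \<in> dom V then Poly_Mapping.lookup (q i) (pm a) else 0)" for i a
  have "(\<Sum>i\<in>N. \<Sum>y\<in>supp a. t i y * g i (dec a y)) = (if a = ind G then 1 else 0)" if a: "a \<in> dom V" for a
  proof -
    have pos: "\<And>w. 0 \<le> a w" and \<Delta>a: "supp a \<in> \<Delta>" using a domV by auto
    have fin: "finite (supp a)" using simplicial_complex_finite[OF \<Delta> \<Delta>a] .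
    have "w \<in> Poly_Mapping.keys (pm a) \<longleftrightarrow> w \<in> supp a" for w
      using pos[of w] by (auto simp: in_keys_iff lookup_pm[OF fin])
    then have keys: "Poly_Mapping.keys (pm a) = supp a" by (rule set_eqI)
    have dec_dom: "dec a y \<in> dom V" and pm_dec: "pm (dec a y) = pm a - Poly_Mapping.single y 1"
      if y: "y \<in> supp a" for y
    proof -
      have sub: "supp (dec a y) \<subseteq> supp a" by (rule supp_dec[OF y])
      have "0 < a y" using y pos[of y] by simp
      then have "0 \<le> dec a y w" for w using pos by (simp add: dec_def)
      then show "dec a y \<in> dom V" unfolding domV using simplicial_complexD[OF \<Delta> \<Delta>a sub] by blast
      have "Poly_Mapping.lookup (pm (dec a y)) w = Poly_Mapping.lookup (pm a - Poly_Mapping.single y 1) w" for w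
        unfolding lookup_pm[OF finite_subset[OF sub fin]] lookup_minus lookup_pm[OF fin] lookup_single
        by (simp add: dec_def when_def) arith
      then show "pm (dec a y) = pm a - Poly_Mapping.single y 1" by (rule poly_mapping_eqI)
    qed
    have "(\<Sum>i\<in>N. \<Sum>y\<in>supp a. t i y * g i (dec a y)) = (\<Sum>i\<in>J. \<Sum>y\<in>supp a. t i y * g i (dec a y))"
      using N J(2) by (intro sum.mono_neutral_right) (auto simp: g_def)
    also have "\<dots> = (\<Sum>i\<in>J. Poly_Mapping.lookup (q i * \<theta> i) (pm a))"
    proof (intro sum.cong refl)
      fix i assume i: "i \<in> J"
      have "(\<Sum>y\<in>supp a. t i y * g i (dec a y)) =
          (\<Sum>y\<in>supp a. t i y * Poly_Mapping.lookup (q i) (pm a - Poly_Mapping.single y 1))"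
        by (intro sum.cong refl) (simp add: g_def i dec_dom pm_dec)
      also have "\<dots> = Poly_Mapping.lookup (q i * \<theta> i) (pm a)"
        unfolding lookup_times_lin_form[OF lin[OF subsetD[OF J(2) i]]] keys t ..
      finally show "(\<Sum>y\<in>supp a. t i y * g i (dec a y)) = Poly_Mapping.lookup (q i * \<theta> i) (pm a)" .
    qed
    also have "\<dots> = Poly_Mapping.lookup (monom G) (pm a)"
      unfolding eq using lookup_SR_ideal[OF \<Delta> p0, of "pm a"] \<Delta>a by (simp add: lookup_add lookup_sum keys)
    also have "\<dots> = (if a = ind G then 1 else 0)"
    proof -
      have "(\<Sum>w\<in>G. Poly_Mapping.single w 1) = pm a \<longleftrightarrow> a = ind G"
      proof
        assume *: "(\<Sum>w\<in>G. Poly_Mapping.single w 1) = pm a"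
        have "nat (a w) = (if w \<in> G then 1 else 0)" for w
          using lookup_sum_single_one[OF finG, of w] unfolding * lookup_pm[OF fin] .
        then have "int (nat (a w)) = ind G w" for w by (simp add: ind_def)
        then show "a = ind G" using pos by (simp add: fun_eq_iff)
      next
        assume *: "a = ind G"
        show "(\<Sum>w\<in>G. Poly_Mapping.single w 1) = pm a"
          by (rule poly_mapping_eqI, unfold lookup_sum_single_one[OF finG] lookup_pm[OF fin]) (simp add: * ind_def)
      qed
      then show ?thesis unfolding monom_eq_single lookup_single by (simp add: when_def)
    qed
    finally show ?thesis .
  qed
  moreover have "i \<in> N \<and> a \<in> dom V" if "g i a \<noteq> 0" for i a
    using that J(2) by (auto simp: g_def split: if_splits)
  ultimately show ?thesis unfolding lin_rel_def by (intro exI[of _ g] conjI allI impI ballI) blast+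
qed

end

lemma homogeneous_monom: "finite G \<Longrightarrow> homogeneous (card G) (monom G)"
  unfolding homogeneous_def monom_eq_single
  by (simp add: tdeg_def[symmetric]) (induction G rule: finite_induct, simp_all add: tdeg_add tdeg_single, simp add: tdeg_def)

theorem theorem1p7:
  fixes \<Gamma> :: "'a::linorder set set" and \<sigma> :: "'a set \<Rightarrow> 'b set" and V :: "'b set"
    and E F F1 F2 :: "'a set" and \<theta> :: "nat \<Rightarrow> ('a, 'k::field) poly"
  assumes "infinite (UNIV :: 'k set)"
    and "homology_triangulation TYPE('k) \<Gamma> \<sigma> V"
    and "quasi_geometric \<Gamma> \<sigma> V"
    and "E \<in> \<Gamma>"
    and "special_lsop \<Gamma> \<sigma> V E \<theta>"
    and "local_h_zero \<Gamma> \<sigma> V E \<theta>"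
    and "F \<in> lk \<Gamma> E"
    and "interior \<Gamma> \<sigma> V (F \<union> E)"
    and "interior_partition \<Gamma> \<sigma> V E F F1 F2"
    and "card F1 \<le> 2"
  shows "U_pyramid \<Gamma> \<sigma> V E F"
proof (rule ccontr)
  assume not_pyramid: "\<not> U_pyramid \<Gamma> \<sigma> V E F"
  note tri = assms(2)
  define A where "A = apexes \<Gamma> \<sigma> V E F"
  have sc: "simplicial_complex \<Gamma>" and V: "finite V" and \<sigma>V: "\<And>F. F \<in> \<Gamma> \<Longrightarrow> \<sigma> F \<subseteq> V"
    using tri unfolding homology_triangulation_def by blast+
  have lsop: "lsop (lk \<Gamma> E) (card V - card E) \<theta>" using assms(5) by (simp add: special_lsop_def Let_def)
  obtain \<iota> where \<iota>: "inj_on \<iota> (V - \<sigma> E)" "\<iota> ` (V - \<sigma> E) \<subseteq> {..<card V - card E}"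
    "\<forall>v\<in>V - \<sigma> E. \<exists>l. lin_form_on {w \<in> vertices (lk \<Gamma> E). v \<in> \<sigma> {w}} l \<and>
      \<theta> (\<iota> v) - l \<in> ideal_gen (SR_gens (lk \<Gamma> E))"
    using assms(5) unfolding special_lsop_def Let_def by blast
  interpret carrier_complex "lk \<Gamma> E" "\<lambda>G. \<sigma> (G \<union> E)" V "{..<card V - card E}"
    "\<lambda>i y. Poly_Mapping.lookup (\<theta> i) (Poly_Mapping.single y 1)" \<iota>
    by (rule carrier_complex_lk[OF tri assms(4) lsop \<iota>])
  have part: "F = F1 \<union> F2 \<union> A" "F1 \<inter> F2 = {}" "F1 \<inter> A = {}" "F2 \<inter> A = {}"
    "\<sigma> (F1 \<union> A \<union> E) = V" "\<sigma> (F2 \<union> A \<union> E) = V"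
    using assms(9) by (auto simp: interior_partition_def Let_def A_def interior_def)
  have disj: "F \<inter> E = {}" and FE: "F \<union> E \<in> \<Gamma>" using assms(7) by (auto simp: lk_def)
  have apex: "\<exists>u\<in>V. \<exists>u'\<in>V. u \<noteq> u' \<and> u \<notin> \<sigma> (F - {w} \<union> E) \<and> u' \<notin> \<sigma> (F - {w} \<union> E)"
    if w: "w \<in> A" for w
  proof -
    have wF: "w \<in> F" and nint: "\<not> interior \<Gamma> \<sigma> V (F \<union> E - {w})" using w by (auto simp: A_def apexes_def)
    have eq: "F \<union> E - {w} = F - {w} \<union> E" using wF disj by blast
    have face: "F \<union> E - {w} \<in> \<Gamma>" by (rule simplicial_complexD[OF sc FE Diff_subset])
    \<comment> \<open>The set of lost elements is nonempty since \<open>w\<close> is an apex, and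
      not a singleton since \<open>F\<close> is not a U-pyramid.\<close>
    let ?D = "V - \<sigma> (F \<union> E - {w})"
    have "?D \<noteq> {}" using nint face \<sigma>V[OF face] by (auto simp: interior_def)
    moreover have "card ?D \<noteq> 1" using not_pyramid w by (auto simp: U_pyramid_def A_def)
    ultimately have "\<not> is_singleton ?D" "?D \<noteq> {}" by (simp_all add: is_singleton_altdef)
    then obtain u u' where "u \<in> ?D" "u' \<in> ?D" "u \<noteq> u'" using is_singletonI'[of ?D] by blast
    then show ?thesis unfolding eq by blast
  qed
  have rel: "\<exists>g. lin_rel G g" if G: "G \<in> lk \<Gamma> E" "\<sigma> (G \<union> E) = V" for G
  proof (rule lin_rel_from_ideal[OF _ refl G(1)])
    show "lin_form_on UNIV (\<theta> i)" if "i \<in> {..<card V - card E}" for i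
      using lsop that by (simp add: lsop_def)
    let ?I = "{monom F | F. F \<in> lk \<Gamma> E \<and> interior \<Gamma> \<sigma> V (F \<union> E)} :: ('a, 'k) poly set"
    have "monom G \<in> ?I" using G by (auto simp: interior_def lk_def)
    then have "monom G \<in> ideal_gen ?I"
      unfolding ideal_gen_def by (auto intro!: exI[of _ "{monom G}"] exI[of _ "\<lambda>_. 1"])
    moreover have "homogeneous (card G) (monom G :: ('a, 'k) poly)"
      by (rule homogeneous_monom) (rule simplicial_complex_finite[OF sc], use G in \<open>simp add: lk_def\<close>)
    ultimately show "monom G \<in> ideal_gen (SR_gens (lk \<Gamma> E) \<union> \<theta> ` {..<card V - card E})"
      using assms(6) unfolding local_h_zero_def by blast
  qed
  show False
    by (rule no_interior_partition[OF V assms(7) _ apex _ _ part(2) part(5,6) assms(10) rel])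
      (use part in auto)
qed

end
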